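(* Let $(T,\mathcal A,\mu)$ be a complete $\sigma$-finite measure space, and let $X$ be a separable Asplund space whose norm is $C^1$ away from the origin. Let $f,g:T\times X\to\overline{\mathbb R}$ be two normal integrands such that $f(t,x)\ge g(t,x)$ for all $t\in T$ and all $x\in X$, and such that $g_t:=g(t,\cdot)$ is $C^1$ for all $t\in T$. Assume that $t\mapsto\sup_{u\in X}\|\nabla g(t,u)\|$ belongs to $L^1(T,\mathbb R)$, and that $f$ is a convex normal integrand, i.e. $f_t$ is convex for all $t\in T$. Let $E_f(x)=\int_T f(t,x)\,d\mu(t)$ for $x\in X$. Then one has $x^*\in\partial E_f(x)$ if and only if there are nets $x_\nu\in L^\infty(T,X)$ and $x_\nu^*\in L^1(T,X^* )$ such that: (a) $x_\nu^*(t)\in\partial f(t,x_\nu(t))$ for almost every $t\in T$; (b) $\|x-x_\nu(\cdot)\|_\infty\to0$; (c) $\int_T x_\nu^*(t)\,d\mu(t)\to x^*$ in the weak$^*$ topology $w(X^*,X)$; (d) $\int_T\langle x_\nu^*(t),x_\nu(t)-x\rangle\,d\mu(t)\to0$; (e) $\int_T|f(t,x_\nu(t))-f(t,x)|\,d\mu(t)\to0$. If the space $X$ is reflexive, one can take sequences instead of nets, and the convergence of $\int_T x_\nu^*(t)\,d\mu(t)$ in (c) will be in the norm topology.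
   Context: A separable Asplund space is a separable Banach space $X$ whose dual $X^*$ is separable. $\overline{\mathbb R}=\mathbb R\cup\{\pm\infty\}$, with the convention $\infty+(-\infty)=+\infty$. A normal integrand is a function $f:T\times X\to\overline{\mathbb R}$ that is $\mathcal A\otimes\mathcal B(X)$-measurable ($\mathcal B(X)$ the Borel $\sigma$-algebra) and such that $f_t:=f(t,\cdot)$ is lower semicontinuous for every $t\in T$. Integrals of extended-real functions mean $\int h\,d\mu:=\int h^+d\mu+\int h^-d\mu$, with $h^+=\max\{h,0\}$, $h^-=\min\{h,0\}$ and the convention above. Integrals of $X^*$-valued functions are Bochner integrals. A function from $T$ to $X$ or $X^*$ is measurable if it is an a.e. norm-limit of simple functions; $L^1(T,X^* )$ is the usual Bochner space and $L^\infty(T,X)$ is the space of measurable essentially bounded functions with norm $\|x\|_\infty=\operatorname{ess\,sup}_{t}\|x(t)\|$. Elements of $X$ are identified with constant functions. Here $\partial$ is the convex (Fenchel) subdifferential: for convex $h$ and $x$ with $h(x)$ finite, $\partial h(x)=\{x^*\in X^*:\langle x^*,y-x\rangle\le h(y)-h(x)\ \forall y\in X\}$, and $\partial h(x)=\emptyset$ if $|h(x)|=+\infty$. For an integrand, $\partial f(t,x(t)):=\partial f_t(x(t))$.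
   Formalization: It is additionally assumed that E_f(x) and E_g(x) (the integral of g(·,x)) are finite at the given point x; without finiteness of E_f(x) the "if" part fails, and without finiteness of E_g(x) the "only if" part fails. *)

theory Defs
  imports "HOL-Analysis.Analysis" "HOL-Probability.Essential_Supremum"
begin

section \<open>Separable Asplund spaces\<close>

text \<open>A separable Banach space with separable dual. Separability of the space itself is expressed by
  \<open>second_countable_topology\<close>. The type \<open>'a \<Rightarrow>\<^sub>L real\<close> is not available inside the class
  declaration, which therefore speaks of plain functions and writes out density in the operator
  norm; lemma \<open>separable_dual_iff\<close> below restates the class axiom for \<open>'a \<Rightarrow>\<^sub>L real\<close>.\<close>

definition bounded_functionals ::
    "('a \<Rightarrow> 'a \<Rightarrow> 'a) \<Rightarrow> (real \<Rightarrow> 'a \<Rightarrow> 'a) \<Rightarrow> ('a \<Rightarrow> real) \<Rightarrow> ('a \<Rightarrow> real) set" where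
  "bounded_functionals plus_op smul nrm =
     {l. (\<forall>x y. l (plus_op x y) = l x + l y) \<and> (\<forall>c x. l (smul c x) = c * l x) \<and>
         (\<exists>K. \<forall>x. \<bar>l x\<bar> \<le> nrm x * K)}"

class separable_asplund = banach + second_countable_topology +
  assumes separable_dual_axiom:
    "\<exists>D \<subseteq> bounded_functionals (+) scaleR norm. countable D \<and>
       (\<forall>l \<in> bounded_functionals (+) scaleR norm. \<forall>e>0. \<exists>d\<in>D. \<forall>x. \<bar>d x - l x\<bar> \<le> e * norm x)"

lemma bounded_functionals_eq:
  "bounded_functionals (+) scaleR norm = Collect (bounded_linear :: ('a::real_normed_vector \<Rightarrow> real) \<Rightarrow> bool)"
proof (intro set_eqI)
  fix l :: "'a \<Rightarrow> real"
  have "linear l \<longleftrightarrow> (\<forall>x y. l (x + y) = l x + l y) \<and> (\<forall>c x. l (c *\<^sub>R x) = c * l x)"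
    by (simp add: linear_iff)
  then show "l \<in> bounded_functionals (+) scaleR norm \<longleftrightarrow> l \<in> Collect bounded_linear"
    unfolding bounded_functionals_def bounded_linear_def bounded_linear_axioms_def mem_Collect_eq
      real_norm_def
    by blast
qed

lemma separable_dual_iff:
  "separable_space (euclidean :: ('a::real_normed_vector \<Rightarrow>\<^sub>L real) topology) \<longleftrightarrow>
    (\<exists>D \<subseteq> bounded_functionals (+) scaleR (norm :: 'a \<Rightarrow> real). countable D \<and>
       (\<forall>l \<in> bounded_functionals (+) scaleR norm. \<forall>e>0. \<exists>d\<in>D. \<forall>x. \<bar>d x - l x\<bar> \<le> e * norm x))"
proof
  assume "separable_space (euclidean :: ('a \<Rightarrow>\<^sub>L real) topology)"
  then obtain C :: "('a \<Rightarrow>\<^sub>L real) set" where C: "countable C" "closure C = UNIV"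
    by (auto simp: separable_space_def)
  have "\<exists>d\<in>blinfun_apply ` C. \<forall>x. \<bar>d x - l x\<bar> \<le> e * norm x"
    if l: "bounded_linear l" and e: "e > 0" for l :: "'a \<Rightarrow> real" and e
  proof -
    obtain d where d: "d \<in> C" "dist d (Blinfun l) < e"
      using C(2) e closure_approachable[of "Blinfun l" C] by auto
    have "\<bar>d x - l x\<bar> \<le> e * norm x" for x
    proof -
      have "\<bar>d x - l x\<bar> = norm ((d - Blinfun l) x)"
        using l by (simp add: blinfun.diff_left bounded_linear_Blinfun_apply)
      also have "\<dots> \<le> norm (d - Blinfun l) * norm x" by (rule norm_blinfun)
      also have "\<dots> \<le> e * norm x"
        using d(2) by (intro mult_right_mono) (auto simp: dist_norm)
      finally show ?thesis .
    qed
    then show ?thesis using d(1) by auto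
  qed
  then show "\<exists>D \<subseteq> bounded_functionals (+) scaleR (norm :: 'a \<Rightarrow> real). countable D \<and>
       (\<forall>l \<in> bounded_functionals (+) scaleR norm. \<forall>e>0. \<exists>d\<in>D. \<forall>x. \<bar>d x - l x\<bar> \<le> e * norm x)"
    using C(1) unfolding bounded_functionals_eq
    by (intro exI[of _ "blinfun_apply ` C"] conjI ballI allI impI)
      (simp_all add: image_subset_iff blinfun.bounded_linear_right)
next
  assume "\<exists>D \<subseteq> bounded_functionals (+) scaleR (norm :: 'a \<Rightarrow> real). countable D \<and>
       (\<forall>l \<in> bounded_functionals (+) scaleR norm. \<forall>e>0. \<exists>d\<in>D. \<forall>x. \<bar>d x - l x\<bar> \<le> e * norm x)"
  then obtain D :: "('a \<Rightarrow> real) set"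
    where D: "D \<subseteq> Collect bounded_linear" "countable D"
      and dense: "\<And>l e. bounded_linear l \<Longrightarrow> e > 0 \<Longrightarrow> \<exists>d\<in>D. \<forall>x. \<bar>d x - l x\<bar> \<le> e * norm x"
    unfolding bounded_functionals_eq by blast
  have "l \<in> closure (Blinfun ` D)" for l
    unfolding closure_approachable
  proof (intro allI impI)
    fix e :: real assume e: "e > 0"
    then obtain d where d: "d \<in> D" "\<And>x. \<bar>d x - l x\<bar> \<le> e / 2 * norm x"
      using dense[of "blinfun_apply l" "e/2"] by (auto intro: blinfun.bounded_linear_right)
    have "norm (Blinfun d - l) \<le> e / 2"
      using d D(1) e
      by (intro norm_blinfun_bound) (auto simp: blinfun.diff_left bounded_linear_Blinfun_apply)
    then show "\<exists>y\<in>Blinfun ` D. dist y l < e"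
      using d(1) e by (auto simp: dist_norm intro!: bexI[of _ d])
  qed
  then show "separable_space (euclidean :: ('a \<Rightarrow>\<^sub>L real) topology)"
    unfolding separable_space_def using D(2) by (intro exI[of _ "Blinfun ` D"]) auto
qed

lemma separable_dual: "separable_space (euclidean :: ('a::separable_asplund \<Rightarrow>\<^sub>L real) topology)"
  unfolding separable_dual_iff by (rule separable_dual_axiom)

lemma second_countable_if_dense_metric:
  fixes D :: "'b::metric_space set"
  assumes "countable D" and dense: "\<And>x e. e > 0 \<Longrightarrow> \<exists>d\<in>D. dist d x < e"
  shows "\<exists>B::'b set set. countable B \<and> open = generate_topology B"
proof -
  define B where "B = (\<lambda>(d, n). ball d (inverse (real (Suc n)))) ` (D \<times> (UNIV::nat set))"
  have "countable B" unfolding B_def using assms(1) by auto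
  moreover have "topological_basis B"
  proof (rule topological_basisI)
    show "open b" if "b \<in> B" for b using that by (auto simp: B_def)
    fix O' :: "'b set" and x assume "open O'" "x \<in> O'"
    then obtain e where e: "e > 0" "ball x e \<subseteq> O'" by (meson open_contains_ball)
    obtain n where n: "inverse (real (Suc n)) < e / 2"
      using reals_Archimedean[of "e/2"] e by auto
    obtain d where d: "d \<in> D" "dist d x < inverse (real (Suc n))"
      using dense[of "inverse (real (Suc n))" x] by auto
    have "ball d (inverse (real (Suc n))) \<subseteq> ball x e"
    proof
      fix y assume "y \<in> ball d (inverse (real (Suc n)))"
      then show "y \<in> ball x e"
        using d(2) n dist_triangle[of x y d] by (simp add: dist_commute)
    qed
    then show "\<exists>b\<in>B. x \<in> b \<and> b \<subseteq> O'"
      using d e unfolding B_def by (intro bexI[of _ "ball d (inverse (real (Suc n)))"]) auto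
  qed
  ultimately have "countable B \<and> open = generate_topology B"
    by (simp add: topological_basis_imp_subbasis)
  then show ?thesis by blast
qed

text \<open>Hence the dual is an admissible range type for the Bochner integral of the library.\<close>

instance blinfun :: (separable_asplund, euclidean_space) second_countable_topology
proof (intro_classes, goal_cases)
  case 1
  obtain D :: "('a \<Rightarrow>\<^sub>L real) set" where D: "countable D" "closure D = UNIV"
    using separable_dual[where 'a='a] by (auto simp: separable_space_def)
  define E where "E = (\<lambda>\<phi>. \<Sum>b\<in>Basis. blinfun_scaleR_left b o\<^sub>L \<phi> b) `
      (PiE (Basis :: 'b set) (\<lambda>_. D))"
  show ?case
  proof (rule second_countable_if_dense_metric)
    show "countable E" unfolding E_def
      using D(1) by (intro countable_image countable_PiE) auto
    fix h :: "'a \<Rightarrow>\<^sub>L 'b" and e :: real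
    assume e: "e > 0"
    define c where "c = e / (DIM('b) + 1)"
    have c: "c > 0" using e by (simp add: c_def)
    have "\<exists>l\<in>D. dist l (blinfun_inner_left b o\<^sub>L h) < c" for b :: 'b
      using D(2) c closure_approachable[of "blinfun_inner_left b o\<^sub>L h" D] by auto
    then obtain \<phi> where \<phi>: "\<And>b::'b. \<phi> b \<in> D" "\<And>b. dist (\<phi> b) (blinfun_inner_left b o\<^sub>L h) < c"
      by metis
    define d where "d = (\<Sum>b\<in>Basis. blinfun_scaleR_left b o\<^sub>L \<phi> b)"
    have "d = (\<Sum>b\<in>Basis. blinfun_scaleR_left b o\<^sub>L (restrict \<phi> Basis) b)"
      by (simp add: d_def)
    then have "d \<in> E" unfolding E_def
      using \<phi>(1) by (intro image_eqI[of _ _ "restrict \<phi> Basis"]) auto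
    moreover have "norm (d - h) \<le> (\<Sum>b\<in>(Basis::'b set). c)"
    proof (rule norm_blinfun_bound)
      show "0 \<le> (\<Sum>b\<in>(Basis::'b set). c)" using c by (intro sum_nonneg) auto
      fix y
      have "(d - h) y = (\<Sum>b\<in>Basis. ((\<phi> b - (blinfun_inner_left b o\<^sub>L h)) y) *\<^sub>R b)"
      proof -
        have "(\<Sum>b\<in>Basis. (h y \<bullet> b) *\<^sub>R b) = h y"
          by (rule euclidean_representation)
        then show ?thesis
          by (simp add: d_def blinfun.diff_left blinfun.sum_left scaleR_diff_left sum_subtractf
              inner_commute)
      qed
      also have "norm \<dots> \<le> (\<Sum>b\<in>(Basis::'b set). c * norm y)"
      proof (rule sum_norm_le)
        fix b :: 'b assume b: "b \<in> Basis"
        have "norm ((\<phi> b - (blinfun_inner_left b o\<^sub>L h)) y)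
            \<le> norm (\<phi> b - (blinfun_inner_left b o\<^sub>L h)) * norm y"
          by (rule norm_blinfun)
        also have "\<dots> \<le> c * norm y"
          using \<phi>(2)[of b] by (intro mult_right_mono) (auto simp: dist_norm)
        finally show "norm (((\<phi> b - (blinfun_inner_left b o\<^sub>L h)) y) *\<^sub>R b) \<le> c * norm y"
          using b by simp
      qed
      finally show "norm ((d - h) y) \<le> (\<Sum>b\<in>(Basis::'b set). c) * norm y"
        by simp
    qed
    moreover have "(\<Sum>b\<in>(Basis::'b set). c) < e"
      using e by (simp add: c_def field_simps)
    ultimately show "\<exists>d\<in>E. dist d h < e"
      by (metis dist_norm le_less_trans)
  qed
qed

text \<open>Surjectivity of the canonical embedding into the bidual.\<close>

definition reflexive_space :: "'a::real_normed_vector itself \<Rightarrow> bool" where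
  "reflexive_space _ \<longleftrightarrow>
     (\<forall>\<Phi> :: ('a \<Rightarrow>\<^sub>L real) \<Rightarrow>\<^sub>L real. \<exists>x::'a. \<forall>l. blinfun_apply \<Phi> l = blinfun_apply l x)"


section \<open>Functions on a normed space\<close>

text \<open>Only meaningful at points of Frechet differentiability.\<close>

definition gradient :: "('a::real_normed_vector \<Rightarrow> real) \<Rightarrow> 'a \<Rightarrow> 'a \<Rightarrow>\<^sub>L real" where
  "gradient h x = Blinfun (frechet_derivative h (at x))"

definition C1_on :: "'a::real_normed_vector set \<Rightarrow> ('a \<Rightarrow> real) \<Rightarrow> bool" where
  "C1_on U h \<longleftrightarrow> (\<forall>x\<in>U. h differentiable (at x)) \<and> continuous_on U (gradient h)"

definition lsc :: "('a::topological_space \<Rightarrow> ereal) \<Rightarrow> bool" where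
  "lsc h \<longleftrightarrow> (\<forall>a. open {x. a < h x})"

text \<open>The addition of \<open>ereal\<close> satisfies \<open>\<infinity> + (- \<infinity>) = \<infinity>\<close>.\<close>

definition convex_ereal :: "('a::real_vector \<Rightarrow> ereal) \<Rightarrow> bool" where
  "convex_ereal h \<longleftrightarrow> (\<forall>x y. \<forall>s::real. 0 < s \<and> s < 1 \<longrightarrow>
     h (s *\<^sub>R x + (1 - s) *\<^sub>R y) \<le> ereal s * h x + ereal (1 - s) * h y)"

definition subdifferential ::
    "('a::real_normed_vector \<Rightarrow> ereal) \<Rightarrow> 'a \<Rightarrow> ('a \<Rightarrow>\<^sub>L real) set" where
  "subdifferential h x =
     (if \<bar>h x\<bar> = \<infinity> then {}
      else {l. \<forall>y. ereal (blinfun_apply l (y - x)) \<le> h y - h x})"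


section \<open>Integrands and integral functionals\<close>

definition normal_integrand :: "'t measure \<Rightarrow> ('t \<Rightarrow> 'a::topological_space \<Rightarrow> ereal) \<Rightarrow> bool" where
  "normal_integrand M f \<longleftrightarrow>
     case_prod f \<in> borel_measurable (M \<Otimes>\<^sub>M borel) \<and> (\<forall>t\<in>space M. lsc (f t))"

text \<open>The sum of the integrals of \<open>max h 0\<close> and \<open>min h 0\<close>, the latter being minus the
  integral of a nonnegative function; again \<open>\<infinity> + (- \<infinity>) = \<infinity>\<close>.\<close>

definition ereal_integral :: "'t measure \<Rightarrow> ('t \<Rightarrow> ereal) \<Rightarrow> ereal" where
  "ereal_integral M h =
     enn2ereal (\<integral>\<^sup>+ t. e2ennreal (max (h t) 0) \<partial>M)
     + (- enn2ereal (\<integral>\<^sup>+ t. e2ennreal (- min (h t) 0) \<partial>M))"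

definition integral_functional :: "'t measure \<Rightarrow> ('t \<Rightarrow> 'a \<Rightarrow> ereal) \<Rightarrow> 'a \<Rightarrow> ereal" where
  "integral_functional M f x = ereal_integral M (\<lambda>t. f t x)"

text \<open>The essential supremum is taken in \<open>ennreal\<close>, so that it is \<open>0\<close> for the null measure.\<close>

definition Linf_norm :: "'t measure \<Rightarrow> ('t \<Rightarrow> 'a::real_normed_vector) \<Rightarrow> ennreal" where
  "Linf_norm M u = esssup M (\<lambda>t. ennreal (norm (u t)))"

text \<open>Over a complete \<open>\<sigma>\<close>-finite measure space and with values in a separable Banach space, the
  a.e. norm-limits of simple functions are exactly the Borel measurable functions.\<close>

definition Linf :: "'t measure \<Rightarrow> ('t \<Rightarrow> 'a::{banach, second_countable_topology}) set" where
  "Linf M = {u \<in> borel_measurable M. Linf_norm M u < \<infinity>}"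


section \<open>Nets\<close>

text \<open>A net is a family indexed by a directed set \<open>I\<close>, with \<open>(i, j) \<in> r\<close> meaning that
  \<open>j\<close> is beyond \<open>i\<close>.  Its convergence is convergence along the filter of tails of \<open>I\<close>.
  HOL has no quantification over index types. For the weak* topology of the dual of \<open>'a\<close>, nets
  indexed by directed subsets of \<open>'a set \<times> nat\<close> (finite sets of test vectors and tolerances \<open>1/n\<close>)
  suffice for existence statements.\<close>

definition directed_set :: "'i set \<Rightarrow> 'i rel \<Rightarrow> bool" where
  "directed_set I r \<longleftrightarrow>
     I \<noteq> {} \<and> preorder_on I r \<and> (\<forall>i\<in>I. \<forall>j\<in>I. \<exists>k\<in>I. (i, k) \<in> r \<and> (j, k) \<in> r)"

definition tails :: "'i set \<Rightarrow> 'i rel \<Rightarrow> 'i filter" where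
  "tails I r = (INF i\<in>I. principal {j \<in> I. (i, j) \<in> r})"

lemma eventually_tails:
  assumes "directed_set I r"
  shows "eventually P (tails I r) \<longleftrightarrow> (\<exists>i\<in>I. \<forall>j\<in>I. (i, j) \<in> r \<longrightarrow> P j)"
proof -
  have tr: "trans r" and ne: "I \<noteq> {}"
    using assms by (auto simp: directed_set_def preorder_on_def)
  have base: "\<exists>k\<in>I. principal {l \<in> I. (k, l) \<in> r} \<le>
      inf (principal {l \<in> I. (i, l) \<in> r}) (principal {l \<in> I. (j, l) \<in> r})"
    if ij: "i \<in> I" "j \<in> I" for i j
  proof -
    obtain k where k: "k \<in> I" "(i, k) \<in> r" "(j, k) \<in> r"
      using assms ij unfolding directed_set_def by blast
    have "{l \<in> I. (k, l) \<in> r} \<subseteq> {l \<in> I. (i, l) \<in> r} \<inter> {l \<in> I. (j, l) \<in> r}"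
      using transD[OF tr k(2)] transD[OF tr k(3)] by blast
    then show ?thesis using k(1) by (intro bexI[of _ k]) simp_all
  qed
  have "eventually P (tails I r) \<longleftrightarrow>
      (\<exists>i\<in>I. eventually P (principal {j \<in> I. (i, j) \<in> r}))"
    unfolding tails_def by (rule eventually_INF_base[OF ne base])
  then show ?thesis unfolding eventually_principal by blast
qed

text \<open>Everything required of the two families \<open>u\<close> (in \<open>L\<^sup>\<infinity>(T, X)\<close>) and \<open>v\<close> (in \<open>L\<^sup>1(T, X\<^sup>*)\<close>), except
  for the convergence of the integrals of \<open>v\<close>, whose topology depends on the case considered.\<close>

definition approximating ::
    "'t measure \<Rightarrow> ('t \<Rightarrow> 'a::separable_asplund \<Rightarrow> ereal) \<Rightarrow> 'a \<Rightarrow> 'i set \<Rightarrow> 'i filter \<Rightarrow>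
     ('i \<Rightarrow> 't \<Rightarrow> 'a) \<Rightarrow> ('i \<Rightarrow> 't \<Rightarrow> 'a \<Rightarrow>\<^sub>L real) \<Rightarrow> bool" where
  "approximating M f x I F u v \<longleftrightarrow>
     (\<forall>\<nu>\<in>I. u \<nu> \<in> Linf M \<and> integrable M (v \<nu>)) \<and>
     (\<forall>\<nu>\<in>I. AE t in M. v \<nu> t \<in> subdifferential (f t) (u \<nu> t)) \<and>
     ((\<lambda>\<nu>. Linf_norm M (\<lambda>t. x - u \<nu> t)) \<longlongrightarrow> 0) F \<and>
     ((\<lambda>\<nu>. LINT t|M. blinfun_apply (v \<nu> t) (u \<nu> t - x)) \<longlongrightarrow> 0) F \<and>
     ((\<lambda>\<nu>. ereal_integral M (\<lambda>t. \<bar>f t (u \<nu> t) - f t x\<bar>)) \<longlongrightarrow> 0) F"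

end

theory Submission
  imports Defs "HOL-Library.Diagonal_Subsequence"
begin

text \<open>
  One direction integrates the subgradient inequalities and passes to the limit. For the other, after
  a translation of the argument, penalize the constraint that the selection be constant: for a smooth
  approximation \<open>\<psi>\<close> of the norm, minimize
  \[ J_n(y, u) = \int f(t, u(t)) + n\, p(t)\, \psi(u(t) - y)\, d\mu(t) - \langle x^*, y\rangle \]
  over functions \<open>u\<close> and vectors \<open>y\<close> in a weakly sequentially compact symmetric convex set \<open>C\<close>, where
  \<open>p\<close> is an integrable weight dominating the Lipschitz constants of the minorant. By Fatou's lemma the
  infimum tends to the value at \<open>(0, 0)\<close>, so Ekeland's principle gives a pair with almost vanishing
  variations. Varying \<open>u\<close> pointwise yields subgradients of \<open>f(t, \<cdot>)\<close> close to
  \<open>- n p(t) \<psi>'(u(t) - y)\<close>; varying \<open>y\<close> shows that their integral is close to \<open>x\<^sup>*\<close> on \<open>C\<close>.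
  Finite-dimensional discs \<open>C\<close> give nets, the unit ball of a reflexive space gives norm convergence.
  Measurable choices come from the projection theorem over a complete measure space: measurable sets of
  the product have Souslin representations, whose projections are approximated from inside.
\<close>

section \<open>Measurable selections\<close>

text \<open>Ekeland's principle controls the pair only in an \<open>L^1\<close> distance, while the
  theorem asks for uniform closeness over a measure that is merely sigma-finite. Hence the weight
  \<open>p\<close> is strictly positive as well as integrable, and \<open>u\<close> must be altered
  where it strays from \<open>y\<close>. The norm is smooth only away from the origin, hence its
  approximation sqrt(theta^2 + |z|^2) - theta, which is differentiable everywhere. The vector
  \<open>y\<close> is confined to \<open>C\<close> because Fatou's lemma needs a weakly convergent
  subsequence of such vectors; convexity turns lower semicontinuity into weak sequential lower
  semicontinuity. The price is that the integral of the subgradients is controlled on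
  \<open>C\<close> only. Scaling \<open>C\<close> down keeps \<open>y\<close> near the origin, and
  scaling the tolerance by the same factor loses nothing. Conditions (d) and (e) need just an upper
  bound on the integral of <v(t), u(t)>: the subgradient inequality tested at the origin bounds f(t,
  u(t)) - f(t, 0) above by this pairing, and the negative part of that difference is small in
  \<open>L^1\<close> by lower semicontinuity and domination.\<close>

lemma dense_sequence_exists:
  "\<exists>d :: nat \<Rightarrow> 'a::{metric_space, second_countable_topology}. \<forall>x e. 0 < e \<longrightarrow> (\<exists>n. dist (d n) x < e)"
proof -
  obtain S :: "'a set" where S: "countable S" "\<And>X. open X \<Longrightarrow> X \<noteq> {} \<Longrightarrow> \<exists>d\<in>S. d \<in> X"
    using countable_dense_setE by blast
  have "\<exists>n. dist (from_nat_into S n) x < e" if "0 < e" for x e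
  proof -
    obtain y where y: "y \<in> S" "y \<in> ball x e" using S(2)[of "ball x e"] \<open>0 < e\<close> by fastforce
    then show ?thesis using from_nat_into_surj[OF S(1) y(1)] by (auto simp: dist_commute)
  qed
  then show ?thesis by blast
qed

section \<open>The Souslin operation on measurable rectangles\<close>

definition closed_rectangle :: "'t measure \<Rightarrow> ('t \<times> 'a::topological_space) set \<Rightarrow> bool" where
  "closed_rectangle M R \<longleftrightarrow> (\<exists>A\<in>sets M. \<exists>F. closed F \<and> R = A \<times> F)"

text \<open>The Souslin operation over schemes of rectangles. Decrease along branches is not built
  in; it is arranged afterwards by intersecting over prefixes, which keeps the closure properties
  simple.\<close>

definition souslin :: "'t measure \<Rightarrow> ('t \<times> 'a::topological_space) set \<Rightarrow> bool" where
  "souslin M D \<longleftrightarrow> (\<exists>R :: nat list \<Rightarrow> _. (\<forall>l. closed_rectangle M (R l)) \<and>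
     D = {z. \<exists>\<sigma>. \<forall>k. z \<in> R (map \<sigma> [0..<k])})"

lemma souslin_rectangle:
  assumes "A \<in> sets M" "closed F"
  shows "souslin M (A \<times> F)"
  unfolding souslin_def closed_rectangle_def
  using assms by (intro exI[of _ "\<lambda>_. A \<times> F"]) auto

text \<open>Guarantees that the entries of row \<open>m\<close> with index below \<open>k\<close>
  all sit inside the prefix of length \<open>prod_encode (m, k)\<close>.\<close>

lemma prod_encode_strict_mono: "j < k \<Longrightarrow> prod_encode (m, j) < prod_encode (m, k)"
  by (rule lift_Suc_mono_less[of "\<lambda>j. prod_encode (m, j)"]) (simp_all add: prod_encode_def)

text \<open>A single sequence codes countably many:
  \<open>\<lambda>j. \<sigma> (prod_encode (m, j))\<close> is its row \<open>m\<close>. Every length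
  is \<open>prod_encode (m, k)\<close> for exactly one pair, so at that length \<open>R'\<close> can
  impose just the condition of order \<open>k\<close> on row \<open>m\<close>.\<close>

lemma souslin_INT:
  assumes "\<And>m::nat. souslin M (D m)"
  shows "souslin M (\<Inter>m. D m)"
proof -
  have "\<forall>m. \<exists>R :: nat list \<Rightarrow> _. (\<forall>l. closed_rectangle M (R l)) \<and>
      D m = {z. \<exists>\<sigma>. \<forall>k. z \<in> R (map \<sigma> [0..<k])}"
    using assms unfolding souslin_def by blast
  from choice[OF this] obtain R :: "nat \<Rightarrow> nat list \<Rightarrow> _" where "\<forall>m. (\<forall>l. closed_rectangle M (R m l)) \<and>
      D m = {z. \<exists>\<sigma>. \<forall>k. z \<in> R m (map \<sigma> [0..<k])}" ..
  then have R: "\<And>m l. closed_rectangle M (R m l)"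
    and D: "\<And>m. D m = {z. \<exists>\<sigma>. \<forall>k. z \<in> R m (map \<sigma> [0..<k])}"
    by simp_all
  define R' where "R' l = (case prod_decode (length l) of (m, k) \<Rightarrow>
      R m (map (\<lambda>j. l ! prod_encode (m, j)) [0..<k]))" for l
  have rect: "closed_rectangle M (R' l)" for l
    using R by (cases "prod_decode (length l)") (simp add: R'_def)
  have R'_eq: "R' (map \<sigma> [0..<prod_encode (m, k)]) = R m (map (\<lambda>j. \<sigma> (prod_encode (m, j))) [0..<k])" for \<sigma> m k
  proof -
    have "map (\<lambda>j. map \<sigma> [0..<prod_encode (m, k)] ! prod_encode (m, j)) [0..<k]
        = map (\<lambda>j. \<sigma> (prod_encode (m, j))) [0..<k]"
      by (rule map_cong) (auto simp: prod_encode_strict_mono)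
    then show ?thesis unfolding R'_def by (simp only: length_map length_upt prod_encode_inverse case_prod_conv diff_zero)
  qed
  have "(\<Inter>m. D m) = {z. \<exists>\<sigma>. \<forall>k. z \<in> R' (map \<sigma> [0..<k])}"
  proof (intro set_eqI iffI)
    fix z assume "z \<in> (\<Inter>m. D m)"
    then have "\<forall>m. \<exists>s. \<forall>k. z \<in> R m (map s [0..<k])" by (auto simp: D)
    then obtain s where s: "\<And>m k. z \<in> R m (map (s m) [0..<k])" by metis
    define \<sigma> where "\<sigma> n = (case prod_decode n of (m, j) \<Rightarrow> s m j)" for n
    have "z \<in> R' (map \<sigma> [0..<L])" for L
    proof -
      obtain m k where "L = prod_encode (m, k)" by (metis prod_decode_inverse surj_pair)
      then show ?thesis using s by (simp add: R'_eq \<sigma>_def)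
    qed
    then show "z \<in> {z. \<exists>\<sigma>. \<forall>k. z \<in> R' (map \<sigma> [0..<k])}" by blast
  next
    fix z assume "z \<in> {z. \<exists>\<sigma>. \<forall>k. z \<in> R' (map \<sigma> [0..<k])}"
    then obtain \<sigma> where \<sigma>: "\<And>k. z \<in> R' (map \<sigma> [0..<k])" by blast
    have "z \<in> R m (map (\<lambda>j. \<sigma> (prod_encode (m, j))) [0..<k])" for m k
      using \<sigma>[of "prod_encode (m, k)"] by (simp add: R'_eq)
    then show "z \<in> (\<Inter>m. D m)" unfolding D by blast
  qed
  then show ?thesis unfolding souslin_def using rect by blast
qed

lemma map_upt_Suc_Cons: "map \<sigma> [0..<Suc k] = \<sigma> 0 # map (\<lambda>i. \<sigma> (Suc i)) [0..<k]"
proof -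
  have "[0..<Suc k] = 0 # map Suc [0..<k]" by (simp add: upt_conv_Cons map_Suc_upt del: upt_Suc)
  then show ?thesis by (simp del: upt_Suc)
qed

text \<open>The first entry names the member of the union, the remaining ones form a branch through
  its scheme.\<close>

lemma souslin_UN:
  assumes "\<And>m::nat. souslin M (D m)"
  shows "souslin M (\<Union>m. D m)"
proof -
  have "\<forall>m. \<exists>R :: nat list \<Rightarrow> _. (\<forall>l. closed_rectangle M (R l)) \<and>
      D m = {z. \<exists>\<sigma>. \<forall>k. z \<in> R (map \<sigma> [0..<k])}"
    using assms unfolding souslin_def by blast
  from choice[OF this] obtain R :: "nat \<Rightarrow> nat list \<Rightarrow> _" where "\<forall>m. (\<forall>l. closed_rectangle M (R m l)) \<and>
      D m = {z. \<exists>\<sigma>. \<forall>k. z \<in> R m (map \<sigma> [0..<k])}" ..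
  then have R: "\<And>m l. closed_rectangle M (R m l)"
    and D: "\<And>m. D m = {z. \<exists>\<sigma>. \<forall>k. z \<in> R m (map \<sigma> [0..<k])}"
    by simp_all
  \<comment> \<open>On the empty list the only demand is membership in
    \<open>space M \<times> UNIV\<close>, which every rectangle implies.\<close>
  define R' where "R' l = (case l of [] \<Rightarrow> space M \<times> UNIV | i # l' \<Rightarrow> R i l')" for l
  have rect: "closed_rectangle M (R' l)" for l
  proof (cases l)
    case Nil
    have "closed_rectangle M (space M \<times> UNIV)" unfolding closed_rectangle_def by (metis closed_UNIV sets.top)
    then show ?thesis by (simp add: R'_def Nil)
  next
    case (Cons i k) then show ?thesis using R by (simp add: R'_def)
  qed
  have sub: "R m l \<subseteq> space M \<times> UNIV" for m l
    using R[of m l] sets.sets_into_space by (fastforce simp: closed_rectangle_def)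
  have R'_eq: "(\<forall>k. z \<in> R' (map \<sigma> [0..<k])) \<longleftrightarrow> (\<forall>k. z \<in> R (\<sigma> 0) (map (\<lambda>i. \<sigma> (Suc i)) [0..<k]))" for z \<sigma>
  proof
    assume *: "\<forall>k. z \<in> R' (map \<sigma> [0..<k])"
    show "\<forall>k. z \<in> R (\<sigma> 0) (map (\<lambda>i. \<sigma> (Suc i)) [0..<k])"
    proof
      fix k show "z \<in> R (\<sigma> 0) (map (\<lambda>i. \<sigma> (Suc i)) [0..<k])"
        using *[rule_format, of "Suc k"] unfolding map_upt_Suc_Cons by (simp add: R'_def)
    qed
  next
    assume *: "\<forall>k. z \<in> R (\<sigma> 0) (map (\<lambda>i. \<sigma> (Suc i)) [0..<k])"
    show "\<forall>k. z \<in> R' (map \<sigma> [0..<k])"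
    proof
      fix k show "z \<in> R' (map \<sigma> [0..<k])"
      proof (cases k)
        case 0 then show ?thesis using * sub by (auto simp: R'_def)
      next
        case (Suc k') then show ?thesis using * unfolding Suc map_upt_Suc_Cons by (simp add: R'_def)
      qed
    qed
  qed
  have "(\<Union>m. D m) = {z. \<exists>\<sigma>. \<forall>k. z \<in> R' (map \<sigma> [0..<k])}"
  proof (intro set_eqI iffI)
    fix z assume "z \<in> (\<Union>m. D m)"
    then obtain m s where s: "\<And>k. z \<in> R m (map s [0..<k])" by (auto simp: D)
    show "z \<in> {z. \<exists>\<sigma>. \<forall>k. z \<in> R' (map \<sigma> [0..<k])}"
      unfolding R'_eq using s by (intro CollectI exI[of _ "case_nat m s"]) simp
  next
    fix z assume "z \<in> {z. \<exists>\<sigma>. \<forall>k. z \<in> R' (map \<sigma> [0..<k])}"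
    then show "z \<in> (\<Union>m. D m)" unfolding R'_eq D by blast
  qed
  then show ?thesis unfolding souslin_def using rect by blast
qed

lemma souslin_Int:
  assumes "souslin M A" "souslin M B"
  shows "souslin M (A \<inter> B)"
proof -
  have "A \<inter> B = (\<Inter>m::nat. if m = 0 then A else B)"
    by (auto split: if_splits)
  then show ?thesis using souslin_INT[of M "\<lambda>m. if m = 0 then A else B"] assms by simp
qed

lemma souslin_Un:
  assumes "souslin M A" "souslin M B"
  shows "souslin M (A \<union> B)"
proof -
  have "A \<union> B = (\<Union>m::nat. if m = 0 then A else B)"
    by (auto split: if_splits)
  then show ?thesis using souslin_UN[of M "\<lambda>m. if m = 0 then A else B"] assms by simp
qed

text \<open>Complements of Souslin sets need not be Souslin, so the induction over the generated
  sigma-algebra runs over sets that are Souslin together with their complements.\<close>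

lemma souslin_if_measurable:
  fixes D :: "('t \<times> 'a::metric_space) set"
  assumes "D \<in> sets (M \<Otimes>\<^sub>M borel)"
  shows "souslin M D"
proof -
  let ?Z = "\<lambda>D::('t \<times> 'a) set. souslin M D \<and> souslin M (space M \<times> UNIV - D)"
  have Z_compl: "?Z (space M \<times> UNIV - D)" if "?Z D" "D \<subseteq> space M \<times> UNIV" for D
    using that by (simp add: double_diff)
  have Z_UN: "?Z (\<Union>m. D m)" if "\<And>m::nat. ?Z (D m)" for D
  proof -
    have "space M \<times> UNIV - (\<Union>m. D m) = (\<Inter>m. space M \<times> UNIV - D m)" by auto
    then show ?thesis using that souslin_UN[of M D] souslin_INT[of M "\<lambda>m. space M \<times> UNIV - D m"]
      by (simp only:)
  qed
  have Z_Int: "?Z (A \<inter> B)" if "?Z A" "?Z B" for A B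
  proof -
    have "space M \<times> UNIV - (A \<inter> B) = (space M \<times> UNIV - A) \<union> (space M \<times> UNIV - B)" by auto
    then show ?thesis using that by (auto intro!: souslin_Un souslin_Int simp del: Diff_Int)
  qed
  have Z_left: "?Z (a \<times> UNIV)" if "a \<in> sets M" for a
  proof -
    have "space M \<times> UNIV - a \<times> UNIV = (space M - a) \<times> (UNIV :: 'a set)" by auto
    then show ?thesis using that by (auto intro!: souslin_rectangle)
  qed
  have Z_empty: "?Z {}"
    using Z_left[of "{}"] by simp
  have Z_right: "?Z (space M \<times> b)" if "b \<in> sets borel" for b
  proof -
    have Z_right_compl: "?Z (space M \<times> (UNIV - b))" if "?Z (space M \<times> b)" for b
    proof -
      have "space M \<times> (UNIV - b) = space M \<times> UNIV - space M \<times> b" by auto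
      moreover have "space M \<times> b \<subseteq> space M \<times> UNIV" by auto
      ultimately show ?thesis using Z_compl[of "space M \<times> b"] that by presburger
    qed
    have "b \<in> sigma_sets UNIV (Collect closed)" using that by (simp add: borel_eq_closed)
    then show ?thesis
    proof induction
      case (Basic b)
      then have b: "closed b" by simp
      \<comment> \<open>An open set of a metric space is a countable union of closed sets, which
        makes the complement of a closed strip Souslin.\<close>
      have "open (- b)" using b by (simp add: open_Compl)
      then obtain C where C: "\<And>n::nat. closed (C n)" "(\<Union>n. C n) = - b"
        using open_imp_fsigma_in[of "euclidean :: 'a topology" "- b"]
        by (auto simp: fsigma_in_ascending metrizable_space_euclidean)
      have eq: "space M \<times> UNIV - space M \<times> b = (\<Union>n. space M \<times> C n)" using C(2) by auto
      show ?case unfolding eq using b C(1) by (auto intro!: souslin_rectangle souslin_UN)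
    next
      case Empty then show ?case using Z_empty by simp
    next
      case (Compl b) then show ?case using Z_right_compl by blast
    next
      case (Union b)
      have "space M \<times> (\<Union>i. b i) = (\<Union>i. space M \<times> b i)" by auto
      then show ?case using Z_UN[of "\<lambda>i. space M \<times> b i"] Union by simp
    qed
  qed
  have "D \<in> sigma_sets (space M \<times> UNIV) {a \<times> b | a b. a \<in> sets M \<and> b \<in> sets (borel :: 'a measure)}"
    using assms by (simp add: sets_pair_measure)
  then have "?Z D"
  proof induction
    case (Basic D)
    then obtain a b where "D = a \<times> b" "a \<in> sets M" "b \<in> sets borel" by blast
    then have "D = (a \<times> UNIV) \<inter> (space M \<times> b)" using sets.sets_into_space by fastforce
    then show ?case using Z_Int[OF Z_left Z_right] \<open>a \<in> sets M\<close> \<open>b \<in> sets borel\<close> by simp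
  next
    case Empty then show ?case by (rule Z_empty)
  next
    case (Compl D)
    then show ?case using Z_compl[of D] sigma_sets_into_sp[OF pair_measure_closed[of M borel]] by auto
  next
    case (Union D) then show ?case using Z_UN[of D] by blast
  qed
  then show ?thesis by blast
qed

section \<open>Projections of Souslin sets\<close>

definition projection :: "(nat list \<Rightarrow> 't set) \<Rightarrow> (nat list \<Rightarrow> 'a set) \<Rightarrow> 't set" where
  "projection A F = {t. \<exists>\<sigma> x. \<forall>k. t \<in> A (map \<sigma> [0..<k]) \<and> x \<in> F (map \<sigma> [0..<k])}"

text \<open>On a regular scheme over a complete space a branch carries a point as soon as all its
  sets \<open>F\<close> are nonempty. A condition on lists thus replaces the existence of
  \<open>x\<close>. The empty list has no radius, since \<open>F []\<close> may be the whole
  space.\<close>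

definition regular_scheme :: "(nat list \<Rightarrow> 't set) \<Rightarrow> (nat list \<Rightarrow> 'a::metric_space set) \<Rightarrow> bool" where
  "regular_scheme A F \<longleftrightarrow> (\<forall>l. closed (F l)) \<and> (\<forall>l i. A (l @ [i]) \<subseteq> A l \<and> F (l @ [i]) \<subseteq> F l) \<and>
     (\<forall>l. l \<noteq> [] \<longrightarrow> (\<exists>d. F l \<subseteq> cball d ((1/2) ^ length l)))"

lemma chain_eq_map_upt:
  assumes "c 0 = []" "\<And>k. c (Suc k) = c k @ [s k]"
  shows "c k = map s [0..<k]"
  using assms by (induction k) auto

text \<open>Koenig's lemma for trees whose entry at place \<open>i\<close> is at most
  \<open>b i\<close>. A list is \<open>good\<close> if it has bounded extensions in \<open>W\<close>
  of every length; goodness passes to some child, and the chosen children form the branch.\<close>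

lemma koenig:
  fixes W :: "nat list set"
  assumes prefix: "\<And>l i. l @ [i] \<in> W \<Longrightarrow> l \<in> W"
    and ex: "\<And>j. \<exists>l\<in>W. length l = j \<and> (\<forall>i<j. l ! i \<le> b i)"
  shows "\<exists>\<sigma>. \<forall>k. map \<sigma> [0..<k] \<in> W"
proof -
  define good where "good l \<longleftrightarrow> (\<forall>j\<ge>length l. \<exists>l'\<in>W. length l' = j \<and> (\<forall>i<j. l' ! i \<le> b i)
     \<and> take (length l) l' = l)" for l
  have take_W: "take n l \<in> W" if "l \<in> W" for l n
    using that
  proof (induction l rule: rev_induct)
    case (snoc i l) then show ?case using prefix by (cases "n \<le> length l") auto
  qed simp
  have step: "\<exists>i. good (l @ [i])" if "good l" for l
  proof (rule ccontr)
    assume "\<not> ?thesis"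
    then have "\<forall>i. \<exists>j\<ge>Suc (length l). \<forall>l'\<in>W. length l' = j \<and> (\<forall>i<j. l' ! i \<le> b i)
        \<longrightarrow> take (Suc (length l)) l' \<noteq> l @ [i]"
      unfolding good_def by (metis length_append_singleton)
    then obtain J where J: "\<And>i. J i \<ge> Suc (length l)"
      "\<And>i l'. l' \<in> W \<Longrightarrow> length l' = J i \<Longrightarrow> (\<forall>n<J i. l' ! n \<le> b n) \<Longrightarrow> take (Suc (length l)) l' \<noteq> l @ [i]"
      by metis
    \<comment> \<open>Only finitely many children are admissible, so one length \<open>N\<close>
      exceeds all the lengths \<open>J i\<close> at which they are supposed to fail; an extension of
      that length runs through one of them.\<close>
    define N where "N = Max (J ` {..b (length l)})"
    have N: "J i \<le> N" if "i \<le> b (length l)" for i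
      using that by (auto simp: N_def)
    have lenN: "Suc (length l) \<le> N" using N[of 0] J(1)[of 0] by simp
    then have "length l \<le> N" by simp
    then obtain l' where l': "l' \<in> W" "length l' = N" "\<forall>i<N. l' ! i \<le> b i" "take (length l) l' = l"
      using \<open>good l\<close> unfolding good_def by blast
    define i where "i = l' ! length l"
    have i: "i \<le> b (length l)" using l'(3) lenN by (simp add: i_def)
    have "take (Suc (length l)) l' = l @ [i]"
      using l'(2,4) lenN by (simp add: i_def take_Suc_conv_app_nth)
    then have "take (Suc (length l)) (take (J i) l') = l @ [i]"
      using J(1)[of i] by (simp add: min_def)
    moreover have "take (J i) l' \<in> W" "length (take (J i) l') = J i" "\<forall>n<J i. take (J i) l' ! n \<le> b n"
      using take_W l' N[OF i] by auto
    ultimately show False using J(2) by blast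
  qed
  have good0: "good []" unfolding good_def using ex by simp
  define nx where "nx l = (SOME i. good (l @ [i]))" for l
  define c where "c = rec_nat [] (\<lambda>_ l. l @ [nx l])"
  have c: "c 0 = []" "\<And>k. c (Suc k) = c k @ [nx (c k)]" by (simp_all add: c_def)
  have "good (c k)" for k
  proof (induction k)
    case (Suc k) then show ?case unfolding c nx_def by (rule someI_ex[OF step])
  qed (simp add: c good0)
  moreover have "l \<in> W" if "good l" for l
    using that unfolding good_def by (metis order_refl take_all)
  moreover have "c k = map (\<lambda>k. nx (c k)) [0..<k]" for k
    by (rule chain_eq_map_upt) (use c in auto)
  ultimately show ?thesis by metis
qed

text \<open>Cantor's intersection theorem along the branch: closed nested sets with radii tending to
  zero.\<close>

lemma regular_scheme_branch_point:
  fixes F :: "nat list \<Rightarrow> 'a::complete_space set"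
  assumes reg: "regular_scheme A F" and ne: "\<And>k. F (map \<sigma> [0..<k]) \<noteq> {}"
  shows "\<exists>x. \<forall>k. x \<in> F (map \<sigma> [0..<k])"
proof -
  have mono: "F (map \<sigma> [0..<n]) \<subseteq> F (map \<sigma> [0..<m])" if "m \<le> n" for m n
    using that
  proof (induction rule: dec_induct)
    case (step n)
    have "F (map \<sigma> [0..<n] @ [\<sigma> n]) \<subseteq> F (map \<sigma> [0..<n])"
      using reg unfolding regular_scheme_def by blast
    then show ?case using step.IH by simp
  qed simp
  have diam: "\<exists>n. \<forall>x\<in>F (map \<sigma> [0..<n]). \<forall>y\<in>F (map \<sigma> [0..<n]). dist x y < e" if "e > 0" for e
  proof -
    obtain n where n: "(1/2::real) ^ n < e / 2"
      using real_arch_pow_inv[OF half_gt_zero[OF \<open>e > 0\<close>], of "1/2"] by auto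
    have "(1/2::real) ^ Suc n \<le> (1/2) ^ n" by (rule power_decreasing) auto
    then have n': "(1/2::real) ^ Suc n < e / 2" using n by linarith
    obtain d where d: "F (map \<sigma> [0..<Suc n]) \<subseteq> cball d ((1/2) ^ Suc n)"
      using reg unfolding regular_scheme_def
      by (metis diff_zero length_map length_upt list.size(3) nat.simps(3))
    show ?thesis
    proof (intro exI[of _ "Suc n"] ballI)
      fix x y assume "x \<in> F (map \<sigma> [0..<Suc n])" "y \<in> F (map \<sigma> [0..<Suc n])"
      then have "dist d x \<le> (1/2) ^ Suc n" "dist d y \<le> (1/2) ^ Suc n" using d by auto
      then show "dist x y < e" using n' dist_triangle3[of x y d] by linarith
    qed
  qed
  show ?thesis
    by (rule decreasing_closed_nest[of "\<lambda>k. F (map \<sigma> [0..<k])"])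
      (use reg ne mono diam in \<open>auto simp: regular_scheme_def\<close>)
qed

text \<open>Lusin's argument. \<open>P b\<close> keeps the points with a branch bounded by
  \<open>b\<close>. Outer measure is continuous along increasing sequences of arbitrary sets, so the
  bounds can be chosen one entry after another with small loss. The points with bounded branches are
  caught by measurable sets \<open>Q j\<close>, whose intersection lies in the projection by
  Koenig's lemma.\<close>

lemma (in finite_measure) projection_inner_approx:
  fixes F :: "nat list \<Rightarrow> 'b::complete_space set"
  assumes reg: "regular_scheme A F" and A: "\<And>l. A l \<in> sets M" and e: "e > 0"
  shows "\<exists>Q\<in>sets M. Q \<subseteq> projection A F \<and> outer_measure_of M (projection A F) \<le> emeasure M Q + ennreal e"
proof -
  define P where "P b = {t. \<exists>\<sigma> x. (\<forall>i<length b. \<sigma> i \<le> b ! i) \<and>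
      (\<forall>k. t \<in> A (map \<sigma> [0..<k]) \<and> x \<in> F (map \<sigma> [0..<k]))}" for b
  have P_Nil: "P [] = projection A F" by (simp add: P_def projection_def)
  have P_sub: "P b \<subseteq> space M" for b
  proof
    fix t assume "t \<in> P b"
    then obtain \<sigma> where "t \<in> A (map \<sigma> [0..<0])" unfolding P_def by blast
    then show "t \<in> space M" using sets.sets_into_space[OF A] by blast
  qed
  have P_snoc: "P b = (\<Union>m. P (b @ [m]))" for b
  proof (intro set_eqI iffI)
    fix t assume "t \<in> P b"
    then obtain \<sigma> x where \<sigma>: "\<forall>i<length b. \<sigma> i \<le> b ! i"
      "\<forall>k. t \<in> A (map \<sigma> [0..<k]) \<and> x \<in> F (map \<sigma> [0..<k])" unfolding P_def by blast
    have "\<forall>i<length (b @ [\<sigma> (length b)]). \<sigma> i \<le> (b @ [\<sigma> (length b)]) ! i"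
      using \<sigma>(1) by (auto simp: nth_append less_Suc_eq)
    then show "t \<in> (\<Union>m. P (b @ [m]))" unfolding P_def using \<sigma>(2) by blast
  next
    fix t assume "t \<in> (\<Union>m. P (b @ [m]))"
    then obtain m \<sigma> x where \<sigma>: "\<forall>i<length (b @ [m]). \<sigma> i \<le> (b @ [m]) ! i"
      "\<forall>k. t \<in> A (map \<sigma> [0..<k]) \<and> x \<in> F (map \<sigma> [0..<k])" unfolding P_def by blast
    have "\<forall>i<length b. \<sigma> i \<le> b ! i" using \<sigma>(1) by (auto simp: nth_append split: if_splits)
    then show "t \<in> P b" unfolding P_def using \<sigma>(2) by blast
  qed
  have P_inc: "incseq (\<lambda>m. P (b @ [m]))" for b
  proof (intro incseq_SucI subsetI)
    fix m t assume "t \<in> P (b @ [m])"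
    then obtain \<sigma> x where \<sigma>: "\<forall>i<length (b @ [m]). \<sigma> i \<le> (b @ [m]) ! i"
      "\<forall>k. t \<in> A (map \<sigma> [0..<k]) \<and> x \<in> F (map \<sigma> [0..<k])" unfolding P_def by blast
    have "\<sigma> i \<le> (b @ [Suc m]) ! i" if "i < length (b @ [Suc m])" for i
      using \<sigma>(1)[rule_format, of i] that by (cases "i < length b") (auto simp: nth_append)
    then show "t \<in> P (b @ [Suc m])" unfolding P_def using \<sigma>(2) by blast
  qed
  have fin: "outer_measure_of M (P b) < \<infinity>" for b
  proof -
    have "outer_measure_of M (P b) \<le> emeasure M (space M)"
      using outer_measure_of_mono[OF P_sub[of b], of M] by (simp only: outer_measure_of_eq sets.top)
    also have "\<dots> < \<infinity>" using emeasure_finite[of "space M"] by (metis infinity_ennreal_def top.not_eq_extremum)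
    finally show ?thesis .
  qed
  have "\<exists>m. outer_measure_of M (P b) \<le> outer_measure_of M (P (b @ [m])) + ennreal r" if "r > 0" for b r
  proof -
    have "(SUP m. outer_measure_of M (P (b @ [m]))) = outer_measure_of M (P b)"
      unfolding P_snoc[of b] by (rule SUP_outer_measure_of_incseq[OF P_sub P_inc])
    then show ?thesis
      using SUP_approx_ennreal[of r UNIV "outer_measure_of M (P b)" "\<lambda>m. outer_measure_of M (P (b @ [m]))"]
        fin[of b] that by (metis UNIV_not_empty infinity_ennreal_def less_imp_le order_less_irrefl)
  qed
  then have "\<forall>b r. \<exists>m. r > 0 \<longrightarrow> outer_measure_of M (P b) \<le> outer_measure_of M (P (b @ [m])) + ennreal r" by blast
  then obtain m where m: "\<And>b r. r > 0 \<Longrightarrow> outer_measure_of M (P b) \<le> outer_measure_of M (P (b @ [m b r])) + ennreal r"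
    by metis
  \<comment> \<open>Losing \<open>e * (1/2) ^ Suc j\<close> at step \<open>j\<close> gives a total
    of \<open>e * (1 - (1/2) ^ j)\<close> before step \<open>j\<close>, hence never more than
    \<open>e\<close>.\<close>
  define L where "L = rec_nat [] (\<lambda>j b. b @ [m b (e * (1/2) ^ Suc j)])"
  have L: "L 0 = []" "\<And>j. L (Suc j) = L j @ [m (L j) (e * (1/2) ^ Suc j)]" by (simp_all add: L_def)
  define b where "b j = m (L j) (e * (1/2) ^ Suc j)" for j
  have L_eq: "L j = map b [0..<j]" for j
    by (rule chain_eq_map_upt) (simp_all add: L b_def)
  have approx: "outer_measure_of M (projection A F) \<le> outer_measure_of M (P (L j)) + ennreal (e * (1 - (1/2) ^ j))" for j
  proof (induction j)
    case 0 then show ?case by (simp add: L P_Nil)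
  next
    case (Suc j)
    have "outer_measure_of M (projection A F) \<le> outer_measure_of M (P (L j)) + ennreal (e * (1 - (1/2) ^ j))"
      by (rule Suc)
    also have "\<dots> \<le> outer_measure_of M (P (L (Suc j))) + ennreal (e * (1/2) ^ Suc j) + ennreal (e * (1 - (1/2) ^ j))"
      unfolding L(2) by (intro add_right_mono m) (use e in auto)
    also have "\<dots> = outer_measure_of M (P (L (Suc j))) + ennreal (e * (1/2) ^ Suc j + e * (1 - (1/2) ^ j))"
      using e by (subst ennreal_plus) (auto simp: add.assoc power_le_one)
    also have "e * (1/2) ^ Suc j + e * (1 - (1/2) ^ j) = e * (1 - (1/2) ^ Suc j)"
      by (simp add: algebra_simps)
    finally show ?case .
  qed
  \<comment> \<open>Asking for nonempty \<open>F l\<close> instead of a common point makes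
    \<open>Q j\<close> a countable union of measurable sets; the common point is recovered at the
    end along a whole branch.\<close>
  define Q where "Q j = (\<Union>l\<in>{l. length l = j \<and> (\<forall>i<j. l ! i \<le> b i) \<and> F l \<noteq> {}}. A l)" for j
  have Q_sets: "Q j \<in> sets M" for j
    unfolding Q_def by (intro sets.countable_UN'' A) auto
  have P_Q: "P (L j) \<subseteq> Q j" for j
  proof
    fix t assume "t \<in> P (L j)"
    then obtain \<sigma> x where \<sigma>: "\<forall>i<j. \<sigma> i \<le> b i"
      "\<forall>k. t \<in> A (map \<sigma> [0..<k]) \<and> x \<in> F (map \<sigma> [0..<k])" unfolding P_def by (auto simp: L_eq)
    show "t \<in> Q j" unfolding Q_def using \<sigma>
      by (intro UN_I[of "map \<sigma> [0..<j]"]) auto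
  qed
  have dec: "decseq Q"
  proof (rule decseq_SucI, rule subsetI)
    fix j t assume "t \<in> Q (Suc j)"
    then obtain l where l: "length l = Suc j" "\<forall>i<Suc j. l ! i \<le> b i" "F l \<noteq> {}" "t \<in> A l"
      unfolding Q_def by blast
    then obtain l' i where l': "l = l' @ [i]" by (metis length_Suc_conv_rev)
    have "t \<in> A l'" "F l' \<noteq> {}" using reg l l' unfolding regular_scheme_def by blast+
    moreover have "\<forall>i<j. l' ! i \<le> b i"
    proof (intro allI impI)
      fix n assume "n < j" then show "l' ! n \<le> b n" using l(1) l(2)[rule_format, of n] l' by (simp add: nth_append)
    qed
    ultimately show "t \<in> Q j" unfolding Q_def using l(1) l' by auto
  qed
  have sub: "(\<Inter>j. Q j) \<subseteq> projection A F"
  proof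
    fix t assume t: "t \<in> (\<Inter>j. Q j)"
    define W where "W = {l. t \<in> A l \<and> F l \<noteq> {}}"
    have "\<exists>\<sigma>. \<forall>k. map \<sigma> [0..<k] \<in> W"
    proof (rule koenig[of W b])
      show "l \<in> W" if "l @ [i] \<in> W" for l i
        using that reg unfolding W_def regular_scheme_def by blast
      show "\<exists>l\<in>W. length l = j \<and> (\<forall>i<j. l ! i \<le> b i)" for j
        using t unfolding Q_def W_def by blast
    qed
    then obtain \<sigma> where \<sigma>: "\<And>k. t \<in> A (map \<sigma> [0..<k])" "\<And>k. F (map \<sigma> [0..<k]) \<noteq> {}"
      unfolding W_def by blast
    show "t \<in> projection A F"
      using regular_scheme_branch_point[OF reg \<sigma>(2)] \<sigma>(1) unfolding projection_def by blast
  qed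
  have "outer_measure_of M (projection A F) \<le> emeasure M (Q j) + ennreal e" for j
  proof -
    have "outer_measure_of M (projection A F) \<le> outer_measure_of M (P (L j)) + ennreal (e * (1 - (1/2) ^ j))"
      by (rule approx)
    also have "\<dots> \<le> emeasure M (Q j) + ennreal e"
      using outer_measure_of_mono[OF P_Q[of j], of M] e Q_sets[of j]
      by (intro add_mono ennreal_leI) (auto simp: mult_left_le)
    finally show ?thesis .
  qed
  then have "outer_measure_of M (projection A F) \<le> (INF j. emeasure M (Q j) + ennreal e)"
    by (intro INF_greatest) auto
  also have "\<dots> = (INF j. emeasure M (Q j)) + ennreal e"
    by (simp add: add.commute INF_ennreal_const_add)
  also have "(INF j. emeasure M (Q j)) = emeasure M (\<Inter>j. Q j)"
    using Q_sets dec by (intro INF_emeasure_decseq) auto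
  finally show ?thesis using sub Q_sets by (intro bexI[of _ "\<Inter>j. Q j"]) auto
qed

text \<open>A strictly positive integrable density makes the measure finite with the same null sets.
  The measurable hull \<open>H\<close> and the union \<open>Q'\<close> of inner approximations then
  differ by a null set, and completeness absorbs \<open>P - Q'\<close>.\<close>

lemma projection_measurable:
  fixes F :: "nat list \<Rightarrow> 'b::complete_space set"
  assumes "complete_measure M" "sigma_finite_measure M"
    and reg: "regular_scheme A F" and A: "\<And>l. A l \<in> sets M"
  shows "projection A F \<in> sets M"
proof -
  interpret complete_measure M by fact
  interpret sigma_finite_measure M by fact
  obtain h :: "'a \<Rightarrow> real" where h: "h \<in> borel_measurable M" "\<And>x. h x > 0" "integrable M h"
    using obtain_positive_integrable_function by metis
  define N where "N = density M (\<lambda>x. ennreal (h x))"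
  have sets_N: "sets N = sets M" by (simp add: N_def)
  have "emeasure N (space N) < \<infinity>"
    using h integrableD(2)[OF h(3)] less_imp_le[OF h(2)]
    by (simp add: N_def emeasure_density nn_integral_eq_integral cong: nn_integral_cong)
  then interpret N: finite_measure N by (intro finite_measureI) simp
  define P where "P = projection A F"
  have "P \<subseteq> space N"
  proof
    fix t assume "t \<in> P"
    then obtain \<sigma> where "t \<in> A (map \<sigma> [0..<0])" unfolding P_def projection_def by blast
    then show "t \<in> space N" using sets.sets_into_space[OF A] by (auto simp: N_def)
  qed
  then obtain H where H: "H \<in> sets N" "P \<subseteq> H" "outer_measure_of N P = emeasure N H"
    using outer_measure_of_attain by metis
  have "\<forall>n. \<exists>Q\<in>sets N. Q \<subseteq> P \<and> outer_measure_of N P \<le> emeasure N Q + ennreal (1 / Suc n)"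
    unfolding P_def using N.projection_inner_approx[OF reg] A sets_N by simp
  then obtain Q where Q: "\<And>n. Q n \<in> sets N" "\<And>n. Q n \<subseteq> P"
     "\<And>n. outer_measure_of N P \<le> emeasure N (Q n) + ennreal (1 / Suc n)" by metis
  define Q' where "Q' = (\<Union>n. Q n)"
  have Q': "Q' \<in> sets N" "Q' \<subseteq> P" using Q by (auto simp: Q'_def)
  have "emeasure N H \<le> emeasure N Q'"
  proof (rule ennreal_le_epsilon)
    fix e :: real assume "e > 0"
    then obtain n where "1 / Suc n < e" using nat_approx_posE by blast
    have "emeasure N H \<le> emeasure N (Q n) + ennreal (1 / Suc n)" using Q(3) H(3) by simp
    also have "\<dots> \<le> emeasure N Q' + ennreal e"
      using \<open>1 / Suc n < e\<close> Q'(1) by (intro add_mono emeasure_mono ennreal_leI) (auto simp: Q'_def)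
    finally show "emeasure N H \<le> emeasure N Q' + ennreal e" .
  qed
  then have "emeasure N (H - Q') = 0"
    using H Q' by (subst emeasure_Diff) (auto simp: diff_eq_0_iff_ennreal order_trans less_top[symmetric])
  then have "H - Q' \<in> null_sets N" using H(1) Q'(1) by auto
  then have "H - Q' \<in> sets M" "AE x in M. x \<in> H - Q' \<longrightarrow> ennreal (h x) = 0"
    unfolding N_def using h(1) by (auto simp: null_sets_density_iff)
  then have "AE x in M. x \<notin> H - Q'"
    using h(2) by (auto elim!: eventually_mono) (metis ennreal_eq_0_iff not_le)
  then have "H - Q' \<in> null_sets M" using sets.sets_into_space[OF \<open>H - Q' \<in> sets M\<close>] by (simp add: null_sets_iff_AE)
  moreover have "P - Q' \<subseteq> H - Q'" using H(2) by auto
  ultimately have "P - Q' \<in> sets M" using complete by blast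
  moreover have "P = (P - Q') \<union> Q'" using Q'(2) by auto
  ultimately show ?thesis using Q'(1) sets_N unfolding P_def by (metis sets.Un)
qed

text \<open>Each new entry codes an old entry together with the index of a ball of radius
  \<open>(1/2) ^ length\<close> around a point of a dense sequence; such balls cover the space, so
  no point is lost. Intersecting over prefixes gives monotonicity.\<close>

lemma souslin_regular:
  fixes D :: "('t \<times> 'a::{metric_space, second_countable_topology}) set"
  assumes "souslin M D"
  shows "\<exists>A F. regular_scheme A F \<and> (\<forall>l. A l \<in> sets M) \<and>
    D = {(t, x). \<exists>\<sigma>. \<forall>k. t \<in> A (map \<sigma> [0..<k]) \<and> x \<in> F (map \<sigma> [0..<k])}"
proof -
  obtain R :: "nat list \<Rightarrow> _" where R: "\<And>l. closed_rectangle M (R l)" and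
    D: "D = {z. \<exists>\<sigma>. \<forall>k. z \<in> R (map \<sigma> [0..<k])}" using assms unfolding souslin_def by blast
  have "\<forall>l. \<exists>AF. fst AF \<in> sets M \<and> closed (snd AF) \<and> R l = fst AF \<times> snd AF"
    using R unfolding closed_rectangle_def by fastforce
  from choice[OF this] obtain AF where AF:
    "\<And>l. fst (AF l) \<in> sets M" "\<And>l. closed (snd (AF l))" "\<And>l. R l = fst (AF l) \<times> snd (AF l)" by blast
  define A0 F0 where "A0 = (\<lambda>l. fst (AF l))" and "F0 = (\<lambda>l. snd (AF l))"
  obtain d :: "nat \<Rightarrow> 'a" where d: "\<And>x e. 0 < e \<Longrightarrow> \<exists>n. dist (d n) x < e"
    using dense_sequence_exists by blast
  define p where "p n = fst (prod_decode n)" for n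
  define A1 where "A1 l = A0 (map p l)" for l
  define F1 where "F1 l = F0 (map p l) \<inter>
      (if l = [] then UNIV else cball (d (snd (prod_decode (last l)))) ((1/2) ^ length l))" for l
  define A where "A l = (\<Inter>k\<in>{..length l}. A1 (take k l))" for l
  define F where "F l = (\<Inter>k\<in>{..length l}. F1 (take k l))" for l
  have "regular_scheme A F" unfolding regular_scheme_def
  proof (intro conjI allI impI)
    show "closed (F l)" for l unfolding F_def F1_def F0_def using AF(2) by (intro closed_INT) auto
    have *: "take k (l @ [i]) = take k l" if "k \<le> length l" for k i and l :: "nat list" using that by simp
    show "A (l @ [i]) \<subseteq> A l" for l i
    proof
      fix t assume "t \<in> A (l @ [i])"
      then have "t \<in> A1 (take k (l @ [i]))" if "k \<le> length l" for k
        using that unfolding A_def by fastforce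
      then show "t \<in> A l" using * unfolding A_def by auto
    qed
    show "F (l @ [i]) \<subseteq> F l" for l i
    proof
      fix t assume "t \<in> F (l @ [i])"
      then have "t \<in> F1 (take k (l @ [i]))" if "k \<le> length l" for k
        using that unfolding F_def by fastforce
      then show "t \<in> F l" using * unfolding F_def by auto
    qed
    show "\<exists>d. F l \<subseteq> cball d ((1/2) ^ length l)" if "l \<noteq> []" for l
    proof -
      have "F l \<subseteq> F1 l" unfolding F_def by (auto dest: bspec[of _ _ "length l"])
      then show ?thesis using that unfolding F1_def by auto
    qed
  qed
  moreover have "A l \<in> sets M" for l
    unfolding A_def A1_def A0_def by (intro sets.finite_INT) (use AF(1) in auto)
  moreover have "D = {(t, x). \<exists>\<sigma>. \<forall>k. t \<in> A (map \<sigma> [0..<k]) \<and> x \<in> F (map \<sigma> [0..<k])}"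
  proof -
    have take: "take j (map \<sigma> [0..<k]) = map \<sigma> [0..<j]" if "j \<le> k" for j k and \<sigma> :: "nat \<Rightarrow> nat"
      using that by (simp add: take_map)
    have A_iff: "(\<forall>k. t \<in> A (map \<sigma> [0..<k])) \<longleftrightarrow> (\<forall>k. t \<in> A1 (map \<sigma> [0..<k]))" for t \<sigma>
      unfolding A_def by (auto simp: take)
    have F_iff: "(\<forall>k. x \<in> F (map \<sigma> [0..<k])) \<longleftrightarrow> (\<forall>k. x \<in> F1 (map \<sigma> [0..<k]))" for x \<sigma>
      unfolding F_def by (auto simp: take)
    have D_iff: "(t, x) \<in> D \<longleftrightarrow> (\<exists>\<sigma>. \<forall>k. t \<in> A0 (map \<sigma> [0..<k]) \<and> x \<in> F0 (map \<sigma> [0..<k]))" for t x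
      unfolding D by (simp add: AF(3) A0_def F0_def)
    have "(t, x) \<in> D \<longleftrightarrow> (\<exists>\<sigma>. (\<forall>k. t \<in> A1 (map \<sigma> [0..<k])) \<and> (\<forall>k. x \<in> F1 (map \<sigma> [0..<k])))" for t x
    proof
      assume "(t, x) \<in> D"
      then obtain \<sigma> where \<sigma>: "\<And>k. t \<in> A0 (map \<sigma> [0..<k])" "\<And>k. x \<in> F0 (map \<sigma> [0..<k])"
        unfolding D_iff by blast
      have "\<forall>k. \<exists>n. dist (d n) x < (1/2) ^ Suc k" by (intro allI d) simp
      then obtain n where n: "\<And>k. dist (d (n k)) x < (1/2) ^ Suc k" by metis
      define s where "s k = prod_encode (\<sigma> k, n k)" for k
      have p_s: "map p (map s [0..<k]) = map \<sigma> [0..<k]" for k by (simp add: p_def s_def)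
      have "t \<in> A1 (map s [0..<k])" for k unfolding A1_def p_s by (rule \<sigma>)
      moreover have "x \<in> F1 (map s [0..<k])" for k
      proof (cases k)
        case 0 then show ?thesis using \<sigma>(2)[of 0] by (simp add: F1_def)
      next
        case (Suc j)
        have "last (map s [0..<k]) = s j" by (simp add: Suc)
        then show ?thesis unfolding F1_def p_s using \<sigma>(2)[of k] n[of j] by (simp add: Suc s_def)
      qed
      ultimately show "\<exists>\<sigma>. (\<forall>k. t \<in> A1 (map \<sigma> [0..<k])) \<and> (\<forall>k. x \<in> F1 (map \<sigma> [0..<k]))" by blast
    next
      assume "\<exists>\<sigma>. (\<forall>k. t \<in> A1 (map \<sigma> [0..<k])) \<and> (\<forall>k. x \<in> F1 (map \<sigma> [0..<k]))"
      then obtain \<sigma> where "\<And>k. t \<in> A1 (map \<sigma> [0..<k])" "\<And>k. x \<in> F1 (map \<sigma> [0..<k])" by blast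
      then show "(t, x) \<in> D" unfolding D_iff
        by (intro exI[of _ "\<lambda>k. p (\<sigma> k)"]) (auto simp: A1_def F1_def comp_def)
    qed
    then show ?thesis by (auto simp: A_iff[symmetric] F_iff[symmetric] all_conj_distrib)
  qed
  ultimately show ?thesis by blast
qed

text \<open>The leftmost branch of the scheme through each point gives the selection.\<close>

theorem measurable_selection:
  fixes D :: "('t \<times> 'a::{complete_space, second_countable_topology}) set"
  assumes compl: "complete_measure M" and sf: "sigma_finite_measure M"
    and D: "D \<in> sets (M \<Otimes>\<^sub>M borel)"
  obtains s where "s \<in> borel_measurable M" "{t. \<exists>x. (t, x) \<in> D} \<in> sets M"
    "\<And>t x. (t, x) \<in> D \<Longrightarrow> (t, s t) \<in> D"
proof -
  obtain A F where reg: "regular_scheme A F" and A: "\<And>l. A l \<in> sets M"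
    and D_eq: "D = {(t, x). \<exists>\<sigma>. \<forall>k. t \<in> A (map \<sigma> [0..<k]) \<and> x \<in> F (map \<sigma> [0..<k])}"
    using souslin_regular[OF souslin_if_measurable[OF D]] by blast
  \<comment> \<open>The part of the projection reached by branches through \<open>l\<close>. The
    scheme shifted by \<open>l\<close> stays regular because its radii are only smaller.\<close>
  define P where "P l = projection (\<lambda>l'. A (l @ l')) (\<lambda>l'. F (l @ l'))" for l
  have P_sets [measurable]: "P l \<in> sets M" for l
    unfolding P_def
  proof (rule projection_measurable[OF compl sf _ A])
    show "regular_scheme (\<lambda>l'. A (l @ l')) (\<lambda>l'. F (l @ l'))"
      unfolding regular_scheme_def
    proof (intro conjI allI impI)
      show "closed (F (l @ l'))" for l' using reg unfolding regular_scheme_def by blast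
      show "A (l @ l' @ [i]) \<subseteq> A (l @ l')" "F (l @ l' @ [i]) \<subseteq> F (l @ l')" for l' i
        using reg unfolding regular_scheme_def by (metis append_assoc)+
      show "\<exists>d. F (l @ l') \<subseteq> cball d ((1/2) ^ length l')" if "l' \<noteq> []" for l'
      proof -
        obtain d where "F (l @ l') \<subseteq> cball d ((1/2) ^ length (l @ l'))"
          using reg \<open>l' \<noteq> []\<close> unfolding regular_scheme_def by blast
        also have "\<dots> \<subseteq> cball d ((1/2) ^ length l')"
          by (intro subset_cball power_decreasing) auto
        finally show ?thesis by blast
      qed
    qed
  qed
  have P_step: "\<exists>i. t \<in> P (l @ [i])" if "t \<in> P l" for t l
  proof -
    obtain \<sigma> x where \<sigma>: "\<And>k. t \<in> A (l @ map \<sigma> [0..<k]) \<and> x \<in> F (l @ map \<sigma> [0..<k])"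
      using \<open>t \<in> P l\<close> unfolding P_def projection_def by blast
    have "t \<in> A ((l @ [\<sigma> 0]) @ map (\<lambda>i. \<sigma> (Suc i)) [0..<k]) \<and>
        x \<in> F ((l @ [\<sigma> 0]) @ map (\<lambda>i. \<sigma> (Suc i)) [0..<k])" for k
      using \<sigma>[of "Suc k"] unfolding map_upt_Suc_Cons by simp
    then show ?thesis unfolding P_def projection_def by blast
  qed
  have P_D: "P l \<subseteq> A l" "t \<in> P l \<Longrightarrow> F l \<noteq> {}" for l t
  proof -
    show "P l \<subseteq> A l"
    proof
      fix t assume "t \<in> P l"
      then obtain \<sigma> where "t \<in> A (l @ map \<sigma> [0..<0])" unfolding P_def projection_def by blast
      then show "t \<in> A l" by simp
    qed
    assume "t \<in> P l"
    then obtain \<sigma> x where "x \<in> F (l @ map \<sigma> [0..<0])" unfolding P_def projection_def by blast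
    then show "F l \<noteq> {}" by auto
  qed
  have P_Nil: "t \<in> P [] \<longleftrightarrow> (\<exists>x. (t, x) \<in> D)" for t
    unfolding P_def projection_def D_eq by auto
  define n where "n t l = (LEAST i. t \<in> P (l @ [i]))" for t l
  define c where "c t = rec_nat [] (\<lambda>_ l. l @ [n t l])" for t
  have c: "c t 0 = []" "c t (Suc k) = c t k @ [n t (c t k)]" for t k by (simp_all add: c_def)
  have c_eq: "c t k = map (\<lambda>k. n t (c t k)) [0..<k]" for t k
    by (rule chain_eq_map_upt) (simp_all add: c)
  have c_P: "t \<in> P (c t k)" if "t \<in> P []" for t k
  proof (induction k)
    case (Suc k) then show ?case unfolding c n_def by (rule LeastI_ex[OF P_step])
  qed (simp add: c that)
  have c_meas: "(\<lambda>t. c t k) \<in> measurable M (count_space UNIV)" for k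
  proof (induction k)
    case 0 then show ?case by (simp add: c)
  next
    case (Suc k)
    have "(\<lambda>t. l @ [n t l]) \<in> measurable M (count_space UNIV)" for l
    proof -
      have "(\<lambda>t. n t l) \<in> measurable M (count_space UNIV)" unfolding n_def by measurable
      then show ?thesis by (rule measurable_compose) simp
    qed
    from measurable_compose_countable[OF this Suc] show ?case by (simp add: c)
  qed
  \<comment> \<open>A point that depends on the finite list alone, so \<open>pt (c t k)\<close>
    takes countably many values and is measurable in \<open>t\<close>. These points converge to the
    selection, which inherits measurability.\<close>
  define pt where "pt l = (SOME x. x \<in> F l)" for l
  have pt: "pt (c t k) \<in> F (c t k)" if "t \<in> P []" for t k
    unfolding pt_def using P_D(2)[OF c_P[OF that]] by (simp add: some_in_eq)
  define s where "s t = (if t \<in> P [] then SOME x. \<forall>k. x \<in> F (c t k) else undefined)" for t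
  have s: "s t \<in> F (c t k)" if "t \<in> P []" for t k
  proof -
    have "\<exists>x. \<forall>k. x \<in> F (map (\<lambda>k. n t (c t k)) [0..<k])"
      by (rule regular_scheme_branch_point[OF reg]) (use P_D(2)[OF c_P[OF that]] in \<open>simp add: c_eq[symmetric]\<close>)
    then have "\<exists>x. \<forall>k. x \<in> F (c t k)" by (simp add: c_eq[symmetric])
    from someI_ex[OF this] show ?thesis using that by (simp add: s_def)
  qed
  show ?thesis
  proof
    show "{t. \<exists>x. (t, x) \<in> D} \<in> sets M" using P_sets[of "[]"] by (simp add: P_Nil[symmetric])
    show "(t, s t) \<in> D" if "(t, x) \<in> D" for t x
    proof -
      have t: "t \<in> P []" using that P_Nil by blast
      have "t \<in> A (c t k) \<and> s t \<in> F (c t k)" for k using c_P[OF t, of k] P_D(1) s[OF t] by blast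
      then show ?thesis unfolding D_eq by (subst (asm) (1 2) c_eq) blast
    qed
    show "s \<in> borel_measurable M"
    proof (rule borel_measurable_LIMSEQ_metric)
      fix k
      have [measurable]: "(\<lambda>t. pt (c t k)) \<in> borel_measurable M"
        by (rule measurable_compose[OF c_meas]) simp
      show "(\<lambda>t. if t \<in> P [] then pt (c t k) else undefined) \<in> borel_measurable M" by measurable
    next
      fix t
      show "(\<lambda>k. if t \<in> P [] then pt (c t k) else undefined) \<longlonglongrightarrow> s t"
      proof (cases "t \<in> P []")
        case True
        \<comment> \<open>Two points of a ball of radius \<open>(1/2) ^ Suc k\<close> are at most
          \<open>(1/2) ^ k\<close> apart; the shift by one skips the empty list, which has no
          radius.\<close>
        have bound: "dist (pt (c t (Suc k))) (s t) \<le> (1/2) ^ k" for k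
        proof -
          have "length (c t (Suc k)) = Suc k" by (subst c_eq) simp
          then obtain d where "F (c t (Suc k)) \<subseteq> cball d ((1/2) ^ Suc k)"
            using reg unfolding regular_scheme_def by (metis list.size(3) nat.simps(3))
          then have "dist d (pt (c t (Suc k))) \<le> (1/2) ^ Suc k" "dist d (s t) \<le> (1/2) ^ Suc k"
            using pt[OF True, of "Suc k"] s[OF True, of "Suc k"] by (metis mem_cball subsetD)+
          then show ?thesis using dist_triangle3[of "pt (c t (Suc k))" "s t" d] by simp
        qed
        have "(\<lambda>k. dist (pt (c t (Suc k))) (s t)) \<longlonglongrightarrow> 0"
          by (rule tendsto_sandwich[of "\<lambda>_. 0" _ _ "\<lambda>k. (1/2) ^ k"]) (use bound LIMSEQ_power_zero[of "1/2::real"] in \<open>simp_all\<close>)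
        then have "(\<lambda>k. pt (c t (Suc k))) \<longlonglongrightarrow> s t" by (subst tendsto_dist_iff)
        then show ?thesis using True LIMSEQ_imp_Suc[of "\<lambda>k. pt (c t k)" "s t"] by simp
      qed (simp add: s_def)
    qed
  qed
qed

section \<open>Convex analysis\<close>

definition sublinear :: "('a::real_vector \<Rightarrow> real) \<Rightarrow> bool" where
  "sublinear p \<longleftrightarrow> (\<forall>x y. p (x + y) \<le> p x + p y) \<and> (\<forall>c x. 0 \<le> c \<longrightarrow> p (c *\<^sub>R x) = c * p x)"

text \<open>One inequality for positive factors suffices: applied to \<open>1 / c\<close> and
  \<open>c *\<^sub>R x\<close> it gives the reverse one.\<close>

lemma sublinearI:
  assumes add: "\<And>x y. p (x + y) \<le> p x + p y" and zero: "p 0 = 0"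
    and scale: "\<And>c x. 0 < c \<Longrightarrow> p (c *\<^sub>R x) \<le> c * p x"
  shows "sublinear p"
  unfolding sublinear_def
proof (intro conjI allI impI add)
  fix c :: real and x assume "0 \<le> c"
  show "p (c *\<^sub>R x) = c * p x"
  proof (cases "c = 0")
    case False
    then have c: "c > 0" using \<open>0 \<le> c\<close> by simp
    have "p ((1/c) *\<^sub>R (c *\<^sub>R x)) \<le> (1/c) * p (c *\<^sub>R x)" by (rule scale) (use c in simp)
    then have "c * p x \<le> p (c *\<^sub>R x)" using c by (simp add: field_simps)
    then show ?thesis using scale[OF c, of x] by simp
  qed (simp add: zero)
qed

lemma sublinear_neg: "sublinear p \<Longrightarrow> - p (- x) \<le> p x"
  unfolding sublinear_def by (metis add.right_inverse add_0 mult_zero_left order_refl scaleR_zero_left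
      add.commute minus_le_iff neg_le_iff_le uminus_add_conv_diff diff_ge_0_iff_ge minus_add_cancel diff_0)

text \<open>A minimal sublinear functional is linear.\<close>

lemma hahn_banach:
  fixes p :: "'a::real_vector \<Rightarrow> real"
  assumes p: "sublinear p"
  shows "\<exists>l. linear l \<and> (\<forall>x. l x \<le> p x)"
proof -
  define \<A> where "\<A> = {q. sublinear q \<and> (\<forall>x. q x \<le> p x)}"
  define P where "P q r \<longleftrightarrow> (\<forall>x::'a. r x \<le> (q x :: real))" for q r
  have lower: "- p (- x) \<le> q x" if "q \<in> \<A>" for q x
    using sublinear_neg[of q x] that unfolding \<A>_def by (smt (verit) mem_Collect_eq)
  have "\<exists>m\<in>\<A>. \<forall>a\<in>\<A>. P m a \<longrightarrow> a = m"
  proof (rule predicate_Zorn)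
    show "partial_order_on \<A> (relation_of P \<A>)"
      unfolding partial_order_on_def preorder_on_def relation_of_def refl_on_def trans_def antisym_def P_def
      by (auto intro!: ext simp: antisym) (meson order_trans)
  next
    fix C assume C: "C \<in> Chains (relation_of P \<A>)"
    then have C_sub: "C \<subseteq> \<A>" by (auto simp: Chains_def relation_of_def)
    have C_tot: "P q r \<or> P r q" if "q \<in> C" "r \<in> C" for q r
      using C that by (auto simp: Chains_def relation_of_def)
    show "\<exists>u\<in>\<A>. \<forall>a\<in>C. P a u"
    proof (cases "C = {}")
      case True then show ?thesis using p by (auto simp: \<A>_def)
    next
      case False
      \<comment> \<open>The pointwise infimum of a chain, finite because every member stays above
        \<open>- p (- x)\<close>. Subadditivity survives because of any two members one is the
        smaller everywhere and serves for both arguments.\<close>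
      define u where "u x = (INF q\<in>C. q x)" for x
      have u_le: "u x \<le> q x" if "q \<in> C" for q x
        unfolding u_def by (rule cINF_lower[OF _ that]) (use C_sub lower in \<open>auto intro!: bdd_belowI2[of _ "- p (- x)"]\<close>)
      have u_ge: "b \<le> u x" if "\<And>q. q \<in> C \<Longrightarrow> b \<le> q x" for b x
        unfolding u_def by (rule cINF_greatest[OF False that])
      have q: "q (x + y) \<le> q x + q y" "0 \<le> c \<Longrightarrow> q (c *\<^sub>R x) = c * q x" "q 0 = 0" "q x \<le> p x" if "q \<in> C" for q x y c
      proof -
        have *: "sublinear q" "q x \<le> p x" using that C_sub by (auto simp: \<A>_def)
        then show "q (x + y) \<le> q x + q y" "0 \<le> c \<Longrightarrow> q (c *\<^sub>R x) = c * q x" "q x \<le> p x" by (auto simp: sublinear_def)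
        have "q (0 *\<^sub>R 0) = 0 * q 0" using *(1) unfolding sublinear_def by blast
        then show "q 0 = 0" by simp
      qed
      have "sublinear u"
      proof (rule sublinearI)
        fix x y
        have "u (x + y) \<le> q x + r y" if "q \<in> C" "r \<in> C" for q r
        proof -
          have "P q r \<or> P r q" using C_tot that .
          then show ?thesis
          proof
            assume "P q r"
            then show ?thesis using u_le[OF that(2), of "x + y"] q(1)[OF that(2), of x y] unfolding P_def by (smt (verit))
          next
            assume "P r q"
            then show ?thesis using u_le[OF that(1), of "x + y"] q(1)[OF that(1), of x y] unfolding P_def by (smt (verit))
          qed
        qed
        then have "u (x + y) - q x \<le> u y" if "q \<in> C" for q
          using that by (intro u_ge) (fastforce simp: algebra_simps)
        then have "u (x + y) - u y \<le> u x" by (intro u_ge) (auto simp: algebra_simps)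
        then show "u (x + y) \<le> u x + u y" by simp
      next
        show "u 0 = 0" 
        proof (rule antisym)
          obtain q where "q \<in> C" using False by blast
          then show "u 0 \<le> 0" using u_le[of q 0] q(3)[of q] by simp
        qed (rule u_ge, simp add: q(3))
      next
        fix c :: real and x assume c: "0 < c"
        have "u (c *\<^sub>R x) / c \<le> u x"
        proof (rule u_ge)
          fix r assume r: "r \<in> C"
          then show "u (c *\<^sub>R x) / c \<le> r x"
            using u_le[OF r, of "c *\<^sub>R x"] q(2)[OF r, of c x] c by (simp add: field_simps)
        qed
        then show "u (c *\<^sub>R x) \<le> c * u x" using c by (simp add: field_simps)
      qed
      moreover have "u x \<le> p x" for x
        using False u_le q(4) by (meson ex_in_conv order_trans)
      ultimately show ?thesis using u_le by (auto simp: \<A>_def P_def)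
    qed
  qed
  then obtain m where m: "m \<in> \<A>" "\<And>a. a \<in> \<A> \<Longrightarrow> P m a \<Longrightarrow> a = m" by blast
  then have m_sub: "sublinear m" "\<And>x. m x \<le> p x" by (auto simp: \<A>_def)
  then have m_add: "m (x + y) \<le> m x + m y" and m_scale: "0 \<le> c \<Longrightarrow> m (c *\<^sub>R x) = c * m x" for x y c
    by (auto simp: sublinear_def)
  have m0: "m 0 = 0" using m_scale[of 0 0] by simp
  have odd: "m (- h) = - m h" for h
  proof -
    \<comment> \<open>This functional is sublinear and below \<open>m\<close>, hence equal to
      \<open>m\<close> by minimality. Taking \<open>s = 1\<close> at \<open>- h\<close> then yields
      \<open>m (- h) \<le> - m h\<close>.\<close>
    define m' where "m' z = (INF s\<in>{0..}. m (z + s *\<^sub>R h) - s * m h)" for z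
    have lb: "- m (- z) \<le> m (z + s *\<^sub>R h) - s * m h" if "s \<ge> 0" for s z
      using m_add[of "z + s *\<^sub>R h" "- z"] m_scale[OF that, of h] by simp
    have m'_le: "m' z \<le> m (z + s *\<^sub>R h) - s * m h" if "s \<ge> 0" for s z
      unfolding m'_def by (rule cINF_lower) (use that lb in \<open>auto intro!: bdd_belowI2[of _ "- m (- z)"]\<close>)
    have m'_ge: "b \<le> m' z" if "\<And>s. s \<ge> 0 \<Longrightarrow> b \<le> m (z + s *\<^sub>R h) - s * m h" for b z
      unfolding m'_def by (rule cINF_greatest) (use that in auto)
    have m'_m: "m' z \<le> m z" for z using m'_le[of 0 z] by simp
    have "sublinear m'"
    proof (rule sublinearI)
      fix x y
      have *: "m' (x + y) \<le> (m (x + s *\<^sub>R h) - s * m h) + (m (y + r *\<^sub>R h) - r * m h)" if "s \<ge> 0" "r \<ge> 0" for s r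
      proof -
        have "m' (x + y) \<le> m ((x + y) + (s + r) *\<^sub>R h) - (s + r) * m h" using that by (intro m'_le) auto
        also have "(x + y) + (s + r) *\<^sub>R h = (x + s *\<^sub>R h) + (y + r *\<^sub>R h)" by (simp add: algebra_simps)
        finally show ?thesis using m_add[of "x + s *\<^sub>R h" "y + r *\<^sub>R h"] by (simp add: algebra_simps)
      qed
      have "m' (x + y) - (m (x + s *\<^sub>R h) - s * m h) \<le> m' y" if "s \<ge> 0" for s
      proof (rule m'_ge)
        fix r :: real assume "r \<ge> 0" then show "m' (x + y) - (m (x + s *\<^sub>R h) - s * m h) \<le> m (y + r *\<^sub>R h) - r * m h"
          using *[OF that] by (smt (verit))
      qed
      then have "m' (x + y) - m' y \<le> m' x" by (intro m'_ge) (smt (verit))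
      then show "m' (x + y) \<le> m' x + m' y" by simp
    next
      show "m' 0 = 0" using m'_m[of 0] m'_ge[of 0 0] lb[of _ 0] m0 by simp
    next
      fix c :: real and x assume c: "0 < c"
      have "m' (c *\<^sub>R x) / c \<le> m' x"
      proof (rule m'_ge)
        fix s :: real assume s: "s \<ge> 0"
        have "m' (c *\<^sub>R x) \<le> m (c *\<^sub>R x + (c * s) *\<^sub>R h) - (c * s) * m h" using s c by (intro m'_le) auto
        also have "c *\<^sub>R x + (c * s) *\<^sub>R h = c *\<^sub>R (x + s *\<^sub>R h)" by (simp add: algebra_simps)
        finally show "m' (c *\<^sub>R x) / c \<le> m (x + s *\<^sub>R h) - s * m h"
          using c m_scale[of c "x + s *\<^sub>R h"] by (simp add: field_simps)
      qed
      then show "m' (c *\<^sub>R x) \<le> c * m' x" using c by (simp add: field_simps)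
    qed
    then have "m' = m" using m(2)[of m'] m'_m m_sub(2) by (auto simp: \<A>_def P_def intro: order_trans)
    then have "m (- h) \<le> - m h" using m'_le[of 1 "- h"] m0 by simp
    then show ?thesis using m_add[of h "- h"] m0 by simp
  qed
  have "linear m"
  proof (rule linearI)
    show "m (x + y) = m x + m y" for x y
      using m_add[of x y] m_add[of "- x" "- y"] odd[of x] odd[of y] odd[of "x + y"] by simp
    show "m (c *\<^sub>R x) = c *\<^sub>R m x" for c x
    proof (cases "c \<ge> 0")
      case False
      then have "m (c *\<^sub>R x) = - m ((- c) *\<^sub>R x)" using odd[of "(- c) *\<^sub>R x"] by simp
      then show ?thesis using m_scale[of "- c" x] False by simp
    qed (simp add: m_scale)
  qed
  then show ?thesis using m_sub(2) by blast
qed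

text \<open>The functional comes from the Hahn-Banach theorem for the sublinear functional
  \<open>h \<mapsto> inf {\<beta> + N \<parallel>h - w\<parallel> | (w, \<beta>) \<in> K}\<close>.\<close>

lemma functional_below_cone:
  fixes K :: "('a::real_normed_vector \<times> real) set"
  assumes K0: "(0, 0) \<in> K"
    and add: "\<And>w \<beta> w' \<beta>'. (w, \<beta>) \<in> K \<Longrightarrow> (w', \<beta>') \<in> K \<Longrightarrow> (w + w', \<beta> + \<beta>') \<in> K"
    and scale: "\<And>w \<beta> c. (w, \<beta>) \<in> K \<Longrightarrow> 0 < c \<Longrightarrow> (c *\<^sub>R w, c * \<beta>) \<in> K"
    and lower: "\<And>w \<beta>. (w, \<beta>) \<in> K \<Longrightarrow> - N * norm w \<le> \<beta>" and N: "0 \<le> N"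
  shows "\<exists>l::'a \<Rightarrow>\<^sub>L real. norm l \<le> N \<and> (\<forall>(w, \<beta>)\<in>K. blinfun_apply l w \<le> \<beta>)"
proof -
  define S where "S h = (INF (w, \<beta>)\<in>K. \<beta> + N * norm (h - w))" for h
  have lb: "- N * norm h \<le> \<beta> + N * norm (h - w)" if "(w, \<beta>) \<in> K" for w \<beta> h
  proof -
    have "norm w \<le> norm h + norm (h - w)" by (metis norm_minus_commute norm_triangle_sub)
    then have "N * norm w \<le> N * (norm h + norm (h - w))" using N by (rule mult_left_mono)
    then show ?thesis using lower[OF that] by (simp add: algebra_simps)
  qed
  have S_le: "S h \<le> \<beta> + N * norm (h - w)" if "(w, \<beta>) \<in> K" for w \<beta> h
  proof -
    have "(INF z\<in>K. snd z + N * norm (h - fst z)) \<le> snd (w, \<beta>) + N * norm (h - fst (w, \<beta>))"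
      by (rule cINF_lower[OF _ that]) (use lb in \<open>auto intro!: bdd_belowI2[of _ "- N * norm h"]\<close>)
    then show ?thesis by (simp add: S_def case_prod_beta)
  qed
  have S_ge: "b \<le> S h" if "\<And>w \<beta>. (w, \<beta>) \<in> K \<Longrightarrow> b \<le> \<beta> + N * norm (h - w)" for b h
    unfolding S_def by (rule cINF_greatest) (use that K0 in auto)
  have "sublinear S"
  proof (rule sublinearI)
    fix x y
    have *: "S (x + y) \<le> (\<beta> + N * norm (x - w)) + (\<beta>' + N * norm (y - w'))"
      if "(w, \<beta>) \<in> K" "(w', \<beta>') \<in> K" for w \<beta> w' \<beta>'
    proof -
      have "S (x + y) \<le> (\<beta> + \<beta>') + N * norm ((x + y) - (w + w'))" by (rule S_le[OF add[OF that]])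
      also have "(x + y) - (w + w') = (x - w) + (y - w')" by simp
      also have "N * norm ((x - w) + (y - w')) \<le> N * (norm (x - w) + norm (y - w'))"
        by (intro mult_left_mono norm_triangle_ineq N)
      finally show ?thesis by (simp add: algebra_simps)
    qed
    have "S (x + y) - (\<beta> + N * norm (x - w)) \<le> S y" if "(w, \<beta>) \<in> K" for w \<beta>
      by (rule S_ge) (use *[OF that] in \<open>simp add: algebra_simps\<close>)
    then have "S (x + y) - S y \<le> S x" by (intro S_ge) (simp add: algebra_simps)
    then show "S (x + y) \<le> S x + S y" by simp
  next
    show "S 0 = 0" using S_le[OF K0, of 0] S_ge[of 0 0] lb[of _ _ 0] by fastforce
  next
    fix c :: real and x assume c: "0 < c"
    have "S (c *\<^sub>R x) / c \<le> S x"
    proof (rule S_ge)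
      fix w \<beta> assume K: "(w, \<beta>) \<in> K"
      have "S (c *\<^sub>R x) \<le> c * \<beta> + N * norm (c *\<^sub>R x - c *\<^sub>R w)" by (rule S_le[OF scale[OF K c]])
      also have "norm (c *\<^sub>R x - c *\<^sub>R w) = c * norm (x - w)" using c by (simp flip: scaleR_diff_right)
      finally show "S (c *\<^sub>R x) / c \<le> \<beta> + N * norm (x - w)" using c by (simp add: field_simps)
    qed
    then show "S (c *\<^sub>R x) \<le> c * S x" using c by (simp add: field_simps)
  qed
  then obtain l where l: "linear l" "\<And>x. l x \<le> S x" using hahn_banach by blast
  \<comment> \<open>The pair \<open>(0, 0)\<close> in the infimum gives the norm bound; further
    down, \<open>h = w\<close> makes the distance term vanish and gives
    \<open>l w \<le> \<beta>\<close>.\<close>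
  have l_le: "l h \<le> N * norm h" for h using l(2)[of h] S_le[OF K0, of h] by simp
  have l_abs: "\<bar>l h\<bar> \<le> N * norm h" for h
    using l_le[of h] l_le[of "- h"] linear_neg[OF l(1), of h] by simp
  have bl: "bounded_linear l"
    using l(1) l_abs by (intro bounded_linear_intro[of _ N]) (auto simp: linear_add linear_scale mult.commute)
  have "norm (Blinfun l) \<le> N"
    by (rule norm_blinfun_bound[OF N]) (simp add: bounded_linear_Blinfun_apply[OF bl] l_abs)
  moreover have "l w \<le> \<beta>" if "(w, \<beta>) \<in> K" for w \<beta>
    using l(2)[of w] S_le[OF that, of w] by simp
  ultimately show ?thesis
    by (intro exI[of _ "Blinfun l"]) (auto simp: bounded_linear_Blinfun_apply[OF bl])
qed

section \<open>Affine minorants of extended-real convex functions\<close>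

lemma convex_ereal_real:
  assumes "convex_ereal f" "f x \<le> ereal a" "f y \<le> ereal b" "0 \<le> s" "0 \<le> r" "s + r = 1"
    and "f x \<noteq> - \<infinity>" "f y \<noteq> - \<infinity>"
  shows "f (s *\<^sub>R x + r *\<^sub>R y) \<le> ereal (s * a + r * b)"
proof (cases "0 < s \<and> s < 1")
  case True
  have r: "r = 1 - s" using assms by simp
  have "f (s *\<^sub>R x + (1 - s) *\<^sub>R y) \<le> ereal s * f x + ereal (1 - s) * f y"
    using assms(1) True by (simp add: convex_ereal_def)
  also have "\<dots> \<le> ereal s * ereal a + ereal (1 - s) * ereal b"
    using True assms by (intro add_mono ereal_mult_left_mono) auto
  finally show ?thesis by (simp add: r)
next
  case False
  then have "s = 0 \<and> r = 1 \<or> s = 1 \<and> r = 0" using assms(4-6) by auto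
  then show ?thesis using assms by auto
qed

text \<open>Separation for the cone generated by the epigraph of \<open>f + q (\<cdot> - y)\<close>,
  shifted by \<open>(y, a)\<close>: the lower bound puts this cone above \<open>- N * norm\<close>,
  and the functional below it is \<open>v + q\<close>. With \<open>a\<close> the value at
  \<open>y\<close> this is a subgradient near \<open>- q\<close>; a smaller \<open>a\<close> gives
  an affine minorant.\<close>

lemma convex_subgradient_exists:
  fixes f :: "'a::real_normed_vector \<Rightarrow> ereal" and q :: "'a \<Rightarrow>\<^sub>L real"
  assumes conv: "convex_ereal f" and N: "0 \<le> N"
    and lower: "\<And>z. ereal (a - q (z - y) - N * norm (z - y)) \<le> f z"
  shows "\<exists>v::'a \<Rightarrow>\<^sub>L real. norm (v + q) \<le> N \<and> (\<forall>z. ereal (a + v (z - y)) \<le> f z)"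
proof (cases "\<exists>z \<alpha>. f z \<le> ereal \<alpha>")
  \<comment> \<open>For \<open>f\<close> identically \<open>\<infinity>\<close> the cone would be
    empty, so this case is settled separately.\<close>
  case False
  then have "f z = \<infinity>" for z by (metis ereal_le_real nle_le ereal_infty_less_eq(1))
  then show ?thesis using N by (intro exI[of _ "- q"]) auto
next
  case True
  define K where "K = {(w, \<beta>). \<exists>s z \<alpha>. 0 \<le> s \<and> f z \<le> ereal \<alpha> \<and> w = s *\<^sub>R (z - y) \<and> \<beta> = s * (\<alpha> - a + q (z - y))}"
  have K_I: "(s *\<^sub>R (z - y), s * (\<alpha> - a + q (z - y))) \<in> K" if "0 \<le> s" "f z \<le> ereal \<alpha>" for s z \<alpha>
    unfolding K_def using that by blast
  have not_minf: "f z \<noteq> - \<infinity>" for z using lower[of z] by auto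
  have "\<exists>l::'a \<Rightarrow>\<^sub>L real. norm l \<le> N \<and> (\<forall>(w, \<beta>)\<in>K. blinfun_apply l w \<le> \<beta>)"
  proof (rule functional_below_cone[OF _ _ _ _ N])
    show "(0, 0) \<in> K" 
    proof -
      obtain z \<alpha> where "f z \<le> ereal \<alpha>" using True by blast
      then show ?thesis using K_I[of 0 z \<alpha>] by simp
    qed
    show "(c *\<^sub>R w, c * \<beta>) \<in> K" if "(w, \<beta>) \<in> K" "0 < c" for w \<beta> c
    proof -
      obtain s z \<alpha> where s: "0 \<le> s" "f z \<le> ereal \<alpha>" "w = s *\<^sub>R (z - y)" "\<beta> = s * (\<alpha> - a + q (z - y))"
        using \<open>(w, \<beta>) \<in> K\<close> unfolding K_def by blast
      then show ?thesis using K_I[of "c * s" z \<alpha>] that(2) by (simp add: mult.assoc)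
    qed
    show "- N * norm w \<le> \<beta>" if "(w, \<beta>) \<in> K" for w \<beta>
    proof -
      obtain s z \<alpha> where s: "0 \<le> s" "f z \<le> ereal \<alpha>" "w = s *\<^sub>R (z - y)" "\<beta> = s * (\<alpha> - a + q (z - y))"
        using \<open>(w, \<beta>) \<in> K\<close> unfolding K_def by blast
      have "ereal (a - q (z - y) - N * norm (z - y)) \<le> ereal \<alpha>" using lower[of z] s(2) by (rule order_trans)
      then have "s * (- N * norm (z - y)) \<le> s * (\<alpha> - a + q (z - y))" by (intro mult_left_mono s) simp
      moreover have "norm w = s * norm (z - y)" using s(1,3) by simp
      ultimately show ?thesis unfolding s(4) by (simp only: mult.left_commute mult_minus_left mult_minus_right)
    qed
    show "(w + w', \<beta> + \<beta>') \<in> K" if K: "(w, \<beta>) \<in> K" "(w', \<beta>') \<in> K" for w \<beta> w' \<beta>'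
    proof -
      obtain s z \<alpha> where s: "0 \<le> s" "f z \<le> ereal \<alpha>" "w = s *\<^sub>R (z - y)" "\<beta> = s * (\<alpha> - a + q (z - y))"
        using K(1) unfolding K_def by blast
      obtain s' z' \<alpha>' where s': "0 \<le> s'" "f z' \<le> ereal \<alpha>'" "w' = s' *\<^sub>R (z' - y)" "\<beta>' = s' * (\<alpha>' - a + q (z' - y))"
        using K(2) unfolding K_def by blast
      show ?thesis
      proof (cases "s + s' = 0")
        case True
        then have "s = 0" "s' = 0" using s s' by auto
        then show ?thesis using s s' K by simp
      next
        case False
        \<comment> \<open>The sum of two elements of the cone is \<open>r\<close> times a convex
          combination, to which convexity of \<open>f\<close> applies.\<close>
        define r where "r = s + s'"
        have r: "r > 0" using False s s' by (simp add: r_def)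
        define t t' where "t = s / r" and "t' = s' / r"
        have t: "0 \<le> t" "0 \<le> t'" "t + t' = 1"
          using s(1) s'(1) r by (simp_all add: t_def t'_def flip: add_divide_distrib r_def)
        define z'' where "z'' = t *\<^sub>R z + t' *\<^sub>R z'"
        have s_eq: "s = r * t" "s' = r * t'" using r by (auto simp: t_def t'_def)
        have fz: "f z'' \<le> ereal (t * \<alpha> + t' * \<alpha>')"
          unfolding z''_def by (rule convex_ereal_real[OF conv s(2) s'(2) t not_minf not_minf])
        have zy: "z'' - y = t *\<^sub>R (z - y) + t' *\<^sub>R (z' - y)"
          unfolding z''_def using t(3) by (simp add: algebra_simps flip: scaleR_add_left)
        have "w + w' = r *\<^sub>R (z'' - y)"
          unfolding zy s(3) s'(3) s_eq by (simp add: algebra_simps)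
        moreover have "\<beta> + \<beta>' = r * ((t * \<alpha> + t' * \<alpha>') - a + q (z'' - y))"
        proof -
          have "a = t * a + t' * a" using t(3) by (simp flip: distrib_right)
          then have "(t * \<alpha> + t' * \<alpha>') - a + q (z'' - y) = t * (\<alpha> - a + q (z - y)) + t' * (\<alpha>' - a + q (z' - y))"
            unfolding zy blinfun.add_right blinfun.scaleR_right by (simp add: algebra_simps)
          then show ?thesis unfolding s(4) s'(4) s_eq by (simp only: distrib_left mult.assoc)
        qed
        ultimately show ?thesis using K_I[OF _ fz, of r] r by simp
      qed
    qed
  qed
  then obtain l :: "'a \<Rightarrow>\<^sub>L real" where l: "norm l \<le> N" "\<And>w \<beta>. (w, \<beta>) \<in> K \<Longrightarrow> blinfun_apply l w \<le> \<beta>" by blast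
  have "ereal (a + (l - q) (z - y)) \<le> f z" for z
  proof (cases "f z")
    case (real \<alpha>)
    have "(z - y, \<alpha> - a + q (z - y)) \<in> K" using K_I[of 1 z \<alpha>] real by simp
    then have "l (z - y) \<le> \<alpha> - a + q (z - y)" by (rule l(2))
    then show ?thesis using real by (simp add: blinfun.diff_left)
  qed (use not_minf[of z] in auto)
  then show ?thesis using l(1) by (intro exI[of _ "l - q"]) simp
qed

text \<open>For \<open>a\<close> below the value at \<open>y\<close> there is a continuous affine
  minorant with value \<open>a\<close> at \<open>y\<close>; it converges along weakly convergent
  sequences and keeps the values of \<open>f\<close> above \<open>a'\<close> from some index
  on.\<close>

lemma convex_weakly_seq_lsc:
  fixes f :: "'a::real_normed_vector \<Rightarrow> ereal"
  assumes conv: "convex_ereal f" and "lsc f" and k: "0 \<le> k"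
    and lower: "\<And>z. ereal (c - k * norm z) \<le> f z"
    and weak: "\<And>l::'a \<Rightarrow>\<^sub>L real. (\<lambda>n. l (u n)) \<longlonglongrightarrow> l y"
  shows "f y \<le> liminf (\<lambda>n. f (u n))"
proof (rule le_Liminf_iff[THEN iffD2], intro allI impI)
  fix b assume "b < f y"
  then obtain a' where a': "b < ereal a'" "ereal a' < f y" using ereal_dense2 by blast
  then obtain a where "ereal a' < ereal a" "ereal a < f y" using ereal_dense2 by blast
  with a' have a: "b < ereal a'" "a' < a" "ereal a < f y" by auto
  have "open {x. ereal a < f x}" using \<open>lsc f\<close> by (simp add: lsc_def)
  then obtain r where r: "r > 0" "ball y r \<subseteq> {x. ereal a < f x}" using a(3) by (metis mem_Collect_eq open_contains_ball)
  \<comment> \<open>Inside the ball lower semicontinuity keeps \<open>f\<close> above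
    \<open>a\<close>. Outside, \<open>norm (z - y) \<ge> r\<close>, so the summand
    \<open>\<bar>a - c + k * norm y\<bar> / r\<close> pushes \<open>a - N * norm (z - y)\<close>
    below \<open>c - k * norm z\<close>.\<close>
  define N where "N = k + \<bar>a - c + k * norm y\<bar> / r"
  have N: "0 \<le> N" using k r by (simp add: N_def)
  have "ereal (a - blinfun_apply 0 (z - y) - N * norm (z - y)) \<le> f z" for z
  proof (cases "norm (z - y) < r")
    case True
    then have "z \<in> ball y r" by (simp add: dist_norm norm_minus_commute)
    then have "ereal a < f z" using r(2) by blast
    moreover have "ereal (a - N * norm (z - y)) \<le> ereal a" using N by simp
    ultimately have "ereal (a - N * norm (z - y)) \<le> f z" by (meson le_less_trans less_imp_le)
    then show ?thesis by simp
  next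
    case False
    have "\<bar>a - c + k * norm y\<bar> \<le> \<bar>a - c + k * norm y\<bar> / r * norm (z - y)"
      using False r(1) mult_left_mono[of r "norm (z - y)" "\<bar>a - c + k * norm y\<bar> / r"] by simp
    moreover have "k * norm z \<le> k * (norm y + norm (z - y))"
      by (intro mult_left_mono k) (metis norm_triangle_sub)
    ultimately have "a - N * norm (z - y) \<le> c - k * norm z" by (simp add: N_def algebra_simps)
    then have "ereal (a - N * norm (z - y)) \<le> ereal (c - k * norm z)" by simp
    also have "\<dots> \<le> f z" by (rule lower)
    finally show ?thesis by simp
  qed
  then obtain v :: "'a \<Rightarrow>\<^sub>L real" where v: "\<And>z. ereal (a + v (z - y)) \<le> f z"
    using convex_subgradient_exists[OF conv N, of a 0 y] by blast
  have "(\<lambda>n. a + v (u n - y)) \<longlonglongrightarrow> a + (v y - v y)"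
    unfolding blinfun.diff_right by (intro tendsto_intros weak)
  then have "eventually (\<lambda>n. a' < a + v (u n - y)) sequentially"
    using a(2) by (intro order_tendstoD(1)) auto
  then show "eventually (\<lambda>n. b < f (u n)) sequentially"
  proof eventually_elim
    case (elim n)
    have "b < ereal (a + v (u n - y))" using a(1) elim by (metis ereal_less(2) less_ereal.simps(1) order_less_trans)
    then show ?case using v[of "u n"] by (rule less_le_trans)
  qed
qed

text \<open>Ekeland's variational principle. Completeness and lower semicontinuity are asked
  together, and only for sequences with steps at most \<open>(1/2) ^ j\<close> along which
  \<open>J\<close> decreases. This is what the integral functional can offer; its distance cannot
  separate functions that agree almost everywhere.\<close>

lemma ekeland:
  fixes S :: "'s set" and d :: "'s \<Rightarrow> 's \<Rightarrow> real" and J :: "'s \<Rightarrow> real"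
  assumes s0: "s0 \<in> S" and \<eta>: "\<eta> > 0"
    and d_nonneg: "\<And>s t. 0 \<le> d s t" and d_self: "\<And>s. d s s = 0"
    and triangle: "\<And>s t r. s \<in> S \<Longrightarrow> t \<in> S \<Longrightarrow> r \<in> S \<Longrightarrow> d s r \<le> d s t + d t r"
    and bounded: "\<And>s. s \<in> S \<Longrightarrow> B \<le> J s"
    and complete: "\<And>\<sigma>. (\<And>j. \<sigma> j \<in> S) \<Longrightarrow> (\<And>j. d (\<sigma> j) (\<sigma> (Suc j)) \<le> (1/2) ^ j) \<Longrightarrow> (\<And>j. J (\<sigma> (Suc j)) \<le> J (\<sigma> j)) \<Longrightarrow>
      \<exists>s\<in>S. (\<forall>j. J s \<le> J (\<sigma> j)) \<and> (\<lambda>j. d (\<sigma> j) s) \<longlonglongrightarrow> 0"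
  shows "\<exists>s\<in>S. J s + \<eta> * d s0 s \<le> J s0 \<and> (\<forall>t\<in>S. J s \<le> J t + \<eta> * d s t)"
proof -
  \<comment> \<open>Points that improve on \<open>s\<close> by at least \<open>\<eta>\<close> times
    the distance. Each next element of the sequence nearly minimizes \<open>J\<close> over the set
    of its predecessor.\<close>
  define T where "T s = {t \<in> S. J t + \<eta> * d s t \<le> J s}" for s
  have T_self: "s \<in> T s" if "s \<in> S" for s using that by (simp add: T_def d_self)
  have T_trans: "r \<in> T s" if "t \<in> T s" "r \<in> T t" "s \<in> S" for r s t
  proof -
    have "\<eta> * d s r \<le> \<eta> * (d s t + d t r)" using that triangle[of s t r] \<eta> by (intro mult_left_mono) (auto simp: T_def)
    then show ?thesis using that unfolding T_def by (auto simp: algebra_simps)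
  qed
  have "\<exists>t\<in>T s. \<forall>r\<in>T s. J t \<le> J r + e" if "s \<in> S" "e > 0" for s e
  proof -
    have bdd: "bdd_below (J ` T s)" using bounded by (intro bdd_belowI2[of _ B]) (auto simp: T_def)
    have "Inf (J ` T s) < Inf (J ` T s) + e" using that by simp
    then obtain t where t: "t \<in> T s" "J t < Inf (J ` T s) + e"
      using cInf_lessD[of "J ` T s"] T_self[OF \<open>s \<in> S\<close>] by blast
    then show ?thesis using cINF_lower[OF bdd] by (intro bexI[of _ t] ballI) (smt (verit), simp)
  qed
  then obtain nx where nx: "\<And>s e. s \<in> S \<Longrightarrow> e > 0 \<Longrightarrow> nx s e \<in> T s"
    "\<And>s e r. s \<in> S \<Longrightarrow> e > 0 \<Longrightarrow> r \<in> T s \<Longrightarrow> J (nx s e) \<le> J r + e" by metis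
  define \<sigma> where "\<sigma> = rec_nat s0 (\<lambda>j s. nx s (\<eta> * (1/2) ^ j))"
  have \<sigma>: "\<sigma> 0 = s0" "\<sigma> (Suc j) = nx (\<sigma> j) (\<eta> * (1/2) ^ j)" for j by (simp_all add: \<sigma>_def)
  have e: "\<eta> * (1/2) ^ j > 0" for j :: nat using \<eta> by simp
  have \<sigma>_S: "\<sigma> j \<in> S" for j
  proof (induction j)
    case (Suc j) then show ?case using nx(1)[OF Suc e] unfolding \<sigma> T_def by blast
  qed (simp add: \<sigma> s0)
  have \<sigma>_T: "\<sigma> (Suc j) \<in> T (\<sigma> j)" for j unfolding \<sigma>(2) by (rule nx(1)[OF \<sigma>_S e])
  have \<sigma>_T': "\<sigma> k \<in> T (\<sigma> j)" if "j \<le> k" for j k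
    using that
  proof (induction rule: dec_induct)
    case (step k) then show ?case using T_trans[OF step.IH \<sigma>_T \<sigma>_S] by blast
  qed (simp add: T_self \<sigma>_S)
  have approx: "J (\<sigma> (Suc j)) \<le> J r + \<eta> * (1/2) ^ j" if "r \<in> T (\<sigma> j)" for r j
    unfolding \<sigma>(2) by (rule nx(2)[OF \<sigma>_S e that])
  \<comment> \<open>Near-minimality up to \<open>\<eta> * (1/2) ^ j\<close> limits the next
    improvement and with it the next step. The first step has no such bound, so completeness is
    applied to the sequence from index one on.\<close>
  have dist: "d (\<sigma> (Suc j)) (\<sigma> (Suc (Suc j))) \<le> (1/2) ^ j" for j
  proof -
    have "\<sigma> (Suc (Suc j)) \<in> T (\<sigma> j)" by (rule \<sigma>_T') simp
    from approx[OF this] \<sigma>_T[of "Suc j"] have "\<eta> * d (\<sigma> (Suc j)) (\<sigma> (Suc (Suc j))) \<le> \<eta> * (1/2) ^ j"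
      unfolding T_def by simp
    then show ?thesis using \<eta> by simp
  qed
  have "\<exists>s\<in>S. (\<forall>j. J s \<le> J (\<sigma> (Suc j))) \<and> (\<lambda>j. d (\<sigma> (Suc j)) s) \<longlonglongrightarrow> 0"
  proof (rule complete)
    show "J (\<sigma> (Suc (Suc j))) \<le> J (\<sigma> (Suc j))" for j
      using \<sigma>_T[of "Suc j"] d_nonneg[of "\<sigma> (Suc j)" "\<sigma> (Suc (Suc j))"] \<eta> unfolding T_def
      by (smt (verit) mem_Collect_eq mult_nonneg_nonneg)
  qed (use \<sigma>_S dist in auto)
  then obtain s where s: "s \<in> S" "\<And>j. J s \<le> J (\<sigma> (Suc j))" "(\<lambda>j. d (\<sigma> (Suc j)) s) \<longlonglongrightarrow> 0" by blast
  have s_T: "s \<in> T (\<sigma> j)" for j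
  proof -
    have "J s + \<eta> * d (\<sigma> j) s \<le> J (\<sigma> j) + \<eta> * d (\<sigma> (Suc k)) s" if "j \<le> k" for k
    proof -
      have "\<sigma> (Suc k) \<in> T (\<sigma> j)" using that by (intro \<sigma>_T') simp
      then have "J (\<sigma> (Suc k)) + \<eta> * d (\<sigma> j) (\<sigma> (Suc k)) \<le> J (\<sigma> j)" by (simp add: T_def)
      moreover have "\<eta> * d (\<sigma> j) s \<le> \<eta> * (d (\<sigma> j) (\<sigma> (Suc k)) + d (\<sigma> (Suc k)) s)"
        using triangle[OF \<sigma>_S \<sigma>_S s(1)] \<eta> by (intro mult_left_mono) auto
      ultimately show ?thesis using s(2)[of k] by (simp add: algebra_simps)
    qed
    moreover have "(\<lambda>k. J (\<sigma> j) + \<eta> * d (\<sigma> (Suc k)) s) \<longlonglongrightarrow> J (\<sigma> j) + \<eta> * 0"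
      by (intro tendsto_intros s(3))
    ultimately have "J s + \<eta> * d (\<sigma> j) s \<le> J (\<sigma> j)"
      by (intro LIMSEQ_le_const[where X="\<lambda>k. J (\<sigma> j) + \<eta> * d (\<sigma> (Suc k)) s"]) auto
    then show ?thesis using s(1) by (simp add: T_def)
  qed
  have "J s \<le> J t + \<eta> * d s t" if "t \<in> S" for t
  proof (rule ccontr)
    assume less: "\<not> ?thesis"
    then have "t \<in> T s" using that by (simp add: T_def)
    then have "t \<in> T (\<sigma> j)" for j using T_trans[OF s_T _ \<sigma>_S] by blast
    then have "J s \<le> J t + \<eta> * (1/2) ^ j" for j using approx s(2)[of j] order_trans by blast
    moreover have "(\<lambda>j. J t + \<eta> * (1/2) ^ j) \<longlonglongrightarrow> J t + \<eta> * 0"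
      by (intro tendsto_intros LIMSEQ_power_zero) simp
    ultimately have "J s \<le> J t" by (intro LIMSEQ_le_const[where X="\<lambda>j. J t + \<eta> * (1/2) ^ j"]) auto
    moreover have "0 \<le> \<eta> * d s t" using \<eta> d_nonneg by simp
    ultimately show False using less by simp
  qed
  then show ?thesis using s(1) s_T[of 0] by (auto simp: T_def \<sigma>)
qed

section \<open>A smooth approximation of the norm\<close>

text \<open>The Euclidean length of the pair of \<open>\<theta>\<close> and \<open>norm z\<close>,
  lowered so as to vanish at the origin.\<close>

definition soft_norm :: "real \<Rightarrow> 'a::real_normed_vector \<Rightarrow> real" where
  "soft_norm \<theta> z = sqrt (\<theta>\<^sup>2 + (norm z)\<^sup>2) - \<theta>"

lemma soft_norm_0 [simp]: "0 \<le> \<theta> \<Longrightarrow> soft_norm \<theta> 0 = 0"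
  by (simp add: soft_norm_def)

lemma soft_norm_minus [simp]: "soft_norm \<theta> (- z) = soft_norm \<theta> z"
  by (simp add: soft_norm_def)

lemma soft_norm_nonneg: "0 \<le> \<theta> \<Longrightarrow> 0 \<le> soft_norm \<theta> z"
  using real_sqrt_sum_squares_ge1[of \<theta> "norm z"] by (simp add: soft_norm_def)

lemma soft_norm_ge: "norm z - \<theta> \<le> soft_norm \<theta> z"
  using real_sqrt_sum_squares_ge2[of "norm z" \<theta>] by (simp add: soft_norm_def)

lemma soft_norm_lipschitz: "\<bar>soft_norm \<theta> y - soft_norm \<theta> z\<bar> \<le> norm (y - z)"
proof -
  have "soft_norm \<theta> y - soft_norm \<theta> z \<le> norm (y - z)" for y z :: 'a
  proof -
    have "norm y \<le> norm z + norm (y - z)" by (rule norm_triangle_sub)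
    then have "sqrt (\<theta>\<^sup>2 + (norm y)\<^sup>2) \<le> sqrt ((\<theta> + 0)\<^sup>2 + (norm z + norm (y - z))\<^sup>2)"
      by (simp add: power_mono)
    also have "\<dots> \<le> sqrt (\<theta>\<^sup>2 + (norm z)\<^sup>2) + sqrt (0\<^sup>2 + (norm (y - z))\<^sup>2)"
      by (rule real_sqrt_sum_squares_triangle_ineq)
    finally show ?thesis by (simp add: soft_norm_def)
  qed
  from this[of y z] this[of z y] show ?thesis by (simp add: norm_minus_commute)
qed

lemma soft_norm_le: "0 \<le> \<theta> \<Longrightarrow> soft_norm \<theta> z \<le> norm z"
  using soft_norm_lipschitz[of \<theta> z 0] by simp

lemma continuous_soft_norm [continuous_intros]:
  "continuous_on S h \<Longrightarrow> continuous_on S (\<lambda>x. soft_norm \<theta> (h x))"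
  unfolding soft_norm_def by (intro continuous_intros)

lemma borel_measurable_soft_norm [measurable]: "soft_norm \<theta> \<in> borel_measurable borel"
  by (intro borel_measurable_continuous_onI continuous_intros)

text \<open>Solves the defining equation for the norm, so that a small soft norm forces a small
  norm.\<close>

lemma norm_eq_soft_norm:
  assumes "0 \<le> \<theta>"
  shows "norm z = sqrt ((soft_norm \<theta> z)\<^sup>2 + 2 * \<theta> * soft_norm \<theta> z)"
proof -
  define r where "r = sqrt (\<theta>\<^sup>2 + (norm z)\<^sup>2)"
  have "r\<^sup>2 = \<theta>\<^sup>2 + (norm z)\<^sup>2" by (simp add: r_def)
  then have "(r - \<theta>)\<^sup>2 + 2 * \<theta> * (r - \<theta>) = (norm z)\<^sup>2" by (simp add: power2_eq_square algebra_simps)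
  then show ?thesis unfolding soft_norm_def r_def by simp
qed

lemma soft_norm_tendsto_0_imp:
  assumes "0 \<le> \<theta>" "((\<lambda>n. soft_norm \<theta> (z n)) \<longlongrightarrow> 0) F"
  shows "(z \<longlongrightarrow> 0) F"
proof -
  have "((\<lambda>n. sqrt ((soft_norm \<theta> (z n))\<^sup>2 + 2 * \<theta> * soft_norm \<theta> (z n))) \<longlongrightarrow> sqrt (0\<^sup>2 + 2 * \<theta> * 0)) F"
    by (intro tendsto_intros assms)
  then show ?thesis by (simp add: norm_eq_soft_norm[OF assms(1), symmetric] tendsto_norm_zero_iff)
qed

text \<open>Convexity on the segment from the origin. After squaring, the two sides of the
  inequality for the root differ by
  \<open>2 * c * (1 - c) * \<theta> * (r - \<theta>)\<close>.\<close>

lemma soft_norm_scale_le: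
  assumes \<theta>: "0 \<le> \<theta>" and c: "0 \<le> c" "c \<le> 1"
  shows "soft_norm \<theta> (c *\<^sub>R z) \<le> c * soft_norm \<theta> z"
proof -
  define r where "r = sqrt (\<theta>\<^sup>2 + (norm z)\<^sup>2)"
  have r: "r\<^sup>2 = \<theta>\<^sup>2 + (norm z)\<^sup>2" "\<theta> \<le> r" using \<theta> by (simp_all add: r_def real_le_rsqrt)
  have "sqrt (\<theta>\<^sup>2 + (c * norm z)\<^sup>2) \<le> (1 - c) * \<theta> + c * r"
  proof (rule real_le_lsqrt)
    show "0 \<le> (1 - c) * \<theta> + c * r" using \<theta> c r(2) by simp
    have "0 \<le> 2 * c * (1 - c) * \<theta> * (r - \<theta>)" using \<theta> c r(2) by simp
    moreover have "((1 - c) * \<theta> + c * r)\<^sup>2 - (\<theta>\<^sup>2 + (c * norm z)\<^sup>2) = 2 * c * (1 - c) * \<theta> * (r - \<theta>) + c\<^sup>2 * (r\<^sup>2 - \<theta>\<^sup>2 - (norm z)\<^sup>2)"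
      by (simp add: power2_eq_square algebra_simps)
    moreover have "c\<^sup>2 * (r\<^sup>2 - \<theta>\<^sup>2 - (norm z)\<^sup>2) = 0" using r(1) by simp
    ultimately show "\<theta>\<^sup>2 + (c * norm z)\<^sup>2 \<le> ((1 - c) * \<theta> + c * r)\<^sup>2" by linarith
  qed
  then show ?thesis using c unfolding soft_norm_def r_def[symmetric] by (simp add: algebra_simps)
qed

text \<open>Steps \<open>1 / Suc n\<close> turn the derivative into the limit of a sequence, the
  form in which dominated convergence can use it.\<close>

lemma difference_quotient_LIMSEQ:
  fixes f :: "'a::real_normed_vector \<Rightarrow> real"
  assumes "(f has_derivative D) (at z)"
  shows "(\<lambda>n. real (Suc n) * (f (z + (1 / real (Suc n)) *\<^sub>R h) - f z)) \<longlonglongrightarrow> D h"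
proof -
  have lin: "linear D" using assms has_derivative_linear by blast
  have "((\<lambda>s. f (z + s *\<^sub>R h)) has_derivative (\<lambda>s. D (s *\<^sub>R h))) (at 0)"
  proof (rule has_derivative_compose[where f="\<lambda>s. z + s *\<^sub>R h" and g=f])
    show "((\<lambda>s. z + s *\<^sub>R h) has_derivative (\<lambda>s. s *\<^sub>R h)) (at 0)"
      by (auto intro!: derivative_eq_intros)
  qed (use assms in simp)
  then have "((\<lambda>s. f (z + s *\<^sub>R h)) has_field_derivative D h) (at 0)"
    by (rule has_derivative_imp_has_field_derivative) (simp add: linear_scale[OF lin])
  then have "((\<lambda>s. (f (z + s *\<^sub>R h) - f z) / s) \<longlongrightarrow> D h) (at 0)"
    by (simp add: has_field_derivative_iff)
  moreover have "filterlim (\<lambda>n. 1 / real (Suc n)) (at 0) sequentially"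
    unfolding filterlim_at using LIMSEQ_Suc[OF lim_1_over_n] by auto
  ultimately have "(\<lambda>n. (f (z + (1 / real (Suc n)) *\<^sub>R h) - f z) / (1 / real (Suc n))) \<longlonglongrightarrow> D h"
    by (rule filterlim_compose)
  then show ?thesis by (simp add: mult.commute)
qed

text \<open>Away from the origin this is the chain rule; at the origin the derivative is zero
  because the soft norm is of second order there. The norm bound comes from the Lipschitz property,
  the last inequality from convexity along the segment to the origin.\<close>

lemma soft_norm_gradient:
  assumes C1: "C1_on (- {0}) (norm :: 'a::separable_asplund \<Rightarrow> real)" and \<theta>: "0 < \<theta>"
  obtains D :: "'a \<Rightarrow> 'a::separable_asplund \<Rightarrow>\<^sub>L real" where "D \<in> borel_measurable borel"
    "\<And>z. (soft_norm \<theta> has_derivative D z) (at z)" "\<And>z. norm (D z) \<le> 1" "\<And>z. soft_norm \<theta> z \<le> D z z"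
proof
  define D :: "'a \<Rightarrow> 'a \<Rightarrow>\<^sub>L real" where
    "D z = (if z = 0 then 0 else (norm z / sqrt (\<theta>\<^sup>2 + (norm z)\<^sup>2)) *\<^sub>R gradient norm z)" for z
  have [measurable]: "gradient norm \<in> borel_measurable (restrict_space borel (- {0::'a}))"
    using C1 by (intro borel_measurable_continuous_on_restrict) (simp add: C1_on_def)
  have "(\<lambda>z. norm z / sqrt (\<theta>\<^sup>2 + (norm z)\<^sup>2)) \<in> borel_measurable (restrict_space borel (- {0::'a}))"
    by (intro measurable_restrict_space1) measurable
  then have "(\<lambda>z. (norm z / sqrt (\<theta>\<^sup>2 + (norm z)\<^sup>2)) *\<^sub>R gradient norm z) \<in> borel_measurable (restrict_space borel (- {0::'a}))"
    by measurable
  moreover have "- {0::'a} = {z. z \<noteq> 0}" by auto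
  ultimately show "D \<in> borel_measurable borel"
    unfolding D_def by (subst measurable_If_restrict_space_iff) simp_all
  show deriv: "(soft_norm \<theta> has_derivative D z) (at z)" for z
  proof (cases "z = 0")
    case False
    have "norm differentiable (at z)" using C1 False by (simp add: C1_on_def)
    then have "(norm has_derivative frechet_derivative norm (at z)) (at z)" by (simp add: frechet_derivative_works)
    then have n: "(norm has_derivative gradient norm z) (at z)"
      by (simp add: gradient_def bounded_linear_Blinfun_apply has_derivative_bounded_linear)
    have pos: "0 < \<theta>\<^sup>2 + (norm z)\<^sup>2" using \<theta> by (simp add: add_pos_nonneg)
    show ?thesis unfolding soft_norm_def
    proof (rule has_derivative_eq_rhs[OF has_derivative_diff[OF has_derivative_real_sqrt has_derivative_const]])
      show "((\<lambda>z. \<theta>\<^sup>2 + (norm z)\<^sup>2) has_derivative (\<lambda>h. 0 + real 2 * gradient norm z h * norm z ^ (2 - 1))) (at z)"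
        by (intro has_derivative_add has_derivative_const has_derivative_power n)
    qed (use pos False in \<open>auto simp: D_def fun_eq_iff blinfun.scaleR_left field_simps\<close>)
  next
    case True
    have "((\<lambda>y. (soft_norm \<theta> y - soft_norm \<theta> 0 - 0) /\<^sub>R norm (y - 0)) \<longlongrightarrow> 0) (at (0::'a))"
    proof (rule Lim_null_comparison)
      show "eventually (\<lambda>y. norm ((soft_norm \<theta> y - soft_norm \<theta> 0 - 0) /\<^sub>R norm (y - 0)) \<le> norm y / (2 * \<theta>)) (at (0::'a))"
      proof (rule always_eventually, rule allI)
        fix y :: 'a
        have "2 * \<theta> * soft_norm \<theta> y \<le> (soft_norm \<theta> y)\<^sup>2 + 2 * \<theta> * soft_norm \<theta> y" by simp
        also have "\<dots> = (norm y)\<^sup>2"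
          using norm_eq_soft_norm[of \<theta> y] \<theta> soft_norm_nonneg[of \<theta> y]
          by (metis add_nonneg_nonneg less_imp_le mult_nonneg_nonneg real_sqrt_pow2 zero_le_numeral zero_le_power2)
        finally have "2 * \<theta> * soft_norm \<theta> y \<le> (norm y)\<^sup>2" .
        then show "norm ((soft_norm \<theta> y - soft_norm \<theta> 0 - 0) /\<^sub>R norm (y - 0)) \<le> norm y / (2 * \<theta>)"
          using \<theta> soft_norm_nonneg[of \<theta> y] by (cases "y = 0") (auto simp: field_simps power2_eq_square)
      qed
      have "((\<lambda>y::'a. norm y / (2 * \<theta>)) \<longlongrightarrow> norm (0::'a) / (2 * \<theta>)) (at 0)" using \<theta> by (intro tendsto_intros) auto
      then show "((\<lambda>y::'a. norm y / (2 * \<theta>)) \<longlongrightarrow> 0) (at 0)" by simp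
    qed
    then show ?thesis using True by (simp add: has_derivative_at_within D_def zero_blinfun.rep_eq bounded_linear_zero)
  qed
  show "norm (D z) \<le> 1" for z
  proof (rule norm_blinfun_bound)
    fix h
    have "\<bar>D z h\<bar> \<le> norm h"
    proof (rule tendsto_upperbound[OF tendsto_rabs[OF difference_quotient_LIMSEQ[OF deriv]]])
      show "eventually (\<lambda>n. \<bar>real (Suc n) * (soft_norm \<theta> (z + (1 / real (Suc n)) *\<^sub>R h) - soft_norm \<theta> z)\<bar> \<le> norm h) sequentially"
      proof (rule always_eventually, rule allI)
        fix n
        have "\<bar>real (Suc n) * (soft_norm \<theta> (z + (1 / real (Suc n)) *\<^sub>R h) - soft_norm \<theta> z)\<bar>
            \<le> real (Suc n) * norm ((1 / real (Suc n)) *\<^sub>R h)"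
          unfolding abs_mult using soft_norm_lipschitz[of \<theta> "z + (1 / real (Suc n)) *\<^sub>R h" z]
          by (intro mult_mono) auto
        then show "\<bar>real (Suc n) * (soft_norm \<theta> (z + (1 / real (Suc n)) *\<^sub>R h) - soft_norm \<theta> z)\<bar> \<le> norm h" by simp
      qed
    qed simp
    then show "norm (D z h) \<le> 1 * norm h" by simp
  qed simp
  show "soft_norm \<theta> z \<le> D z z" for z
  proof -
    have "D z (- z) \<le> - soft_norm \<theta> z"
    proof (rule tendsto_upperbound[OF difference_quotient_LIMSEQ[OF deriv]])
      show "eventually (\<lambda>n. real (Suc n) * (soft_norm \<theta> (z + (1 / real (Suc n)) *\<^sub>R (- z)) - soft_norm \<theta> z) \<le> - soft_norm \<theta> z) sequentially"
      proof (rule always_eventually, rule allI)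
        fix n
        have "z + (1 / real (Suc n)) *\<^sub>R (- z) = (1 - 1 / real (Suc n)) *\<^sub>R z" by (simp add: algebra_simps)
        then have "soft_norm \<theta> (z + (1 / real (Suc n)) *\<^sub>R (- z)) \<le> (1 - 1 / real (Suc n)) * soft_norm \<theta> z"
          using soft_norm_scale_le[of \<theta> "1 - 1 / real (Suc n)" z] \<theta> by simp
        then have "real (Suc n) * (soft_norm \<theta> (z + (1 / real (Suc n)) *\<^sub>R (- z)) - soft_norm \<theta> z)
           \<le> real (Suc n) * ((1 - 1 / real (Suc n)) * soft_norm \<theta> z - soft_norm \<theta> z)"
          by (intro mult_left_mono) auto
        also have "\<dots> = - soft_norm \<theta> z" by (simp add: field_simps)
        finally show "real (Suc n) * (soft_norm \<theta> (z + (1 / real (Suc n)) *\<^sub>R (- z)) - soft_norm \<theta> z) \<le> - soft_norm \<theta> z" .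
      qed
    qed simp
    then show ?thesis by (simp add: blinfun.minus_right)
  qed
qed

section \<open>Convex normal integrands\<close>

lemma borel_measurable_blinfun_apply [measurable (raw)]:
  fixes f :: "'t \<Rightarrow> 'a::separable_asplund \<Rightarrow>\<^sub>L real"
  assumes "f \<in> borel_measurable N" "g \<in> borel_measurable N"
  shows "(\<lambda>x. blinfun_apply (f x) (g x)) \<in> borel_measurable N"
proof (rule borel_measurable_continuous_Pair[OF assms])
  show "continuous_on UNIV (\<lambda>x :: ('a \<Rightarrow>\<^sub>L real) \<times> 'a. blinfun_apply (fst x) (snd x))"
    by (intro continuous_intros)
qed

text \<open>Fatou's lemma for \<open>H - b\<close>, with finiteness and integrability of
  \<open>H\<close> as conclusions. Comparing strict real lower bounds says that \<open>H\<close> is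
  below the lower limit, in the form supplied by lower semicontinuity.\<close>

lemma integrable_Fatou_real:
  fixes h :: "nat \<Rightarrow> 't \<Rightarrow> real" and H :: "'t \<Rightarrow> ereal"
  assumes h: "\<And>j. integrable M (h j)" and b: "integrable M b"
    and lower: "\<And>j. AE t in M. b t \<le> h j t" and upper: "\<And>j. integral\<^sup>L M (h j) \<le> c j" and c: "c \<longlonglongrightarrow> c0"
    and H [measurable]: "H \<in> borel_measurable M" and H_lower: "AE t in M. ereal (b t) \<le> H t"
    and liminf: "AE t in M. \<forall>r. ereal r < H t \<longrightarrow> eventually (\<lambda>j. r < h j t) sequentially"
  shows "AE t in M. \<bar>H t\<bar> \<noteq> \<infinity>" "integrable M (\<lambda>t. real_of_ereal (H t))"
    "integral\<^sup>L M (\<lambda>t. real_of_ereal (H t)) \<le> c0"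
proof -
  have [measurable]: "b \<in> borel_measurable M" "\<And>j. h j \<in> borel_measurable M" using h b by auto
  define W where "W t = e2ennreal (H t - ereal (b t))" for t
  have [measurable]: "W \<in> borel_measurable M" unfolding W_def by measurable
  have "AE t in M. W t \<le> liminf (\<lambda>j. ennreal (h j t - b t))"
    using H_lower liminf
  proof eventually_elim
    case (elim t)
    show ?case
    proof (rule le_Liminf_iff[THEN iffD2], intro allI impI)
      fix y assume y: "y < W t"
      then obtain y' where y': "y = ennreal y'" "0 \<le> y'" by (cases y) auto
      have "ereal (y' + b t) < H t"
        using y y' elim(1) unfolding W_def by (cases "H t") (auto simp: ennreal_less_iff e2ennreal_ereal)
      then have "eventually (\<lambda>j. y' + b t < h j t) sequentially" using elim(2) by blast
      then show "eventually (\<lambda>j. y < ennreal (h j t - b t)) sequentially"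
        by eventually_elim (use y' in \<open>simp add: ennreal_less_iff\<close>)
    qed
  qed
  then have "(\<integral>\<^sup>+ t. W t \<partial>M) \<le> (\<integral>\<^sup>+ t. liminf (\<lambda>j. ennreal (h j t - b t)) \<partial>M)"
    by (rule nn_integral_mono_AE)
  also have "\<dots> \<le> liminf (\<lambda>j. \<integral>\<^sup>+ t. ennreal (h j t - b t) \<partial>M)"
    by (rule nn_integral_liminf) measurable
  also have "\<dots> \<le> liminf (\<lambda>j. ennreal (c j - integral\<^sup>L M b))"
  proof (rule Liminf_mono, rule always_eventually, rule allI)
    fix j
    have "(\<integral>\<^sup>+ t. ennreal (h j t - b t) \<partial>M) = ennreal (\<integral>t. h j t - b t \<partial>M)"
      using h b lower[of j] by (intro nn_integral_eq_integral) auto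
    also have "(\<integral>t. h j t - b t \<partial>M) = integral\<^sup>L M (h j) - integral\<^sup>L M b" using h b by simp
    also have "ennreal \<dots> \<le> ennreal (c j - integral\<^sup>L M b)" using upper[of j] by (intro ennreal_leI) simp
    finally show "(\<integral>\<^sup>+ t. ennreal (h j t - b t) \<partial>M) \<le> ennreal (c j - integral\<^sup>L M b)" .
  qed
  also have "\<dots> = ennreal (c0 - integral\<^sup>L M b)"
    by (intro lim_imp_Liminf tendsto_ennrealI tendsto_intros c) simp
  finally have W_le: "(\<integral>\<^sup>+ t. W t \<partial>M) \<le> ennreal (c0 - integral\<^sup>L M b)" .
  then have "(\<integral>\<^sup>+ t. W t \<partial>M) \<noteq> \<infinity>" by (metis ennreal_less_top infinity_ennreal_def le_less_trans less_irrefl)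
  then have "AE t in M. W t \<noteq> \<infinity>" by (intro nn_integral_PInf_AE) auto
  then show fin: "AE t in M. \<bar>H t\<bar> \<noteq> \<infinity>"
    using H_lower
  proof eventually_elim
    case (elim t) then show ?case by (cases "H t") (auto simp: W_def)
  qed
  have W_eq: "AE t in M. W t = ennreal (real_of_ereal (H t) - b t) \<and> b t \<le> real_of_ereal (H t)"
    using fin H_lower
  proof eventually_elim
    case (elim t) then show ?case by (cases "H t") (auto simp: W_def e2ennreal_ereal)
  qed
  have Hb: "integrable M (\<lambda>t. real_of_ereal (H t) - b t)"
  proof (rule integrableI_nonneg)
    show "AE t in M. 0 \<le> real_of_ereal (H t) - b t" using W_eq by eventually_elim simp
    have "(\<integral>\<^sup>+ t. ennreal (real_of_ereal (H t) - b t) \<partial>M) = (\<integral>\<^sup>+ t. W t \<partial>M)"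
      using W_eq by (intro nn_integral_cong_AE) auto
    then show "(\<integral>\<^sup>+ t. ennreal (real_of_ereal (H t) - b t) \<partial>M) < \<infinity>"
      using W_le by (simp add: le_less_trans)
  qed measurable
  then have "integrable M (\<lambda>t. (real_of_ereal (H t) - b t) + b t)" using b by (intro Bochner_Integration.integrable_add)
  then show iH: "integrable M (\<lambda>t. real_of_ereal (H t))" by simp
  have "ennreal (\<integral>t. real_of_ereal (H t) - b t \<partial>M) = (\<integral>\<^sup>+ t. ennreal (real_of_ereal (H t) - b t) \<partial>M)"
    using W_eq Hb by (intro nn_integral_eq_integral[symmetric]) auto
  also have "\<dots> = (\<integral>\<^sup>+ t. W t \<partial>M)" using W_eq by (intro nn_integral_cong_AE) auto
  finally have "ennreal (\<integral>t. real_of_ereal (H t) - b t \<partial>M) \<le> ennreal (c0 - integral\<^sup>L M b)" using W_le by simp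
  \<comment> \<open>\<open>ennreal\<close> cuts negative numbers off at zero; the comparison can be
    undone once the right-hand side is known to be nonnegative.\<close>
  moreover have "integral\<^sup>L M b \<le> c0"
  proof (rule LIMSEQ_le_const[OF c])
    have "integral\<^sup>L M b \<le> c j" for j
      using integral_mono_AE[OF b h lower[of j]] upper[of j] by simp
    then show "\<exists>N. \<forall>j\<ge>N. integral\<^sup>L M b \<le> c j" by blast
  qed
  ultimately have "(\<integral>t. real_of_ereal (H t) - b t \<partial>M) \<le> c0 - integral\<^sup>L M b"
    by (subst (asm) ennreal_le_iff) auto
  then show "integral\<^sup>L M (\<lambda>t. real_of_ereal (H t)) \<le> c0" using iH b by simp
qed

text \<open>The situation after translating the base point to the origin and repairing null sets, so
  that every condition holds at all \<open>t\<close>. The difference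
  \<open>a\<^sub>0 - g\<^sub>0\<close> bounds how far \<open>F t z + p t * norm z\<close> can fall
  below its value at the origin.\<close>

locale convex_integrand =
  fixes M :: "'t measure" and F :: "'t \<Rightarrow> 'a::separable_asplund \<Rightarrow> ereal" and p g\<^sub>0 a\<^sub>0 :: "'t \<Rightarrow> real"
  assumes complete: "complete_measure M" and sigma_finite: "sigma_finite_measure M"
    and F_normal: "normal_integrand M F"
    and F_convex: "\<And>t. t \<in> space M \<Longrightarrow> convex_ereal (F t)"
    and p_pos: "\<And>t. t \<in> space M \<Longrightarrow> 0 < p t"
    and p_int: "integrable M p" and g0_int: "integrable M g\<^sub>0" and a0_int: "integrable M a\<^sub>0"
    and F_lower: "\<And>t z. t \<in> space M \<Longrightarrow> ereal (g\<^sub>0 t - p t * norm z) \<le> F t z"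
    and F_zero: "\<And>t. t \<in> space M \<Longrightarrow> F t 0 = ereal (a\<^sub>0 t)"
begin

lemma measurable_data [measurable]:
  "p \<in> borel_measurable M" "g\<^sub>0 \<in> borel_measurable M" "a\<^sub>0 \<in> borel_measurable M"
  using p_int g0_int a0_int by auto

lemma F_measurable_compose [measurable (raw)]:
  assumes "h \<in> measurable N M" "u \<in> borel_measurable N"
  shows "(\<lambda>x. F (h x) (u x)) \<in> borel_measurable N"
proof -
  have "(\<lambda>x. (h x, u x)) \<in> measurable N (M \<Otimes>\<^sub>M borel)" using assms by measurable
  from measurable_compose[OF this, of "case_prod F" borel] F_normal show ?thesis
    by (simp add: normal_integrand_def)
qed

lemma F_lsc: "t \<in> space M \<Longrightarrow> lsc (F t)"
  using F_normal by (simp add: normal_integrand_def)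

lemma F_not_MInf: "t \<in> space M \<Longrightarrow> F t z \<noteq> - \<infinity>"
  using F_lower[of t z] by auto

lemma g0_le_a0: "t \<in> space M \<Longrightarrow> g\<^sub>0 t \<le> a\<^sub>0 t"
  using F_lower[of t 0] F_zero[of t] by simp

text \<open>A Castaing representation of the epigraph: one section for each ball of a countable
  family and each rational level. Controlling values as well as positions lets inequalities between
  \<open>F t\<close> and a continuous function be checked on countably many sections, which keeps
  the sets of admissible choices measurable.\<close>

lemma castaing:
  "\<exists>z :: nat \<Rightarrow> 't \<Rightarrow> 'a. (\<forall>i. z i \<in> borel_measurable M) \<and>
    (\<forall>t\<in>space M. \<forall>w e. F t w < \<infinity> \<longrightarrow> 0 < e \<longrightarrow> (\<exists>i. norm (z i t - w) < e \<and> F t (z i t) < F t w + ereal e))"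
proof -
  obtain d :: "nat \<Rightarrow> 'a" where d: "\<And>x e. 0 < e \<Longrightarrow> \<exists>n. dist (d n) x < e"
    using dense_sequence_exists by blast
  define E where "E i = {x \<in> space (M \<Otimes>\<^sub>M borel). dist (d (fst i)) (snd x) < 1 / real (Suc (fst (snd i))) \<and>
      F (fst x) (snd x) < ereal (real_of_rat (snd (snd i)))}" for i
  have E: "E i \<in> sets (M \<Otimes>\<^sub>M borel)" for i
    unfolding E_def by measurable
  have "\<exists>s. s \<in> borel_measurable M \<and> {t. \<exists>w. (t, w) \<in> E i} \<in> sets M \<and> (\<forall>t w. (t, w) \<in> E i \<longrightarrow> (t, s t) \<in> E i)" for i
    using measurable_selection[OF complete sigma_finite E[of i]] by metis
  then obtain s where s: "\<And>i. s i \<in> borel_measurable M" "\<And>i. {t. \<exists>w. (t, w) \<in> E i} \<in> sets M"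
    "\<And>i t w. (t, w) \<in> E i \<Longrightarrow> (t, s i t) \<in> E i" by metis
  define z where "z j t = (if t \<in> {t. \<exists>w. (t, w) \<in> E (from_nat j)} then s (from_nat j) t else 0)" for j t
  show ?thesis
  proof (intro exI[of _ z] conjI allI ballI impI)
    show "z j \<in> borel_measurable M" for j
      unfolding z_def by (intro measurable_If_set s borel_measurable_const) (use s(2) in auto)
    show "\<exists>i. norm (z i t - w) < e \<and> F t (z i t) < F t w + ereal e" if t: "t \<in> space M" and w: "F t w < \<infinity>" and e: "0 < e" for t w e
    proof -
      obtain r where r: "F t w = ereal r" using w F_not_MInf[OF t, of w] by (cases "F t w") auto
      obtain a where a: "r < real_of_rat a" "real_of_rat a < r + e" using of_rat_dense[of r "r + e"] e by auto
      obtain k where k: "1 / real (Suc k) < e / 2" using nat_approx_posE[of "e / 2"] e by auto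
      obtain n where n: "dist (d n) w < 1 / real (Suc k)" using d[of "1 / real (Suc k)" w] by auto
      have "(t, w) \<in> E (n, k, a)" using t n a(1) r by (simp add: E_def space_pair_measure)
      then have s_E: "(t, s (n, k, a) t) \<in> E (n, k, a)" by (rule s(3))
      then have s': "dist (d n) (s (n, k, a) t) < 1 / real (Suc k)" "F t (s (n, k, a) t) < ereal (real_of_rat a)"
        by (auto simp: E_def)
      have z: "z (to_nat (n, k, a)) t = s (n, k, a) t" using \<open>(t, w) \<in> E (n, k, a)\<close> by (auto simp: z_def)
      have "dist (s (n, k, a) t) w < e" using dist_triangle3[of "s (n, k, a) t" w "d n"] s'(1) n k by linarith
      moreover have "F t (s (n, k, a) t) < F t w + ereal e"
        using s'(2) a(2) r by (metis less_ereal.simps(1) order_less_trans plus_ereal.simps(1))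
      ultimately show ?thesis by (intro exI[of _ "to_nat (n, k, a)"]) (simp add: z dist_norm)
    qed
  qed
qed

lemma lower_bound_if_dense:
  assumes t: "t \<in> space M"
    and dense: "\<And>w e. F t w < \<infinity> \<Longrightarrow> 0 < e \<Longrightarrow> \<exists>i. norm (z i t - w) < e \<and> F t (z i t) < F t w + ereal e"
    and cont: "continuous_on UNIV h" and le: "\<And>i. ereal (h (z i t)) \<le> F t (z i t)"
  shows "ereal (h w) \<le> F t w"
proof (cases "F t w < \<infinity>")
  case True
  then obtain r where r: "F t w = ereal r" using F_not_MInf[OF t, of w] by (cases "F t w") auto
  have "h w \<le> r + e" if e: "e > 0" for e
  proof -
    obtain \<delta> where \<delta>: "\<delta> > 0" "\<And>y. dist y w < \<delta> \<Longrightarrow> dist (h y) (h w) < e / 2"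
      using cont e unfolding continuous_on_iff by (metis UNIV_I half_gt_zero)
    obtain i where i: "norm (z i t - w) < min \<delta> (e / 2)" "F t (z i t) < F t w + ereal (min \<delta> (e / 2))"
      using dense[OF True, of "min \<delta> (e / 2)"] \<delta>(1) e by auto
    have "ereal (h (z i t)) < ereal (r + min \<delta> (e / 2))" 
      using i(2) unfolding r plus_ereal.simps by (rule le_less_trans[OF le])
    then have "h (z i t) < r + e / 2" by simp
    moreover have "\<bar>h (z i t) - h w\<bar> < e / 2" using \<delta>(2)[of "z i t"] i(1) by (simp add: dist_norm)
    ultimately show ?thesis by linarith
  qed
  then show ?thesis unfolding r by (simp add: field_le_epsilon)
qed auto

text \<open>Pointwise existence is \<open>convex_subgradient_exists\<close>. Testing the subgradient
  inequality only along a Castaing representation makes the set of admissible pairs measurable, so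
  that the selection theorem applies.\<close>

lemma subgradient_selection:
  fixes q :: "'t \<Rightarrow> 'a \<Rightarrow>\<^sub>L real"
  assumes [measurable]: "u \<in> borel_measurable M" "q \<in> borel_measurable M" "s \<in> borel_measurable M"
    and s: "\<And>t. t \<in> space M \<Longrightarrow> 0 \<le> s t"
    and fin: "AE t in M. \<bar>F t (u t)\<bar> \<noteq> \<infinity>"
    and le: "AE t in M. \<forall>z. ereal (real_of_ereal (F t (u t)) - q t (z - u t) - s t * norm (z - u t)) \<le> F t z"
  obtains v where "v \<in> borel_measurable M" "AE t in M. v t \<in> subdifferential (F t) (u t)" "AE t in M. norm (v t + q t) \<le> s t"
proof -
  obtain z :: "nat \<Rightarrow> 't \<Rightarrow> 'a" where z [measurable]: "\<And>i. z i \<in> borel_measurable M"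
    and dense: "\<And>t w e. t \<in> space M \<Longrightarrow> F t w < \<infinity> \<Longrightarrow> 0 < e \<Longrightarrow> \<exists>i. norm (z i t - w) < e \<and> F t (z i t) < F t w + ereal e"
    using castaing by blast
  define D where "D = {x \<in> space (M \<Otimes>\<^sub>M (borel :: ('a \<Rightarrow>\<^sub>L real) measure)). norm (snd x + q (fst x)) \<le> s (fst x) \<and>
      (\<forall>i. ereal (real_of_ereal (F (fst x) (u (fst x))) + snd x (z i (fst x) - u (fst x))) \<le> F (fst x) (z i (fst x)))}"
  have "D \<in> sets (M \<Otimes>\<^sub>M borel)" unfolding D_def by measurable
  from measurable_selection[OF complete sigma_finite this] obtain v where
    v: "v \<in> borel_measurable M" "\<And>t w. (t, w) \<in> D \<Longrightarrow> (t, v t) \<in> D" by metis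
  have "AE t in M. v t \<in> subdifferential (F t) (u t) \<and> norm (v t + q t) \<le> s t"
    using fin le AE_space
  proof eventually_elim
    case (elim t)
    then have t: "t \<in> space M" by simp
    obtain r where r: "F t (u t) = ereal r" using elim(1) by (cases "F t (u t)") auto
    obtain w where "norm (w + q t) \<le> s t" "\<And>z. ereal (r + w (z - u t)) \<le> F t z"
      using convex_subgradient_exists[OF F_convex[OF t] s[OF t], of r "q t" "u t"] elim(2) r by auto
    then have "(t, w) \<in> D" using t by (simp add: D_def space_pair_measure r)
    then have "(t, v t) \<in> D" by (rule v(2))
    then have vD: "norm (v t + q t) \<le> s t" "\<And>i. ereal (r + v t (z i t - u t)) \<le> F t (z i t)"
      by (auto simp: D_def r)
    have "ereal (r + v t (y - u t)) \<le> F t y" for y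
      by (rule lower_bound_if_dense[where z=z and h="\<lambda>y. r + v t (y - u t)", OF t dense[OF t] _ vD(2)])
        (assumption | intro continuous_intros)+
    then have "ereal (v t (y - u t)) \<le> F t y - F t (u t)" for y
      unfolding r by (cases "F t y") (auto simp: add.commute le_diff_eq dest: meta_spec[of _ y])
    then show ?case using vD(1) r by (simp add: subdifferential_def)
  qed
  then show ?thesis using v(1) that by auto
qed

lemma seq_closed_sublevel:
  assumes t: "t \<in> space M" and conv: "\<sigma> \<longlonglongrightarrow> z" and le: "\<And>j. F t (\<sigma> j) \<le> ereal (c j)" and c: "c \<longlonglongrightarrow> c0"
  shows "F t z \<le> ereal c0"
proof (rule ccontr)
  assume "\<not> F t z \<le> ereal c0"
  then have "ereal c0 < F t z" by simp
  then obtain b where b: "ereal c0 < ereal b" "ereal b < F t z" using ereal_dense2 by blast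
  have "eventually (\<lambda>j. \<sigma> j \<in> {x. ereal b < F t x}) sequentially"
    using F_lsc[OF t] b(2) by (intro topological_tendstoD[OF conv]) (auto simp: lsc_def)
  moreover have "eventually (\<lambda>j. c j < b) sequentially" using b(1) c by (intro order_tendstoD(2)) auto
  ultimately have "eventually (\<lambda>j. False) sequentially"
  proof eventually_elim
    case (elim j)
    then have "ereal b < ereal (c j)" using le[of j] by (metis (mono_tags, lifting) mem_Collect_eq order_less_le_trans)
    then show ?case using elim by simp
  qed
  then show False by simp
qed

text \<open>Ekeland's principle for \<open>F t z + p t * norm z\<close>, started at the origin. This
  function is bounded below by \<open>g\<^sub>0 t\<close>, so the drop from the start is at most
  \<open>a\<^sub>0 t - g\<^sub>0 t\<close>, and the factor \<open>1 / \<rho>\<close> in the slope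
  keeps the point in the ball.\<close>

lemma pointwise_ekeland:
  assumes t: "t \<in> space M" and \<rho>: "0 < \<rho>"
  shows "\<exists>u. norm u \<le> \<rho> \<and> F t u < \<infinity> \<and>
    (\<forall>z. ereal (real_of_ereal (F t u) - (p t + (a\<^sub>0 t - g\<^sub>0 t + p t) / \<rho>) * norm (z - u)) \<le> F t z)"
proof -
  define S where "S = {z. F t z < \<infinity>}"
  define J where "J z = real_of_ereal (F t z) + p t * norm z" for z
  \<comment> \<open>The summand \<open>p t\<close> keeps the slope positive even if
    \<open>a\<^sub>0 t = g\<^sub>0 t\<close>.\<close>
  define \<eta> where "\<eta> = (a\<^sub>0 t - g\<^sub>0 t + p t) / \<rho>"
  have m0: "0 \<le> a\<^sub>0 t - g\<^sub>0 t" "0 < p t" using g0_le_a0[OF t] p_pos[OF t] by auto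
  have \<eta>: "\<eta> > 0" using m0 \<rho> by (simp add: \<eta>_def)
  have real: "F t z = ereal (real_of_ereal (F t z))" if "z \<in> S" for z
    using that F_not_MInf[OF t, of z] by (cases "F t z") (auto simp: S_def)
  have lower: "g\<^sub>0 t \<le> J z" if "z \<in> S" for z
  proof -
    have "ereal (g\<^sub>0 t - p t * norm z) \<le> ereal (real_of_ereal (F t z))" using F_lower[OF t, of z] real[OF that] by simp
    then show ?thesis by (simp add: J_def)
  qed
  have "\<exists>s\<in>S. J s + \<eta> * dist 0 s \<le> J 0 \<and> (\<forall>z\<in>S. J s \<le> J z + \<eta> * dist s z)"
  proof (rule ekeland[where B="g\<^sub>0 t"])
    show "0 \<in> S" by (simp add: S_def F_zero[OF t])
    show "dist s r \<le> dist s z + dist z r" for s z r :: 'a by (rule dist_triangle)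
    fix \<sigma> assume \<sigma>: "\<And>j. \<sigma> j \<in> S" "\<And>j. dist (\<sigma> j) (\<sigma> (Suc j)) \<le> (1/2) ^ j" "\<And>j. J (\<sigma> (Suc j)) \<le> J (\<sigma> j)"
    have "summable (\<lambda>j. norm (\<sigma> (Suc j) - \<sigma> j))"
      using \<sigma>(2) by (intro summable_comparison_test[OF _ summable_geometric[of "1/2 :: real"]])
        (auto simp: dist_norm norm_minus_commute)
    then have "summable (\<lambda>j. \<sigma> (Suc j) - \<sigma> j)" by (rule summable_norm_cancel)
    then obtain l where "(\<lambda>n. \<Sum>j<n. \<sigma> (Suc j) - \<sigma> j) \<longlonglongrightarrow> l" by (auto simp: summable_def sums_def)
    then have "(\<lambda>n. \<sigma> n - \<sigma> 0) \<longlonglongrightarrow> l" by (simp add: sum_lessThan_telescope)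
    from tendsto_add[OF this tendsto_const[of "\<sigma> 0"]] have lim: "\<sigma> \<longlonglongrightarrow> l + \<sigma> 0" by simp
    have dec: "J (\<sigma> k) \<le> J (\<sigma> j)" if "j \<le> k" for j k
      using that by (rule lift_Suc_antimono_le[of "\<lambda>j. J (\<sigma> j)", OF \<sigma>(3)])
    have F_le: "F t (l + \<sigma> 0) \<le> ereal (J (\<sigma> j) - p t * norm (l + \<sigma> 0))" for j
    proof (rule seq_closed_sublevel[OF t, where \<sigma>="\<lambda>k. \<sigma> (k + j)" and c="\<lambda>k. J (\<sigma> j) - p t * norm (\<sigma> (k + j))"])
      show lim': "(\<lambda>k. \<sigma> (k + j)) \<longlonglongrightarrow> l + \<sigma> 0" using lim by (rule LIMSEQ_ignore_initial_segment)
      show "(\<lambda>k. J (\<sigma> j) - p t * norm (\<sigma> (k + j))) \<longlonglongrightarrow> J (\<sigma> j) - p t * norm (l + \<sigma> 0)"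
        by (intro tendsto_intros lim')
      show "F t (\<sigma> (k + j)) \<le> ereal (J (\<sigma> j) - p t * norm (\<sigma> (k + j)))" for k
        using dec[of j "k + j"] by (subst real[OF \<sigma>(1)]) (simp add: J_def)
    qed
    have l_S: "l + \<sigma> 0 \<in> S" using F_le[of 0] by (auto simp: S_def intro: le_less_trans)
    have "J (l + \<sigma> 0) \<le> J (\<sigma> j)" for j using F_le[of j] by (subst (asm) real[OF l_S]) (simp add: J_def)
    moreover have "(\<lambda>j. dist (\<sigma> j) (l + \<sigma> 0)) \<longlonglongrightarrow> 0" using lim by (subst (asm) tendsto_dist_iff)
    ultimately show "\<exists>s\<in>S. (\<forall>j. J s \<le> J (\<sigma> j)) \<and> (\<lambda>j. dist (\<sigma> j) s) \<longlonglongrightarrow> 0" using l_S by blast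
  qed (use \<eta> lower in auto)
  then obtain u where u: "u \<in> S" "J u + \<eta> * norm u \<le> J 0" "\<And>z. z \<in> S \<Longrightarrow> J u \<le> J z + \<eta> * norm (z - u)"
    by (auto simp: dist_norm norm_minus_commute)
  have "J 0 = a\<^sub>0 t" by (simp add: J_def F_zero[OF t])
  then have "\<eta> * norm u \<le> a\<^sub>0 t - g\<^sub>0 t" using u(2) lower[OF u(1)] by simp
  also have "\<dots> \<le> \<eta> * \<rho>" using m0 \<rho> by (simp add: \<eta>_def)
  finally have "norm u \<le> \<rho>" using \<eta> by simp
  moreover have "ereal (real_of_ereal (F t u) - (p t + \<eta>) * norm (z - u)) \<le> F t z" for z
  proof (cases "z \<in> S")
    case True
    have "p t * norm z \<le> p t * (norm u + norm (z - u))"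
      using m0 by (intro mult_left_mono) (auto intro: norm_triangle_sub)
    then have "real_of_ereal (F t u) - (p t + \<eta>) * norm (z - u) \<le> real_of_ereal (F t z)"
      using u(3)[OF True] by (simp add: J_def algebra_simps)
    then show ?thesis by (subst real[OF True]) simp
  next
    case False then show ?thesis by (simp add: S_def)
  qed
  ultimately show ?thesis using u(1) unfolding \<eta>_def S_def by blast
qed

text \<open>Supplies bounded points with integrably bounded subgradients. They serve as the
  replacement where a minimizing function leaves the neighbourhood of \<open>y\<close>.\<close>

lemma near_zero_subgradient_selection:
  assumes \<rho>: "0 < \<rho>"
  obtains u v where "u \<in> borel_measurable M" "v \<in> borel_measurable M" "AE t in M. norm (u t) \<le> \<rho>"
    "AE t in M. v t \<in> subdifferential (F t) (u t)" "AE t in M. norm (v t) \<le> p t + (a\<^sub>0 t - g\<^sub>0 t + p t) / \<rho>"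
proof -
  obtain z :: "nat \<Rightarrow> 't \<Rightarrow> 'a" where z [measurable]: "\<And>i. z i \<in> borel_measurable M"
    and dense: "\<And>t w e. t \<in> space M \<Longrightarrow> F t w < \<infinity> \<Longrightarrow> 0 < e \<Longrightarrow> \<exists>i. norm (z i t - w) < e \<and> F t (z i t) < F t w + ereal e"
    using castaing by blast
  define s where "s t = p t + (a\<^sub>0 t - g\<^sub>0 t + p t) / \<rho>" for t
  have [measurable]: "s \<in> borel_measurable M" unfolding s_def by measurable
  have s: "0 \<le> s t" if "t \<in> space M" for t
    using g0_le_a0[OF that] p_pos[OF that] \<rho> by (simp add: s_def)
  define D where "D = {x \<in> space (M \<Otimes>\<^sub>M (borel :: 'a measure)). norm (snd x) \<le> \<rho> \<and> F (fst x) (snd x) < \<infinity> \<and>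
      (\<forall>i. ereal (real_of_ereal (F (fst x) (snd x)) - s (fst x) * norm (z i (fst x) - snd x)) \<le> F (fst x) (z i (fst x)))}"
  have "D \<in> sets (M \<Otimes>\<^sub>M borel)" unfolding D_def by measurable
  from measurable_selection[OF complete sigma_finite this] obtain u where
    u: "u \<in> borel_measurable M" "\<And>t w. (t, w) \<in> D \<Longrightarrow> (t, u t) \<in> D" by metis
  have u_D: "(t, u t) \<in> D" if t: "t \<in> space M" for t
  proof -
    obtain w where "(t, w) \<in> D"
      using pointwise_ekeland[OF t \<rho>] t by (auto simp: D_def space_pair_measure s_def)
    then show ?thesis by (rule u(2))
  qed
  have fin: "\<bar>F t (u t)\<bar> \<noteq> \<infinity>" if t: "t \<in> space M" for t
    using u_D[OF t] F_not_MInf[OF t, of "u t"] by (auto simp: D_def)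
  have "ereal (real_of_ereal (F t (u t)) - blinfun_apply 0 (w - u t) - s t * norm (w - u t)) \<le> F t w"
    if t: "t \<in> space M" for t w
  proof -
    have "ereal (real_of_ereal (F t (u t)) - s t * norm (w - u t)) \<le> F t w"
    proof (rule lower_bound_if_dense[where z=z and h="\<lambda>w. real_of_ereal (F t (u t)) - s t * norm (w - u t)", OF t dense[OF t]])
      show "continuous_on UNIV (\<lambda>w. real_of_ereal (F t (u t)) - s t * norm (w - u t))" by (intro continuous_intros)
    qed (use u_D[OF t] in \<open>auto simp: D_def\<close>)
    then show ?thesis by simp
  qed
  then obtain v where v: "v \<in> borel_measurable M" "AE t in M. v t \<in> subdifferential (F t) (u t)" "AE t in M. norm (v t + 0) \<le> s t"
    using subgradient_selection[of u "\<lambda>_. 0" s] u(1) s fin by (auto simp: AE_I2)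
  show ?thesis
  proof (rule that[OF u(1) v(1) _ v(2)])
    show "AE t in M. norm (u t) \<le> \<rho>" using u_D by (intro AE_I2) (auto simp: D_def)
    show "AE t in M. norm (v t) \<le> p t + (a\<^sub>0 t - g\<^sub>0 t + p t) / \<rho>" using v(3) by (simp add: s_def)
  qed
qed

end

section \<open>Penalization\<close>

text \<open>Geometric decay makes the sum of the functions integrable. This gives convergence almost
  everywhere of a whole sequence, without passing to a subsequence.\<close>

lemma AE_summable_if_integrals_geometric:
  fixes f :: "nat \<Rightarrow> 't \<Rightarrow> real"
  assumes int: "\<And>j. integrable M (f j)" and nonneg: "\<And>j t. t \<in> space M \<Longrightarrow> 0 \<le> f j t"
    and le: "\<And>j. integral\<^sup>L M (f j) \<le> K * (1/2) ^ j"
  shows "AE t in M. summable (\<lambda>j. f j t)"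
proof -
  have [measurable]: "\<And>j. f j \<in> borel_measurable M" using int by auto
  have "0 \<le> integral\<^sup>L M (f 0)" using nonneg by (intro integral_nonneg_AE AE_I2)
  then have K: "0 \<le> K" using le[of 0] by simp
  have "(\<integral>\<^sup>+ t. (\<Sum>j. ennreal (f j t)) \<partial>M) = (\<Sum>j. \<integral>\<^sup>+ t. ennreal (f j t) \<partial>M)"
    by (rule nn_integral_suminf) measurable
  also have "\<dots> = (\<Sum>j. ennreal (integral\<^sup>L M (f j)))"
    by (intro suminf_cong nn_integral_eq_integral int AE_I2 nonneg)
  also have "\<dots> \<le> (\<Sum>j. ennreal (K * (1/2) ^ j))"
    by (intro suminf_le ennreal_leI le) auto
  also have "\<dots> = ennreal (\<Sum>j. K * (1/2) ^ j)"
    using K by (intro suminf_ennreal2 summable_mult summable_geometric) auto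
  finally have "(\<integral>\<^sup>+ t. (\<Sum>j. ennreal (f j t)) \<partial>M) \<noteq> \<infinity>" by (metis ennreal_less_top infinity_ennreal_def le_less_trans less_irrefl)
  then have "AE t in M. (\<Sum>j. ennreal (f j t)) \<noteq> \<infinity>" by (intro nn_integral_PInf_AE) auto
  then show ?thesis using AE_space
  proof eventually_elim
    case (elim t) then show ?case using nonneg[of t] by (intro summable_suminf_not_top) auto
  qed
qed

text \<open>\<open>xs\<close> is the candidate subgradient at the origin. \<open>subgrad\<close> is
  phrased with an integrable representative \<open>b\<close>, so that only real integrals enter;
  vectors \<open>y\<close> without such a representative impose nothing.\<close>

locale penalization = convex_integrand M F p g\<^sub>0 a\<^sub>0
  for M :: "'t measure" and F :: "'t \<Rightarrow> 'a::separable_asplund \<Rightarrow> ereal" and p g\<^sub>0 a\<^sub>0 :: "'t \<Rightarrow> real" +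
  fixes C :: "'a set" and R \<theta> :: real and xs :: "'a \<Rightarrow>\<^sub>L real" and D :: "'a \<Rightarrow> 'a \<Rightarrow>\<^sub>L real"
  assumes C_convex: "convex C" and C_sym: "\<And>y. y \<in> C \<Longrightarrow> - y \<in> C" and C_zero: "0 \<in> C" and C_closed: "closed C"
    and C_bound: "\<And>y. y \<in> C \<Longrightarrow> norm y \<le> R"
    and C_weak: "\<And>s :: nat \<Rightarrow> 'a. (\<And>n. s n \<in> C) \<Longrightarrow>
       \<exists>r y. strict_mono r \<and> y \<in> C \<and> (\<forall>l :: 'a \<Rightarrow>\<^sub>L real. (\<lambda>n. l (s (r n))) \<longlonglongrightarrow> l y)"
    and theta: "0 < \<theta>"
    and D_measurable: "D \<in> borel_measurable borel"
    and D_deriv: "\<And>z. (soft_norm \<theta> has_derivative D z) (at z)"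
    and D_norm: "\<And>z. norm (D z) \<le> 1" and D_ge: "\<And>z. soft_norm \<theta> z \<le> D z z"
    and subgrad: "\<And>y b. integrable M b \<Longrightarrow> AE t in M. F t y = ereal (b t) \<Longrightarrow>
       integral\<^sup>L M a\<^sub>0 + xs y \<le> integral\<^sup>L M b"
begin

abbreviation "Fr t z \<equiv> real_of_ereal (F t z)"

text \<open>The effective domain of the functional. Integrability of
  \<open>p t * norm (u t)\<close>, in place of boundedness of \<open>u\<close>, is a condition that
  survives limits in the distance \<open>d\<close>.\<close>

definition S :: "('a \<times> ('t \<Rightarrow> 'a)) set" where
  "S = {s. fst s \<in> C \<and> snd s \<in> borel_measurable M \<and> integrable M (\<lambda>t. p t * norm (snd s t)) \<and>
     (AE t in M. \<bar>F t (snd s t)\<bar> \<noteq> \<infinity>) \<and> integrable M (\<lambda>t. Fr t (snd s t))}"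

definition penalized :: "nat \<Rightarrow> 'a \<times> ('t \<Rightarrow> 'a) \<Rightarrow> 't \<Rightarrow> real" where
  "penalized n s t = Fr t (snd s t) + real n * (p t * soft_norm \<theta> (snd s t - fst s))"

definition J :: "nat \<Rightarrow> 'a \<times> ('t \<Rightarrow> 'a) \<Rightarrow> real" where
  "J n s = integral\<^sup>L M (penalized n s) - xs (fst s)"

definition d :: "'a \<times> ('t \<Rightarrow> 'a) \<Rightarrow> 'a \<times> ('t \<Rightarrow> 'a) \<Rightarrow> real" where
  "d s s' = norm (fst s - fst s') + (\<integral>t. p t * norm (snd s t - snd s' t) \<partial>M)"

text \<open>The minorant falls by \<open>p t * norm (u t)\<close>, and \<open>norm (u t)\<close> is
  at most \<open>R + \<theta>\<close> plus the soft norm of \<open>u t - y\<close>. One unit of the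
  penalty absorbs the last part, which is why \<open>n - 1\<close> units remain in
  \<open>penalized_lower\<close>.\<close>

definition lower_fun :: "'t \<Rightarrow> real" where
  "lower_fun t = g\<^sub>0 t - (R + \<theta>) * p t"

lemma R_nonneg: "0 \<le> R"
  using C_bound[OF C_zero] by simp

lemma integrable_lower_fun: "integrable M lower_fun"
  unfolding lower_fun_def using g0_int p_int by simp

lemma integrable_weighted_bounded:
  fixes h :: "'t \<Rightarrow> 'a"
  assumes "h \<in> borel_measurable M" "\<And>t. t \<in> space M \<Longrightarrow> norm (h t) \<le> K"
  shows "integrable M (\<lambda>t. p t * norm (h t))"
proof (rule Bochner_Integration.integrable_bound)
  note [measurable] = assms(1)
  show "(\<lambda>t. p t * norm (h t)) \<in> borel_measurable M" by measurable
  show "integrable M (\<lambda>t. K * p t)" using p_int by simp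
  show "AE t in M. norm (p t * norm (h t)) \<le> norm (K * p t)"
  proof (rule AE_I2)
    fix t assume t: "t \<in> space M"
    have "0 \<le> K" using assms(2)[OF t] norm_ge_zero order_trans by blast
    then show "norm (p t * norm (h t)) \<le> norm (K * p t)"
      using assms(2)[OF t] p_pos[OF t] by (simp add: abs_mult mult.commute mult_right_mono)
  qed
qed

lemma integrable_weighted_diff:
  fixes u v :: "'t \<Rightarrow> 'a"
  assumes "u \<in> borel_measurable M" "integrable M (\<lambda>t. p t * norm (u t))"
    and "v \<in> borel_measurable M" "integrable M (\<lambda>t. p t * norm (v t))"
  shows "integrable M (\<lambda>t. p t * norm (u t - v t))"
proof (rule Bochner_Integration.integrable_bound)
  note [measurable] = assms(1,3)
  show "(\<lambda>t. p t * norm (u t - v t)) \<in> borel_measurable M" by measurable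
  show "integrable M (\<lambda>t. p t * norm (u t) + p t * norm (v t))" using assms by simp
  show "AE t in M. norm (p t * norm (u t - v t)) \<le> norm (p t * norm (u t) + p t * norm (v t))"
  proof (rule AE_I2)
    fix t assume t: "t \<in> space M"
    have "p t * norm (u t - v t) \<le> p t * (norm (u t) + norm (v t))"
      using p_pos[OF t] by (intro mult_left_mono norm_triangle_ineq4) auto
    then show "norm (p t * norm (u t - v t)) \<le> norm (p t * norm (u t) + p t * norm (v t))"
      using p_pos[OF t] by (simp add: algebra_simps)
  qed
qed

lemma integrable_weighted_soft_norm:
  fixes u :: "'t \<Rightarrow> 'a"
  assumes "u \<in> borel_measurable M" "integrable M (\<lambda>t. p t * norm (u t))"
  shows "integrable M (\<lambda>t. p t * soft_norm \<theta> (u t - y))"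
proof (rule Bochner_Integration.integrable_bound)
  note [measurable] = assms(1)
  show "(\<lambda>t. p t * soft_norm \<theta> (u t - y)) \<in> borel_measurable M" by measurable
  show "integrable M (\<lambda>t. p t * norm (u t - y))"
    using assms integrable_weighted_bounded[of "\<lambda>_. y" "norm y"] by (intro integrable_weighted_diff) auto
  have "\<bar>soft_norm \<theta> z\<bar> \<le> norm z" for z :: 'a using soft_norm_lipschitz[of \<theta> z 0] theta by simp
  then show "AE t in M. norm (p t * soft_norm \<theta> (u t - y)) \<le> norm (p t * norm (u t - y))"
    using p_pos by (intro AE_I2) (auto simp: abs_mult intro!: mult_left_mono)
qed

lemma integrable_penalized: "s \<in> S \<Longrightarrow> integrable M (penalized n s)"
  unfolding penalized_def S_def
  by (intro Bochner_Integration.integrable_add integrable_mult_right integrable_weighted_soft_norm) auto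

lemma penalized_lower:
  assumes t: "t \<in> space M" and "norm (fst s) \<le> R" and fin: "\<bar>F t (snd s t)\<bar> \<noteq> \<infinity>" and n: "1 \<le> n"
  shows "lower_fun t + (real n - 1) * (p t * soft_norm \<theta> (snd s t - fst s)) \<le> penalized n s t"
proof -
  have "ereal (g\<^sub>0 t - p t * norm (snd s t)) \<le> ereal (Fr t (snd s t))"
    using F_lower[OF t, of "snd s t"] fin by (simp add: ereal_real)
  moreover have "norm (snd s t) \<le> R + \<theta> + soft_norm \<theta> (snd s t - fst s)"
    using soft_norm_ge[of "snd s t - fst s" \<theta>] norm_triangle_sub[of "snd s t" "fst s"] assms(2) by linarith
  then have "p t * norm (snd s t) \<le> p t * (R + \<theta> + soft_norm \<theta> (snd s t - fst s))"
    using p_pos[OF t] by (intro mult_left_mono) auto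
  ultimately show ?thesis by (simp add: penalized_def lower_fun_def algebra_simps)
qed

lemma soft_norm_weighted_nonneg: "t \<in> space M \<Longrightarrow> 0 \<le> p t * soft_norm \<theta> z"
  using p_pos[of t] soft_norm_nonneg[of \<theta> z] theta by simp

lemma penalized_ge_lower_fun:
  assumes "s \<in> S" "1 \<le> n"
  shows "AE t in M. lower_fun t \<le> penalized n s t"
proof -
  have fin: "AE t in M. \<bar>F t (snd s t)\<bar> \<noteq> \<infinity>" and R: "norm (fst s) \<le> R" using assms C_bound by (auto simp: S_def)
  show ?thesis using fin AE_space
  proof eventually_elim
    case (elim t)
    have "0 \<le> (real n - 1) * (p t * soft_norm \<theta> (snd s t - fst s))"
      by (intro mult_nonneg_nonneg[OF _ soft_norm_weighted_nonneg[OF elim(2)]]) (use assms(2) in simp)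
    then show ?case using penalized_lower[OF elim(2) R elim(1) assms(2)] by linarith
  qed
qed

lemma J_bounded_below: "s \<in> S \<Longrightarrow> 1 \<le> n \<Longrightarrow> integral\<^sup>L M lower_fun - norm xs * R \<le> J n s"
proof -
  assume s: "s \<in> S" and n: "1 \<le> n"
  have "integral\<^sup>L M lower_fun \<le> integral\<^sup>L M (penalized n s)"
    by (rule integral_mono_AE[OF integrable_lower_fun integrable_penalized[OF s] penalized_ge_lower_fun[OF s n]])
  moreover have "xs (fst s) \<le> norm xs * R"
    using norm_blinfun[of xs "fst s"] mult_left_mono[OF C_bound[of "fst s"], of "norm xs"] s by (auto simp: S_def)
  ultimately show ?thesis by (simp add: J_def)
qed

lemma J_mono: "s \<in> S \<Longrightarrow> m \<le> n \<Longrightarrow> J m s \<le> J n s"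
  unfolding J_def
  by (intro diff_right_mono integral_mono integrable_penalized)
    (auto simp: penalized_def intro!: mult_right_mono soft_norm_weighted_nonneg)

lemma zero_in_S: "(0, \<lambda>_. 0) \<in> S"
  unfolding S_def using C_zero a0_int
  by (auto simp: F_zero intro!: AE_I2 cong: Bochner_Integration.integrable_cong)

lemma J_zero: "J n (0, \<lambda>_. 0) = integral\<^sup>L M a\<^sub>0"
  unfolding J_def penalized_def using theta
  by (simp add: F_zero cong: Bochner_Integration.integral_cong)

lemma lsc_tendsto:
  assumes t: "t \<in> space M" and conv: "\<sigma> \<longlonglongrightarrow> z" and b: "ereal b < F t z"
  shows "eventually (\<lambda>j. ereal b < F t (\<sigma> j)) sequentially"
proof -
  have "eventually (\<lambda>j. \<sigma> j \<in> {x. ereal b < F t x}) sequentially"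
    using F_lsc[OF t] b by (intro topological_tendstoD[OF conv]) (auto simp: lsc_def)
  then show ?thesis by simp
qed

text \<open>Fatou's lemma for the penalized integrands, all above \<open>lower_fun\<close>. The
  linear term \<open>xs\<close> causes no loss because the vectors converge in norm.\<close>

lemma J_lsc:
  assumes n: "1 \<le> n" and \<sigma>: "\<And>j. \<sigma> j \<in> S" and y: "(\<lambda>j. fst (\<sigma> j)) \<longlonglongrightarrow> y"
    and u [measurable]: "u \<in> borel_measurable M" and u_int: "integrable M (\<lambda>t. p t * norm (u t))"
    and conv: "AE t in M. (\<lambda>j. snd (\<sigma> j) t) \<longlonglongrightarrow> u t"
    and le: "\<And>j. J n (\<sigma> j) \<le> c"
  shows "(y, u) \<in> S" "J n (y, u) \<le> c"
proof -
  have y_C: "y \<in> C" using closed_sequentially[OF C_closed _ y] \<sigma> by (auto simp: S_def)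
  have fin: "AE t in M. \<forall>j. \<bar>F t (snd (\<sigma> j) t)\<bar> \<noteq> \<infinity>" using \<sigma> by (subst AE_all_countable) (auto simp: S_def)
  define H where "H t = F t (u t) + ereal (real n * (p t * soft_norm \<theta> (u t - y)))" for t
  have [measurable]: "H \<in> borel_measurable M" unfolding H_def by measurable
  have upper: "integral\<^sup>L M (penalized n (\<sigma> j)) \<le> c + xs (fst (\<sigma> j))" for j
    using le[of j] by (simp add: J_def)
  have lim: "(\<lambda>j. c + xs (fst (\<sigma> j))) \<longlonglongrightarrow> c + xs y" by (intro tendsto_intros y)
  have H_lower: "AE t in M. ereal (lower_fun t) \<le> H t"
  proof (rule AE_I2)
    fix t assume t: "t \<in> space M"
    show "ereal (lower_fun t) \<le> H t"
    proof (cases "F t (u t)")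
      case (real r)
      then have "lower_fun t + (real n - 1) * (p t * soft_norm \<theta> (u t - y)) \<le> penalized n (y, u) t"
        using penalized_lower[OF t, of "(y, u)" n] C_bound[OF y_C] n by simp
      moreover have "0 \<le> (real n - 1) * (p t * soft_norm \<theta> (u t - y))"
        by (intro mult_nonneg_nonneg[OF _ soft_norm_weighted_nonneg[OF t]]) (use n in simp)
      ultimately show ?thesis using real by (simp add: H_def penalized_def)
    qed (use F_not_MInf[OF t, of "u t"] in \<open>auto simp: H_def\<close>)
  qed
  have liminf: "AE t in M. \<forall>r. ereal r < H t \<longrightarrow> eventually (\<lambda>j. r < penalized n (\<sigma> j) t) sequentially"
    using conv fin AE_space
  proof eventually_elim
    case (elim t)
    then have t: "t \<in> space M" by simp
    show ?case
    proof (intro allI impI)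
      fix r assume r: "ereal r < H t"
      define w where "w = real n * (p t * soft_norm \<theta> (u t - y))"
      have "ereal (r - w) < F t (u t)" using r unfolding H_def w_def[symmetric] by (cases "F t (u t)") auto
      then obtain b where b: "ereal (r - w) < ereal b" "ereal b < F t (u t)" using ereal_dense2 by blast
      have "(\<lambda>j. real n * (p t * soft_norm \<theta> (snd (\<sigma> j) t - fst (\<sigma> j)))) \<longlonglongrightarrow> w"
        unfolding w_def soft_norm_def by (intro tendsto_intros elim(1) y)
      then have "eventually (\<lambda>j. r - b < real n * (p t * soft_norm \<theta> (snd (\<sigma> j) t - fst (\<sigma> j)))) sequentially"
        using b(1) by (intro order_tendstoD(1)) auto
      moreover have "eventually (\<lambda>j. ereal b < F t (snd (\<sigma> j) t)) sequentially"
        by (rule lsc_tendsto[OF t elim(1) b(2)])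
      ultimately show "eventually (\<lambda>j. r < penalized n (\<sigma> j) t) sequentially"
      proof eventually_elim
        case (elim j)
        have "ereal b < ereal (Fr t (snd (\<sigma> j) t))" using elim(2) \<open>\<forall>j. \<bar>F t (snd (\<sigma> j) t)\<bar> \<noteq> \<infinity>\<close> by (simp add: ereal_real)
        then show ?case using elim(1) by (simp add: penalized_def)
      qed
    qed
  qed
  note Fatou = integrable_Fatou_real[OF integrable_penalized[OF \<sigma>] integrable_lower_fun
      penalized_ge_lower_fun[OF \<sigma> n] upper lim _ H_lower liminf]
  have H_fin: "AE t in M. \<bar>H t\<bar> \<noteq> \<infinity>" by (rule Fatou) measurable
  have H_int: "integrable M (\<lambda>t. real_of_ereal (H t))" by (rule Fatou) measurable
  have H_le: "integral\<^sup>L M (\<lambda>t. real_of_ereal (H t)) \<le> c + xs y" by (rule Fatou) measurable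
  have F_fin: "AE t in M. \<bar>F t (u t)\<bar> \<noteq> \<infinity>" using H_fin
    by eventually_elim (auto simp: H_def)
  have H_eq: "AE t in M. real_of_ereal (H t) = penalized n (y, u) t" using F_fin
    by eventually_elim (auto simp: H_def penalized_def real_of_ereal_add)
  have w_int: "integrable M (\<lambda>t. real n * (p t * soft_norm \<theta> (u t - y)))"
    using integrable_weighted_soft_norm[OF u u_int] by simp
  have [measurable]: "penalized n (y, u) \<in> borel_measurable M" unfolding penalized_def fst_conv snd_conv by measurable
  have "integrable M (penalized n (y, u))"
    by (rule integrable_cong_AE_imp[OF H_int]) (use H_eq in auto)
  from Bochner_Integration.integrable_diff[OF this w_int] have "integrable M (\<lambda>t. Fr t (u t))"
    by (simp add: penalized_def)
  then show "(y, u) \<in> S" using y_C u_int F_fin by (simp add: S_def)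
  have "integral\<^sup>L M (penalized n (y, u)) = integral\<^sup>L M (\<lambda>t. real_of_ereal (H t))"
    by (rule integral_cong_AE) (use H_eq in auto)
  then show "J n (y, u) \<le> c" using H_le by (simp add: J_def)
qed

lemma d_triangle:
  assumes "r \<in> S" "s \<in> S" "s' \<in> S"
  shows "d r s' \<le> d r s + d s s'"
proof -
  have int: "integrable M (\<lambda>t. p t * norm (snd r t - snd s t))" if "r \<in> S" "s \<in> S" for r s
    using that by (intro integrable_weighted_diff) (auto simp: S_def)
  have "(\<integral>t. p t * norm (snd r t - snd s' t) \<partial>M) \<le> (\<integral>t. p t * norm (snd r t - snd s t) + p t * norm (snd s t - snd s' t) \<partial>M)"
  proof (rule integral_mono)
    show "p t * norm (snd r t - snd s' t) \<le> p t * norm (snd r t - snd s t) + p t * norm (snd s t - snd s' t)"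
      if "t \<in> space M" for t
      using mult_left_mono[OF norm_triangle_ineq[of "snd r t - snd s t" "snd s t - snd s' t"], of "p t"] p_pos[OF that]
      by (simp add: distrib_left)
  qed (use int assms in auto)
  also have "\<dots> = (\<integral>t. p t * norm (snd r t - snd s t) \<partial>M) + (\<integral>t. p t * norm (snd s t - snd s' t) \<partial>M)"
    using int assms by (intro Bochner_Integration.integral_add) auto
  finally show ?thesis
    using norm_triangle_ineq[of "fst r - fst s" "fst s - fst s'"] by (simp add: d_def)
qed

lemma d_nonneg: "0 \<le> d s s'"
  unfolding d_def using p_pos by (intro add_nonneg_nonneg integral_nonneg_AE AE_I2) (auto simp: less_imp_le)

text \<open>The Riesz-Fischer argument: steps bounded by \<open>(1/2) ^ j\<close> give convergence
  almost everywhere, and Fatou's lemma turns the distances between members into distances to the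
  limit.\<close>

lemma J_complete:
  assumes n: "1 \<le> n" and \<sigma>: "\<And>j. \<sigma> j \<in> S" and dist: "\<And>j. d (\<sigma> j) (\<sigma> (Suc j)) \<le> (1/2) ^ j"
    and dec: "\<And>j. J n (\<sigma> (Suc j)) \<le> J n (\<sigma> j)"
  shows "\<exists>s\<in>S. (\<forall>j. J n s \<le> J n (\<sigma> j)) \<and> (\<lambda>j. d (\<sigma> j) s) \<longlonglongrightarrow> 0"
proof -
  have u_meas [measurable]: "\<And>j. snd (\<sigma> j) \<in> borel_measurable M"
    and u_int: "\<And>j. integrable M (\<lambda>t. p t * norm (snd (\<sigma> j) t))" using \<sigma> by (auto simp: S_def)
  have diff_int: "integrable M (\<lambda>t. p t * norm (snd (\<sigma> i) t - snd (\<sigma> j) t))" for i j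
    by (intro integrable_weighted_diff u_meas u_int)
  have int_nonneg: "0 \<le> (\<integral>t. p t * norm (snd (\<sigma> i) t - v t) \<partial>M)" for i v
    using p_pos by (intro integral_nonneg_AE AE_I2) (auto simp: less_imp_le)
  have step_norm: "norm (fst (\<sigma> j) - fst (\<sigma> (Suc j))) \<le> (1/2) ^ j" for j
    using dist[of j] int_nonneg[of j "snd (\<sigma> (Suc j))"] by (simp add: d_def)
  have step_int: "(\<integral>t. p t * norm (snd (\<sigma> j) t - snd (\<sigma> (Suc j)) t) \<partial>M) \<le> 1 * (1/2) ^ j" for j
    using dist[of j] norm_ge_zero[of "fst (\<sigma> j) - fst (\<sigma> (Suc j))"] unfolding d_def by linarith
  have convergent: "convergent w" if "summable (\<lambda>j. norm (w j - w (Suc j)))" for w :: "nat \<Rightarrow> 'a"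
  proof -
    have "summable (\<lambda>j. w j - w (Suc j))" using that by (rule summable_norm_cancel)
    then obtain l where "(\<lambda>n. \<Sum>j<n. w j - w (Suc j)) \<longlonglongrightarrow> l" by (auto simp: summable_def sums_def)
    then have "(\<lambda>n. w 0 - w n) \<longlonglongrightarrow> l" by (simp add: sum_lessThan_telescope')
    from tendsto_diff[OF tendsto_const[of "w 0"] this] show ?thesis by (auto simp: convergent_def)
  qed
  have "summable (\<lambda>j. norm (fst (\<sigma> j) - fst (\<sigma> (Suc j))))"
    by (rule summable_comparison_test[OF _ summable_geometric[of "1/2 :: real"]]) (use step_norm in auto)
  then obtain y where y: "(\<lambda>j. fst (\<sigma> j)) \<longlonglongrightarrow> y" using convergent[of "\<lambda>j. fst (\<sigma> j)"] by (auto simp: convergent_def)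
  define u where "u t = lim (\<lambda>j. snd (\<sigma> j) t)" for t
  have u [measurable]: "u \<in> borel_measurable M" unfolding u_def by measurable
  have "AE t in M. summable (\<lambda>j. p t * norm (snd (\<sigma> j) t - snd (\<sigma> (Suc j)) t))"
    by (rule AE_summable_if_integrals_geometric[OF diff_int _ step_int]) (use p_pos in \<open>auto simp: less_imp_le\<close>)
  then have conv: "AE t in M. (\<lambda>j. snd (\<sigma> j) t) \<longlonglongrightarrow> u t" using AE_space
  proof eventually_elim
    case (elim t)
    then have "summable (\<lambda>j. norm (snd (\<sigma> j) t - snd (\<sigma> (Suc j)) t))"
      using p_pos[of t] by (subst (asm) summable_cmult_iff) auto
    then show ?case unfolding u_def using convergent[of "\<lambda>j. snd (\<sigma> j) t"] by (simp add: convergent_LIMSEQ_iff)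
  qed
  \<comment> \<open>The factor \<open>1 - (1/2) ^ k\<close> is what lets the induction
    close.\<close>
  have far: "d (\<sigma> j) (\<sigma> (j + k)) \<le> 2 * (1/2) ^ j * (1 - (1/2) ^ k)" for j k
  proof (induction k)
    case (Suc k)
    have "d (\<sigma> j) (\<sigma> (j + Suc k)) \<le> d (\<sigma> j) (\<sigma> (j + k)) + d (\<sigma> (j + k)) (\<sigma> (Suc (j + k)))"
      using d_triangle[OF \<sigma>[of j] \<sigma>[of "j + k"] \<sigma>[of "Suc (j + k)"]] by simp
    also have "\<dots> \<le> 2 * (1/2) ^ j * (1 - (1/2) ^ k) + (1/2) ^ (j + k)" by (intro add_mono Suc dist)
    also have "\<dots> = 2 * (1/2) ^ j * (1 - (1/2) ^ Suc k)" by (simp add: power_add algebra_simps)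
    finally show ?case .
  qed (simp add: d_def)
  have far_int: "(\<integral>t. p t * norm (snd (\<sigma> j) t - snd (\<sigma> (j + k)) t) \<partial>M) \<le> 2 * (1/2) ^ j" for j k
  proof -
    have "(\<integral>t. p t * norm (snd (\<sigma> j) t - snd (\<sigma> (j + k)) t) \<partial>M) \<le> d (\<sigma> j) (\<sigma> (j + k))" by (simp add: d_def)
    also have "\<dots> \<le> 2 * (1/2) ^ j * (1 - (1/2) ^ k)" by (rule far)
    also have "\<dots> \<le> 2 * (1/2) ^ j" by (simp add: mult_left_le)
    finally show ?thesis .
  qed
  have lim: "integrable M (\<lambda>t. p t * norm (snd (\<sigma> j) t - u t)) \<and> (\<integral>t. p t * norm (snd (\<sigma> j) t - u t) \<partial>M) \<le> 2 * (1/2) ^ j" for j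
  proof -
    define H where "H t = ereal (p t * norm (snd (\<sigma> j) t - u t))" for t
    have [measurable]: "H \<in> borel_measurable M" unfolding H_def by measurable
    have liminf: "AE t in M. \<forall>r. ereal r < H t \<longrightarrow> eventually (\<lambda>k. r < p t * norm (snd (\<sigma> j) t - snd (\<sigma> (j + k)) t)) sequentially"
      using conv
    proof eventually_elim
      case (elim t)
      have "(\<lambda>k. snd (\<sigma> (j + k)) t) \<longlonglongrightarrow> u t"
        using LIMSEQ_ignore_initial_segment[OF elim, of j] by (simp add: add.commute)
      then have "(\<lambda>k. p t * norm (snd (\<sigma> j) t - snd (\<sigma> (j + k)) t)) \<longlonglongrightarrow> p t * norm (snd (\<sigma> j) t - u t)"
        by (intro tendsto_intros)
      then show ?case unfolding H_def by (auto dest: order_tendstoD(1))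
    qed
    have lower: "AE t in M. 0 \<le> p t * norm (snd (\<sigma> j) t - snd (\<sigma> (j + k)) t)" for k
      using p_pos by (intro AE_I2) (auto simp: less_imp_le)
    have H_lower: "AE t in M. ereal 0 \<le> H t" using p_pos unfolding H_def by (intro AE_I2) (auto simp: less_imp_le)
    note Fatou = integrable_Fatou_real[OF diff_int[of j "j + _"] integrable_zero lower far_int tendsto_const _ H_lower liminf]
    have "integrable M (\<lambda>t. real_of_ereal (H t))" "integral\<^sup>L M (\<lambda>t. real_of_ereal (H t)) \<le> 2 * (1/2) ^ j"
      by (rule Fatou; measurable)+
    then show ?thesis by (simp add: H_def)
  qed
  have "integrable M (\<lambda>t. p t * norm (u t))"
  proof -
    have "integrable M (\<lambda>t. p t * norm (snd (\<sigma> 0) t - (snd (\<sigma> 0) t - u t)))"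
      by (rule integrable_weighted_diff[OF u_meas u_int _ conjunct1[OF lim]]) measurable
    then show ?thesis by (simp add: algebra_simps)
  qed
  have dec': "J n (\<sigma> (j + k)) \<le> J n (\<sigma> j)" for j k
    by (induction k) (use dec in \<open>auto intro: order_trans\<close>)
  \<comment> \<open>Lower semicontinuity is applied to the tail from \<open>j\<close> on, where
    \<open>J\<close> stays below its value at \<open>\<sigma> j\<close>.\<close>
  have yu: "(y, u) \<in> S \<and> J n (y, u) \<le> J n (\<sigma> j)" for j
  proof -
    have "(\<lambda>k. fst (\<sigma> (j + k))) \<longlonglongrightarrow> y" using LIMSEQ_ignore_initial_segment[OF y, of j] by (simp add: add.commute)
    moreover have "AE t in M. (\<lambda>k. snd (\<sigma> (j + k)) t) \<longlonglongrightarrow> u t" using conv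
    proof eventually_elim
      case (elim t) show ?case using LIMSEQ_ignore_initial_segment[OF elim, of j] by (simp add: add.commute)
    qed
    ultimately show ?thesis
      using J_lsc[OF n, of "\<lambda>k. \<sigma> (j + k)" y u "J n (\<sigma> j)"] \<sigma> \<open>integrable M (\<lambda>t. p t * norm (u t))\<close> dec' u by simp
  qed
  moreover have "(\<lambda>j. d (\<sigma> j) (y, u)) \<longlonglongrightarrow> 0"
  proof -
    have "(\<lambda>j. norm (fst (\<sigma> j) - y) + 2 * (1/2) ^ j) \<longlonglongrightarrow> norm (y - y) + 2 * 0"
      by (intro tendsto_intros y LIMSEQ_power_zero) simp
    then have lim0: "(\<lambda>j. norm (fst (\<sigma> j) - y) + 2 * (1/2) ^ j) \<longlonglongrightarrow> 0" by simp
    show ?thesis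
    proof (rule tendsto_sandwich[OF _ _ tendsto_const lim0])
      show "eventually (\<lambda>j. d (\<sigma> j) (y, u) \<le> norm (fst (\<sigma> j) - y) + 2 * (1/2) ^ j) sequentially"
        using lim by (intro always_eventually allI) (auto simp: d_def)
    qed (simp add: d_nonneg)
  qed
  ultimately show ?thesis by blast
qed

lemma ekeland_point:
  assumes n: "1 \<le> n" and \<eta>: "0 < \<eta>"
  obtains y u where "(y, u) \<in> S" "J n (y, u) + \<eta> * d (0, \<lambda>_. 0) (y, u) \<le> integral\<^sup>L M a\<^sub>0"
    "\<And>s. s \<in> S \<Longrightarrow> J n (y, u) \<le> J n s + \<eta> * d (y, u) s"
proof -
  have "\<exists>s\<in>S. J n s + \<eta> * d (0, \<lambda>_. 0) s \<le> J n (0, \<lambda>_. 0) \<and> (\<forall>t\<in>S. J n s \<le> J n t + \<eta> * d s t)"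
    by (rule ekeland[OF zero_in_S \<eta> d_nonneg _ d_triangle J_bounded_below[OF _ n] J_complete[OF n]])
      (simp_all add: d_def)
  then show ?thesis using that J_zero by auto
qed

text \<open>As the penalty grows, a minimizing pair is forced to have \<open>u\<close> close to the constant \<open>y\<close>; the
  weak compactness of \<open>C\<close> and Fatou's lemma then bound the penalized infimum from below.\<close>

lemma J_asymptotically_minimal:
  assumes \<delta>: "0 < \<delta>"
  shows "\<exists>N. \<forall>n\<ge>N. \<forall>s\<in>S. integral\<^sup>L M a\<^sub>0 - \<delta> \<le> J n s"
proof (rule ccontr)
  define A where "A = integral\<^sup>L M a\<^sub>0 - \<delta>"
  assume "\<not> ?thesis"
  then have "\<exists>n\<ge>N. \<exists>s\<in>S. J n s < A" for N unfolding A_def by (meson not_le)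
  \<comment> \<open>The penalties \<open>2 ^ j\<close>, which monotonicity in \<open>n\<close>
    permits, make the penalty integrals decay geometrically.\<close>
  then have "\<forall>j. \<exists>s. s \<in> S \<and> J (2 ^ j) s < A" by (meson J_mono le_less_trans)
  then obtain \<sigma> where \<sigma>: "\<And>j. \<sigma> j \<in> S" "\<And>j. J (2 ^ j) (\<sigma> j) < A" by metis
  have n: "1 \<le> (2::nat) ^ j" for j by simp
  have fin: "AE t in M. \<forall>j. \<bar>F t (snd (\<sigma> j) t)\<bar> \<noteq> \<infinity>" using \<sigma> by (subst AE_all_countable) (auto simp: S_def case_prod_beta)
  have C: "fst (\<sigma> j) \<in> C" for j using \<sigma>(1)[of j] by (auto simp: S_def)
  define f where "f j t = p t * soft_norm \<theta> (snd (\<sigma> j) t - fst (\<sigma> j))" for j t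
  have f_int: "integrable M (f j)" for j
    using \<sigma>(1)[of j] integrable_weighted_soft_norm unfolding f_def by (auto simp: S_def)
  have f_nonneg: "0 \<le> f j t" if "t \<in> space M" for j t
    unfolding f_def by (rule soft_norm_weighted_nonneg[OF that])
  define K where "K = A + norm xs * R - integral\<^sup>L M lower_fun"
  have bound: "(2 ^ j - 1) * integral\<^sup>L M (f j) \<le> K" for j :: nat
  proof -
    have "AE t in M. lower_fun t + (2 ^ j - 1) * f j t \<le> penalized (2 ^ j) (\<sigma> j) t"
      using fin AE_space
    proof eventually_elim
      case (elim t)
      then show ?case using penalized_lower[of t "\<sigma> j" "2 ^ j"] C_bound[OF C[of j]] by (simp add: f_def)
    qed
    then have "integral\<^sup>L M (\<lambda>t. lower_fun t + (2 ^ j - 1) * f j t) \<le> integral\<^sup>L M (penalized (2 ^ j) (\<sigma> j))"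
      by (intro integral_mono_AE integrable_penalized \<sigma> Bochner_Integration.integrable_add integrable_lower_fun
          integrable_mult_right f_int)
    moreover have "integral\<^sup>L M (\<lambda>t. lower_fun t + (2 ^ j - 1) * f j t) = integral\<^sup>L M lower_fun + (2 ^ j - 1) * integral\<^sup>L M (f j)"
      using f_int integrable_lower_fun by simp
    moreover have "xs (fst (\<sigma> j)) \<le> norm xs * R"
      using norm_blinfun[of xs "fst (\<sigma> j)"] mult_left_mono[OF C_bound[OF C], of "norm xs" j] by auto
    ultimately show ?thesis using \<sigma>(2)[of j] by (simp add: J_def K_def)
  qed
  have K: "0 \<le> K" using bound[of 0] by simp
  \<comment> \<open>The factor \<open>2 ^ j - 1\<close> vanishes for \<open>j = 0\<close>, so the
    index is shifted: \<open>2 ^ Suc j - 1\<close> is at least \<open>2 ^ j\<close>.\<close>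
  have "integral\<^sup>L M (f (Suc j)) \<le> K * (1/2) ^ j" for j
  proof -
    have "0 \<le> integral\<^sup>L M (f (Suc j))" using f_nonneg by (intro integral_nonneg_AE AE_I2)
    then have "2 ^ j * integral\<^sup>L M (f (Suc j)) \<le> (2 ^ Suc j - 1) * integral\<^sup>L M (f (Suc j))"
      by (intro mult_right_mono) auto
    also have "\<dots> \<le> K" by (rule bound)
    finally show ?thesis by (simp add: field_simps power_one_over)
  qed
  then have "AE t in M. summable (\<lambda>j. f (Suc j) t)"
    by (intro AE_summable_if_integrals_geometric f_int f_nonneg)
  then have conv: "AE t in M. (\<lambda>j. snd (\<sigma> j) t - fst (\<sigma> j)) \<longlonglongrightarrow> 0"
    using AE_space
  proof eventually_elim
    case (elim t)
    have "(\<lambda>j. f j t) \<longlonglongrightarrow> 0" using summable_LIMSEQ_zero[OF elim(1)] by (rule LIMSEQ_imp_Suc)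
    then have "(\<lambda>j. f j t / p t) \<longlonglongrightarrow> 0 / p t" using p_pos[OF elim(2)] by (intro tendsto_intros) auto
    moreover have "f j t / p t = soft_norm \<theta> (snd (\<sigma> j) t - fst (\<sigma> j))" for j using p_pos[OF elim(2)] by (simp add: f_def)
    ultimately have "(\<lambda>j. soft_norm \<theta> (snd (\<sigma> j) t - fst (\<sigma> j))) \<longlonglongrightarrow> 0" by simp
    then show ?case by (rule soft_norm_tendsto_0_imp[OF less_imp_le[OF theta]])
  qed
  obtain r y where r: "strict_mono r" "y \<in> C" "\<And>l :: 'a \<Rightarrow>\<^sub>L real. (\<lambda>j. l (fst (\<sigma> (r j)))) \<longlonglongrightarrow> l y"
    using C_weak[of "\<lambda>j. fst (\<sigma> j)"] C by blast
  \<comment> \<open>The penalty is nonnegative and is dropped. Since function value minus vector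
    tends to zero in norm, the function values inherit the weak limit \<open>y\<close> of the
    vectors.\<close>
  have liminf: "AE t in M. \<forall>b. ereal b < F t y \<longrightarrow> eventually (\<lambda>j. b < penalized (2 ^ r j) (\<sigma> (r j)) t) sequentially"
    using conv fin AE_space
  proof eventually_elim
    case (elim t)
    then have t: "t \<in> space M" by simp
    have weak: "(\<lambda>j. l (snd (\<sigma> (r j)) t)) \<longlonglongrightarrow> l y" for l :: "'a \<Rightarrow>\<^sub>L real"
    proof -
      have "(\<lambda>j. snd (\<sigma> (r j)) t - fst (\<sigma> (r j))) \<longlonglongrightarrow> 0" using LIMSEQ_subseq_LIMSEQ[OF elim(1) r(1)] by (simp add: o_def)
      then have "(\<lambda>j. l (snd (\<sigma> (r j)) t - fst (\<sigma> (r j))) + l (fst (\<sigma> (r j)))) \<longlonglongrightarrow> l 0 + l y" by (intro tendsto_intros r(3))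
      then show ?thesis by (simp add: blinfun.diff_right)
    qed
    have "F t y \<le> liminf (\<lambda>j. F t (snd (\<sigma> (r j)) t))"
      by (rule convex_weakly_seq_lsc[OF F_convex[OF t] F_lsc[OF t] _ F_lower[OF t] weak]) (use p_pos[OF t] in simp)
    then have "eventually (\<lambda>j. ereal b < F t (snd (\<sigma> (r j)) t)) sequentially" if "ereal b < F t y" for b
      using that by (simp add: le_Liminf_iff)
    moreover have "b < penalized (2 ^ r j) (\<sigma> (r j)) t" if "ereal b < F t (snd (\<sigma> (r j)) t)" for b j
    proof -
      have "ereal b < ereal (Fr t (snd (\<sigma> (r j)) t))" using that elim(2) by (simp add: ereal_real)
      moreover have "0 \<le> real (2 ^ r j) * (p t * soft_norm \<theta> (snd (\<sigma> (r j)) t - fst (\<sigma> (r j))))"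
        by (intro mult_nonneg_nonneg[OF _ soft_norm_weighted_nonneg[OF t]]) simp
      ultimately show ?thesis by (simp add: penalized_def)
    qed
    ultimately show ?case by (meson eventually_mono)
  qed
  have upper: "integral\<^sup>L M (penalized (2 ^ r j) (\<sigma> (r j))) \<le> A + xs (fst (\<sigma> (r j)))" for j
    using \<sigma>(2)[of "r j"] by (simp add: J_def)
  have lim: "(\<lambda>j. A + xs (fst (\<sigma> (r j)))) \<longlonglongrightarrow> A + xs y" by (intro tendsto_intros r(3))
  have H_lower: "AE t in M. ereal (lower_fun t) \<le> F t y"
  proof (rule AE_I2)
    fix t assume t: "t \<in> space M"
    have "p t * norm y \<le> p t * R" using C_bound[OF r(2)] p_pos[OF t] by simp
    moreover have "0 \<le> \<theta> * p t" using theta p_pos[OF t] by simp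
    ultimately have "ereal (lower_fun t) \<le> ereal (g\<^sub>0 t - p t * norm y)" by (simp add: lower_fun_def algebra_simps)
    also have "\<dots> \<le> F t y" by (rule F_lower[OF t])
    finally show "ereal (lower_fun t) \<le> F t y" .
  qed
  note Fatou = integrable_Fatou_real[OF integrable_penalized[OF \<sigma>(1)] integrable_lower_fun
      penalized_ge_lower_fun[OF \<sigma>(1) n] upper lim _ H_lower liminf]
  have fin_y: "AE t in M. \<bar>F t y\<bar> \<noteq> \<infinity>" by (rule Fatou) measurable
  have int_y: "integrable M (\<lambda>t. Fr t y)" by (rule Fatou) measurable
  have le_y: "integral\<^sup>L M (\<lambda>t. Fr t y) \<le> A + xs y" by (rule Fatou) measurable
  \<comment> \<open>By Fatou's lemma the constant \<open>y\<close> lies \<open>\<delta>\<close>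
    below what the subgradient inequality allows.\<close>
  have "integral\<^sup>L M a\<^sub>0 + xs y \<le> integral\<^sup>L M (\<lambda>t. Fr t y)"
    using fin_y by (intro subgrad int_y) (auto simp: ereal_real elim: eventually_mono)
  then show False using le_y \<delta> by (simp add: A_def)
qed

end

lemma integral_blinfun_apply:
  fixes f :: "'t \<Rightarrow> 'a::separable_asplund \<Rightarrow>\<^sub>L real"
  shows "integrable M f \<Longrightarrow> (\<integral>t. f t h \<partial>M) = (\<integral>t. f t \<partial>M) h"
  by (rule integral_bounded_linear[OF blinfun.bounded_linear_left])

lemma integrable_blinfun_apply:
  fixes f :: "'t \<Rightarrow> 'a::separable_asplund \<Rightarrow>\<^sub>L real"
  shows "integrable M f \<Longrightarrow> integrable M (\<lambda>t. f t h)"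
  by (rule integrable_bounded_linear[OF blinfun.bounded_linear_left])

section \<open>First-order conditions at an Ekeland point\<close>

context penalization
begin

definition q :: "nat \<Rightarrow> 'a \<Rightarrow> ('t \<Rightarrow> 'a) \<Rightarrow> 't \<Rightarrow> 'a \<Rightarrow>\<^sub>L real" where
  "q n y u t = (real n * p t) *\<^sub>R D (u t - y)"

lemma q_measurable [measurable]:
  assumes [measurable]: "u \<in> borel_measurable M"
  shows "q n y u \<in> borel_measurable M"
proof -
  have [measurable]: "(\<lambda>t. D (u t - y)) \<in> borel_measurable M"
    by (rule measurable_compose[OF _ D_measurable]) measurable
  show ?thesis unfolding q_def by measurable
qed

lemma q_norm: "t \<in> space M \<Longrightarrow> norm (q n y u t) \<le> real n * p t"
  using D_norm[of "u t - y"] p_pos[of t] mult_left_mono[of "norm (D (u t - y))" 1 "real n * p t"]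
  by (simp add: q_def)

lemma q_integrable:
  assumes "u \<in> borel_measurable M"
  shows "integrable M (q n y u)"
proof (rule Bochner_Integration.integrable_bound)
  show "integrable M (\<lambda>t. real n * p t)" using p_int by simp
  show "AE t in M. norm (q n y u t) \<le> norm (real n * p t)"
    by (intro AE_I2) (auto intro!: order_trans[OF q_norm])
qed (use assms in measurable)

lemma q_ge: "t \<in> space M \<Longrightarrow> real n * (p t * soft_norm \<theta> (u t - y)) \<le> q n y u t (u t - y)"
  using mult_left_mono[OF D_ge[of "u t - y"], of "real n * p t"] p_pos[of t]
  by (simp add: q_def blinfun.scaleR_left mult.assoc)

text \<open>Moves the vector alone, along the segment to \<open>y'\<close> inside the convex set.
  The distance is then the step times \<open>norm (y' - y)\<close>, and the difference quotients of
  the soft norm are bounded by \<open>norm (y' - y)\<close>, so dominated convergence passes to the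
  derivative.\<close>

lemma variation_y:
  assumes yu: "(y, u) \<in> S" and min: "\<And>s. s \<in> S \<Longrightarrow> J n (y, u) \<le> J n s + \<eta> * d (y, u) s"
    and y': "y' \<in> C"
  shows "(\<integral>t. q n y u t \<partial>M) (y' - y) + xs (y' - y) \<le> \<eta> * norm (y' - y)"
proof -
  have y: "y \<in> C" and u [measurable]: "u \<in> borel_measurable M" and u_int: "integrable M (\<lambda>t. p t * norm (u t))"
    using yu by (auto simp: S_def)
  define h where "h = y' - y"
  \<comment> \<open>The increment is \<open>- h\<close> because \<open>y\<close> enters the penalty
    as \<open>u t - y\<close>.\<close>
  define \<phi> where "\<phi> k t = real (Suc k) * (soft_norm \<theta> (u t - y + (1 / real (Suc k)) *\<^sub>R (- h)) - soft_norm \<theta> (u t - y))" for k t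
  have [measurable]: "\<phi> k \<in> borel_measurable M" for k unfolding \<phi>_def by measurable
  have \<phi>_le: "\<bar>\<phi> k t\<bar> \<le> norm h" for k t
  proof -
    have "\<bar>\<phi> k t\<bar> \<le> real (Suc k) * norm ((1 / real (Suc k)) *\<^sub>R (- h))"
      unfolding \<phi>_def abs_mult using soft_norm_lipschitz[of \<theta> "u t - y + (1 / real (Suc k)) *\<^sub>R (- h)" "u t - y"]
      by (intro mult_mono) auto
    then show ?thesis by simp
  qed
  have lim: "(\<lambda>k. \<integral>t. real n * p t * \<phi> k t \<partial>M) \<longlonglongrightarrow> (\<integral>t. q n y u t (- h) \<partial>M)"
  proof (rule integral_dominated_convergence[where w="\<lambda>t. real n * p t * norm h"])
    show "integrable M (\<lambda>t. real n * p t * norm h)" using p_int by simp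
    show "AE t in M. (\<lambda>k. real n * p t * \<phi> k t) \<longlonglongrightarrow> q n y u t (- h)"
      unfolding \<phi>_def q_def blinfun.scaleR_left
      by (intro AE_I2) (simp only: real_scaleR_def, intro tendsto_mult_left difference_quotient_LIMSEQ D_deriv)
    show "AE t in M. norm (real n * p t * \<phi> k t) \<le> real n * p t * norm h" for k
      using \<phi>_le[of k] p_pos by (intro AE_I2) (auto simp: abs_mult less_imp_le intro!: mult_mono)
    show "(\<lambda>t. q n y u t (- h)) \<in> borel_measurable M" by measurable
  qed measurable
  have "xs h - \<eta> * norm h \<le> (\<integral>t. real n * p t * \<phi> k t \<partial>M)" for k
  proof -
    define s where "s = 1 / real (Suc k)"
    have s: "0 < s" "s \<le> 1" "real (Suc k) * s = 1" by (simp_all add: s_def)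
    define y\<^sub>k where "y\<^sub>k = y + s *\<^sub>R h"
    have "y\<^sub>k = (1 - s) *\<^sub>R y + s *\<^sub>R y'" by (simp add: y\<^sub>k_def h_def algebra_simps)
    then have "y\<^sub>k \<in> C" using C_convex y y' s by (simp add: convexD)
    then have k_S: "(y\<^sub>k, u) \<in> S" using yu by (simp add: S_def)
    have "d (y, u) (y\<^sub>k, u) = s * norm h" using s by (simp add: d_def y\<^sub>k_def)
    then have "0 \<le> J n (y\<^sub>k, u) - J n (y, u) + \<eta> * (s * norm h)" using min[OF k_S] by simp
    moreover have "J n (y\<^sub>k, u) - J n (y, u) = (\<integral>t. penalized n (y\<^sub>k, u) t - penalized n (y, u) t \<partial>M) - xs (s *\<^sub>R h)"
      using integrable_penalized[OF k_S] integrable_penalized[OF yu]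
      by (simp add: J_def y\<^sub>k_def blinfun.add_right)
    moreover have "penalized n (y\<^sub>k, u) t - penalized n (y, u) t = s * (real n * p t * \<phi> k t)" for t
    proof -
      have "u t - y + s *\<^sub>R (- h) = u t - y\<^sub>k" by (simp add: y\<^sub>k_def)
      then have "\<phi> k t = real (Suc k) * (soft_norm \<theta> (u t - y\<^sub>k) - soft_norm \<theta> (u t - y))"
        by (simp only: \<phi>_def s_def)
      then have "s * \<phi> k t = soft_norm \<theta> (u t - y\<^sub>k) - soft_norm \<theta> (u t - y)" by (simp add: s_def)
      moreover have "s * (real n * p t * \<phi> k t) = real n * p t * (s * \<phi> k t)" by simp
      ultimately show ?thesis by (simp only: penalized_def fst_conv snd_conv) (simp add: algebra_simps)
    qed
    ultimately have "0 \<le> s * ((\<integral>t. real n * p t * \<phi> k t \<partial>M) - xs h + \<eta> * norm h)"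
      by (simp add: blinfun.scaleR_right algebra_simps)
    then show ?thesis using s(1) by (simp add: zero_le_mult_iff)
  qed
  then have "xs h - \<eta> * norm h \<le> (\<integral>t. q n y u t (- h) \<partial>M)"
    by (intro LIMSEQ_le_const[OF lim]) blast
  also have "\<dots> = - (\<integral>t. q n y u t \<partial>M) h"
    using q_integrable[OF u] by (simp add: integral_blinfun_apply blinfun.minus_right)
  finally show ?thesis by (simp add: h_def)
qed

text \<open>Localization of an integral inequality: if the bound failed on a non-null set along a
  section, switching from \<open>u\<close> to this section there would contradict minimality.
  Truncation at \<open>norm (z i t) \<le> real N\<close> keeps the altered function in
  \<open>S\<close>, and the Castaing representation extends the bound to all
  \<open>z\<close>.\<close>

lemma variation_u:
  assumes yu: "(y, u) \<in> S" and min: "\<And>s. s \<in> S \<Longrightarrow> J n (y, u) \<le> J n s + \<eta> * d (y, u) s"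
  shows "AE t in M. \<forall>z. ereal (penalized n (y, u) t - real n * (p t * soft_norm \<theta> (z - y)) - \<eta> * (p t * norm (z - u t))) \<le> F t z"
proof -
  have y: "y \<in> C" and u [measurable]: "u \<in> borel_measurable M" and u_int: "integrable M (\<lambda>t. p t * norm (u t))"
    and u_fin: "AE t in M. \<bar>F t (u t)\<bar> \<noteq> \<infinity>" and Fu_int: "integrable M (\<lambda>t. Fr t (u t))"
    using yu by (auto simp: S_def)
  obtain z :: "nat \<Rightarrow> 't \<Rightarrow> 'a" where z [measurable]: "\<And>i. z i \<in> borel_measurable M"
    and dense: "\<And>t w e. t \<in> space M \<Longrightarrow> F t w < \<infinity> \<Longrightarrow> 0 < e \<Longrightarrow> \<exists>i. norm (z i t - w) < e \<and> F t (z i t) < F t w + ereal e"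
    using castaing by blast
  define g where "g t w = penalized n (y, u) t - real n * (p t * soft_norm \<theta> (w - y)) - \<eta> * (p t * norm (w - u t))" for t w
  have pen_meas [measurable]: "penalized n (y, u) \<in> borel_measurable M" using integrable_penalized[OF yu] by auto
  have "AE t in M. norm (z i t) \<le> real N \<longrightarrow> ereal (g t (z i t)) \<le> F t (z i t)" for i N
  proof -
    define B where "B = {t \<in> space M. norm (z i t) \<le> real N \<and> F t (z i t) < ereal (g t (z i t))}"
    have B [measurable]: "B \<in> sets M" unfolding B_def g_def by measurable
    define u' where "u' t = (if t \<in> B then z i t else u t)" for t
    have u' [measurable]: "u' \<in> borel_measurable M" unfolding u'_def by measurable
    have B_real: "F t (z i t) = ereal (Fr t (z i t))" "Fr t (z i t) < g t (z i t)" "g\<^sub>0 t - p t * real N \<le> Fr t (z i t)"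
      if "t \<in> B" for t
    proof -
      have t: "t \<in> space M" "norm (z i t) \<le> real N" "F t (z i t) < ereal (g t (z i t))" using that by (auto simp: B_def)
      show eq: "F t (z i t) = ereal (Fr t (z i t))" using t(3) F_not_MInf[OF t(1), of "z i t"] by (cases "F t (z i t)") auto
      show "Fr t (z i t) < g t (z i t)" using t(3) by (subst (asm) eq) simp
      have "g\<^sub>0 t - p t * norm (z i t) \<le> Fr t (z i t)" using F_lower[OF t(1), of "z i t"] by (subst (asm) eq) simp
      moreover have "p t * norm (z i t) \<le> p t * real N" using p_pos[OF t(1)] by (intro mult_left_mono t(2)) simp
      ultimately show "g\<^sub>0 t - p t * real N \<le> Fr t (z i t)" by linarith
    qed
    have diff_int: "integrable M (\<lambda>t. p t * norm (u' t - u t))"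
    proof (rule Bochner_Integration.integrable_bound)
      show "integrable M (\<lambda>t. p t * norm (u t) + real N * p t)" using u_int p_int by simp
      show "AE t in M. norm (p t * norm (u' t - u t)) \<le> norm (p t * norm (u t) + real N * p t)"
      proof (rule AE_I2)
        fix t assume t: "t \<in> space M"
        have "norm (u' t - u t) \<le> norm (u t) + real N"
          using norm_triangle_ineq4[of "z i t" "u t"] by (auto simp: u'_def B_def)
        then have "p t * norm (u' t - u t) \<le> p t * (norm (u t) + real N)" using p_pos[OF t] by (intro mult_left_mono) auto
        then show "norm (p t * norm (u' t - u t)) \<le> norm (p t * norm (u t) + real N * p t)"
          using p_pos[OF t] by (simp add: algebra_simps)
      qed
    qed measurable
    have u'_int: "integrable M (\<lambda>t. p t * norm (u' t))"
    proof (rule Bochner_Integration.integrable_bound)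
      show "integrable M (\<lambda>t. p t * norm (u t) + p t * norm (u' t - u t))" using u_int diff_int by simp
      show "AE t in M. norm (p t * norm (u' t)) \<le> norm (p t * norm (u t) + p t * norm (u' t - u t))"
      proof (rule AE_I2)
        fix t assume t: "t \<in> space M"
        have "p t * norm (u' t) \<le> p t * (norm (u t) + norm (u' t - u t))"
          using p_pos[OF t] by (intro mult_left_mono norm_triangle_sub) auto
        then show "norm (p t * norm (u' t)) \<le> norm (p t * norm (u t) + p t * norm (u' t - u t))"
          using p_pos[OF t] by (simp add: algebra_simps)
      qed
    qed measurable
    have u'_fin: "AE t in M. \<bar>F t (u' t)\<bar> \<noteq> \<infinity>" using u_fin
    proof eventually_elim
      case (elim t) then show ?case using B_real(1)[of t] by (cases "t \<in> B") (auto simp: u'_def)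
    qed
    have g_bound: "g t (z i t) \<le> \<bar>penalized n (y, u) t\<bar> + \<bar>\<eta>\<bar> * (p t * norm (u' t - u t))" if "t \<in> B" for t
    proof -
      have t: "t \<in> space M" using that by (simp add: B_def)
      have "- \<eta> * (p t * norm (z i t - u t)) \<le> \<bar>\<eta>\<bar> * (p t * norm (z i t - u t))"
        using p_pos[OF t] by (intro mult_right_mono) auto
      moreover have "0 \<le> real n * (p t * soft_norm \<theta> (z i t - y))"
        by (intro mult_nonneg_nonneg[OF _ soft_norm_weighted_nonneg[OF t]]) simp
      ultimately show ?thesis using that by (simp add: g_def u'_def)
    qed
    have Fu'_bound: "\<bar>Fr t (u' t)\<bar> \<le> \<bar>Fr t (u t)\<bar> + \<bar>penalized n (y, u) t\<bar> + \<bar>\<eta>\<bar> * (p t * norm (u' t - u t)) + \<bar>g\<^sub>0 t\<bar> + p t * real N"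
      if "t \<in> space M" for t
    proof (cases "t \<in> B")
      case True
      then have "Fr t (u' t) = Fr t (z i t)" by (simp add: u'_def)
      moreover have "0 \<le> p t * real N" "0 \<le> \<bar>\<eta>\<bar> * (p t * norm (u' t - u t))" using p_pos[OF that] by auto
      ultimately show ?thesis using B_real(2,3)[OF True] g_bound[OF True] by linarith
    next
      case False
      then have "u' t = u t" by (simp add: u'_def)
      moreover have "0 \<le> p t * real N" using p_pos[OF that] by auto
      ultimately show ?thesis by simp
    qed
    have Fu'_int: "integrable M (\<lambda>t. Fr t (u' t))"
    proof (rule Bochner_Integration.integrable_bound)
      show "integrable M (\<lambda>t. \<bar>Fr t (u t)\<bar> + \<bar>penalized n (y, u) t\<bar> + \<bar>\<eta>\<bar> * (p t * norm (u' t - u t)) + \<bar>g\<^sub>0 t\<bar> + p t * real N)"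
        using Fu_int integrable_penalized[OF yu] diff_int g0_int p_int by (intro Bochner_Integration.integrable_add integrable_abs integrable_mult_right integrable_mult_left)
      show "AE t in M. norm (Fr t (u' t)) \<le> norm (\<bar>Fr t (u t)\<bar> + \<bar>penalized n (y, u) t\<bar> + \<bar>\<eta>\<bar> * (p t * norm (u' t - u t)) + \<bar>g\<^sub>0 t\<bar> + p t * real N)"
        using Fu'_bound by (intro AE_I2) (simp, meson abs_ge_self order_trans)
    qed measurable
    have S': "(y, u') \<in> S" using y u' u'_int u'_fin Fu'_int by (simp add: S_def)
    \<comment> \<open>The gain of the switch. It is positive on \<open>B\<close> and zero elsewhere,
      while minimality makes its integral at most zero; hence \<open>B\<close> is null.\<close>
    define w where "w t = penalized n (y, u) t - penalized n (y, u') t - \<eta> * (p t * norm (u' t - u t))" for t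
    have w_int: "integrable M w" unfolding w_def
      using integrable_penalized[OF yu] integrable_penalized[OF S'] diff_int by simp
    have w_B: "w t = g t (z i t) - Fr t (z i t)" if "t \<in> B" for t
      using that by (simp add: w_def u'_def penalized_def g_def)
    have w_nB: "w t = 0" if "t \<notin> B" for t using that by (simp add: w_def u'_def penalized_def)
    have w_nonneg: "0 \<le> w t" for t using w_B[of t] w_nB[of t] B_real(2)[of t] by (cases "t \<in> B") auto
    have "integral\<^sup>L M w = J n (y, u) - J n (y, u') - \<eta> * d (y, u) (y, u')"
      unfolding w_def J_def d_def using integrable_penalized[OF yu] integrable_penalized[OF S'] diff_int
      by (simp add: norm_minus_commute)
    also have "\<dots> \<le> 0" using min[OF S'] by simp
    finally have "integral\<^sup>L M w \<le> 0" .
    moreover have "0 \<le> integral\<^sup>L M w" by (intro integral_nonneg_AE AE_I2 w_nonneg)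
    ultimately have "integral\<^sup>L M w = 0" by simp
    then have "AE t in M. w t = 0" using integral_nonneg_eq_0_iff_AE[OF w_int] w_nonneg by simp
    then show ?thesis using AE_space
    proof eventually_elim
      case (elim t)
      then have "t \<notin> B" using w_B[of t] B_real(2)[of t] by auto
      then show ?case using elim(2) by (auto simp: B_def)
    qed
  qed
  then have "AE t in M. \<forall>i N. norm (z i t) \<le> real N \<longrightarrow> ereal (g t (z i t)) \<le> F t (z i t)"
    unfolding AE_all_countable by blast
  then have "AE t in M. \<forall>w. ereal (g t w) \<le> F t w" using AE_space
  proof eventually_elim
    case (elim t)
    have le: "ereal (g t (z i t)) \<le> F t (z i t)" for i using elim(1) real_arch_simple[of "norm (z i t)"] by blast
    have cont: "continuous_on UNIV (g t)" unfolding g_def by (intro continuous_intros)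
    show ?case using lower_bound_if_dense[where z=z and h="g t", OF elim(2) dense[OF elim(2)] cont le] by blast
  qed
  then show ?thesis by (simp add: g_def)
qed

text \<open>Evaluates the bound at \<open>u t + s *\<^sub>R h\<close> with
  \<open>s = 1 / Suc k\<close>. Convexity replaces the value of \<open>F t\<close> by the chord, and
  division by \<open>s\<close> leaves a difference quotient of the soft norm, which tends to the
  derivative.\<close>

lemma approximate_subgradient_inequality:
  assumes t: "t \<in> space M" and fin: "\<bar>F t (u t)\<bar> \<noteq> \<infinity>"
    and le: "\<And>z. ereal (penalized n (y, u) t - real n * (p t * soft_norm \<theta> (z - y)) - \<eta> * (p t * norm (z - u t))) \<le> F t z"
  shows "ereal (Fr t (u t) - q n y u t (z - u t) - \<eta> * p t * norm (z - u t)) \<le> F t z"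
proof (cases "F t z")
  case (real r)
  define h where "h = z - u t"
  define \<phi> where "\<phi> k = real (Suc k) * (soft_norm \<theta> (u t - y + (1 / real (Suc k)) *\<^sub>R h) - soft_norm \<theta> (u t - y))" for k
  have "Fr t (u t) - real n * p t * \<phi> k - \<eta> * (p t * norm h) \<le> r" for k
  proof -
    define s where "s = 1 / real (Suc k)"
    have s: "0 < s" "0 \<le> 1 - s" "real (Suc k) * s = 1" by (simp_all add: s_def)
    define z\<^sub>k where "z\<^sub>k = u t + s *\<^sub>R h"
    have z\<^sub>k: "z\<^sub>k = s *\<^sub>R z + (1 - s) *\<^sub>R u t" by (simp add: z\<^sub>k_def h_def algebra_simps)
    have "F t z\<^sub>k \<le> ereal (s * r + (1 - s) * Fr t (u t))"
      unfolding z\<^sub>k using real fin s F_not_MInf[OF t]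
      by (intro convex_ereal_real[OF F_convex[OF t]]) (auto simp: ereal_real)
    with le[of z\<^sub>k] have "ereal (penalized n (y, u) t - real n * (p t * soft_norm \<theta> (z\<^sub>k - y)) - \<eta> * (p t * norm (z\<^sub>k - u t))) \<le> ereal (s * r + (1 - s) * Fr t (u t))"
      by (rule order_trans)
    then have "s * Fr t (u t) - real n * p t * (soft_norm \<theta> (z\<^sub>k - y) - soft_norm \<theta> (u t - y)) - s * (\<eta> * (p t * norm h)) \<le> s * r"
      using s(1) by (simp add: penalized_def z\<^sub>k_def algebra_simps)
    moreover have "soft_norm \<theta> (z\<^sub>k - y) - soft_norm \<theta> (u t - y) = s * \<phi> k"
    proof -
      have "u t - y + s *\<^sub>R h = z\<^sub>k - y" by (simp add: z\<^sub>k_def)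
      then have "\<phi> k = real (Suc k) * (soft_norm \<theta> (z\<^sub>k - y) - soft_norm \<theta> (u t - y))"
        by (simp only: \<phi>_def s_def)
      then show ?thesis by (simp add: s_def)
    qed
    ultimately have "s * (Fr t (u t) - real n * p t * \<phi> k - \<eta> * (p t * norm h)) \<le> s * r"
      by (simp add: algebra_simps)
    then show ?thesis using s(1) by simp
  qed
  moreover have "(\<lambda>k. Fr t (u t) - real n * p t * \<phi> k - \<eta> * (p t * norm h))
      \<longlonglongrightarrow> Fr t (u t) - real n * p t * D (u t - y) h - \<eta> * (p t * norm h)"
    unfolding \<phi>_def by (intro tendsto_intros difference_quotient_LIMSEQ D_deriv)
  ultimately have "Fr t (u t) - real n * p t * D (u t - y) h - \<eta> * (p t * norm h) \<le> r"
    by (intro LIMSEQ_le_const2) blast+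
  then show ?thesis using real by (simp add: q_def h_def blinfun.scaleR_left mult.assoc)
qed (use F_not_MInf[OF t, of z] in auto)

text \<open>At each \<open>t\<close> the condition fails for large \<open>n\<close> because
  \<open>p t > 0\<close>; domination by \<open>a\<^sub>0 - g\<^sub>0\<close> does the rest. The
  constant 8 is that of the estimate on the set where \<open>u\<close> is far from
  \<open>y\<close>.\<close>

lemma small_weight_integral_tendsto_0:
  assumes \<rho>: "0 < \<rho>"
  shows "(\<lambda>n. \<integral>t. (if real n * p t * \<rho> \<le> 8 * (a\<^sub>0 t - g\<^sub>0 t) then a\<^sub>0 t - g\<^sub>0 t else 0) \<partial>M) \<longlonglongrightarrow> 0"
proof -
  have "(\<lambda>n. \<integral>t. (if real n * p t * \<rho> \<le> 8 * (a\<^sub>0 t - g\<^sub>0 t) then a\<^sub>0 t - g\<^sub>0 t else 0) \<partial>M) \<longlonglongrightarrow> (\<integral>t. 0 \<partial>M)"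
  proof (rule integral_dominated_convergence[where w="\<lambda>t. \<bar>a\<^sub>0 t - g\<^sub>0 t\<bar>"])
    show "integrable M (\<lambda>t. \<bar>a\<^sub>0 t - g\<^sub>0 t\<bar>)" using a0_int g0_int by simp
    show "AE t in M. (\<lambda>n. if real n * p t * \<rho> \<le> 8 * (a\<^sub>0 t - g\<^sub>0 t) then a\<^sub>0 t - g\<^sub>0 t else 0) \<longlonglongrightarrow> 0"
    proof (rule AE_I2)
      fix t assume t: "t \<in> space M"
      have "0 < p t * \<rho>" using p_pos[OF t] \<rho> by simp
      then obtain N where N: "8 * (a\<^sub>0 t - g\<^sub>0 t) < real N * (p t * \<rho>)" using reals_Archimedean3 by blast
      show "(\<lambda>n. if real n * p t * \<rho> \<le> 8 * (a\<^sub>0 t - g\<^sub>0 t) then a\<^sub>0 t - g\<^sub>0 t else 0) \<longlonglongrightarrow> 0"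
      proof (rule tendsto_eventually, rule eventually_sequentiallyI[of N])
        fix n assume "N \<le> n"
        then have "real N * (p t * \<rho>) \<le> real n * (p t * \<rho>)" using \<open>0 < p t * \<rho>\<close> by (intro mult_right_mono) auto
        then show "(if real n * p t * \<rho> \<le> 8 * (a\<^sub>0 t - g\<^sub>0 t) then a\<^sub>0 t - g\<^sub>0 t else 0) = 0"
          using N by (simp add: mult.assoc)
      qed
    qed
    show "AE t in M. norm (if real n * p t * \<rho> \<le> 8 * (a\<^sub>0 t - g\<^sub>0 t) then a\<^sub>0 t - g\<^sub>0 t else 0) \<le> \<bar>a\<^sub>0 t - g\<^sub>0 t\<bar>" for n
      by (intro AE_I2) auto
  qed measurable
  then show ?thesis by simp
qed

text \<open>The pair comes from an Ekeland point of the penalized functional. It is replaced by a bounded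
  selection where \<open>u\<close> is far from \<open>y\<close>; there the penalty forces \<open>n p \<rho> \<le> 8 (a\<^sub>0 - g\<^sub>0)\<close>, so that
  the replacement is negligible in \<open>L\<^sup>1\<close>.\<close>

theorem approximate_decomposition:
  assumes \<rho>: "0 < \<rho>" "\<rho> \<le> 1" and \<tau>: "0 < \<tau>" and R: "R \<le> \<rho> / 8" and theta_eq: "\<theta> = \<rho> / 16"
  shows "\<exists>u v. u \<in> borel_measurable M \<and> integrable M v \<and> (AE t in M. norm (u t) \<le> \<rho>) \<and>
    (AE t in M. v t \<in> subdifferential (F t) (u t)) \<and>
    (\<forall>h\<in>C. \<bar>(\<integral>t. v t \<partial>M) h - xs h\<bar> \<le> \<tau>) \<and>
    (\<integral>t. v t (u t) \<partial>M) \<le> \<rho> * norm xs + \<tau>"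
proof -
  define m where "m t = a\<^sub>0 t - g\<^sub>0 t" for t
  define P where "P = integral\<^sup>L M p"
  \<comment> \<open>Large enough for the set where \<open>u\<^sub>1\<close> is far from
    \<open>y\<close>. There \<open>p\<close> and \<open>n * p\<close> are at most
    \<open>8 / \<rho> * m\<close>, so \<open>Q\<close> is bounded by \<open>8 / \<rho> * m\<close>,
    and \<open>v\<^sub>0\<close> by
    \<open>(8 / \<rho> + (1 + 8 / \<rho>) / \<rho>) * m\<close>.\<close>
  define K where "K = 16 / \<rho> + (1 + 8 / \<rho>) / \<rho>"
  \<comment> \<open>Each of the two final estimates collects
    \<open>4 * \<delta> + 3 * \<delta>\<close>, which \<open>8 * \<delta> = \<tau>\<close>
    covers.\<close>
  define \<delta> where "\<delta> = \<tau> / 8"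
  have m_nonneg: "0 \<le> m t" if "t \<in> space M" for t using g0_le_a0[OF that] by (simp add: m_def)
  have m_int: "integrable M m" unfolding m_def using a0_int g0_int by simp
  have [measurable]: "m \<in> borel_measurable M" using m_int by auto
  have P: "0 \<le> P" unfolding P_def using p_pos by (intro integral_nonneg_AE AE_I2) (auto simp: less_imp_le)
  have K: "0 < K" using \<rho> by (simp add: K_def add_pos_pos)
  have \<delta>: "0 < \<delta>" using \<tau> by (simp add: \<delta>_def)
  define bad where "bad n t = (if real n * p t * \<rho> \<le> 8 * m t then m t else 0)" for n t
  have [measurable]: "bad n \<in> borel_measurable M" for n unfolding bad_def by measurable
  have bad_nonneg: "0 \<le> bad n t" if "t \<in> space M" for n t using m_nonneg[OF that] by (simp add: bad_def)
  have bad_int: "integrable M (bad n)" for n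
    by (rule Bochner_Integration.integrable_bound[OF m_int]) (use m_nonneg in \<open>auto simp: bad_def\<close>)
  have "eventually (\<lambda>n. integral\<^sup>L M (bad n) < \<delta> / K) sequentially"
    using small_weight_integral_tendsto_0[OF \<rho>(1)] \<delta> K unfolding bad_def m_def by (intro order_tendstoD(2)) auto
  moreover have "eventually (\<lambda>n. \<forall>s\<in>S. integral\<^sup>L M a\<^sub>0 - \<delta> \<le> J n s) sequentially"
    using J_asymptotically_minimal[OF \<delta>] unfolding eventually_sequentially .
  moreover have "eventually (\<lambda>n. (10::nat) \<le> n) sequentially" by (rule eventually_ge_at_top)
  ultimately have "eventually (\<lambda>n. 10 \<le> n \<and> integral\<^sup>L M (bad n) < \<delta> / K \<and> (\<forall>s\<in>S. integral\<^sup>L M a\<^sub>0 - \<delta> \<le> J n s)) sequentially"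
    by eventually_elim blast
  then obtain n where n: "10 \<le> n" "integral\<^sup>L M (bad n) < \<delta> / K"
    and J_ge: "\<And>s. s \<in> S \<Longrightarrow> integral\<^sup>L M a\<^sub>0 - \<delta> \<le> J n s"
    unfolding eventually_sequentially by blast
  \<comment> \<open>Small enough for \<open>\<eta> * P \<le> \<delta>\<close>, the integrated
    selection error, and \<open>\<eta> * R \<le> \<delta>\<close>, the error of varying
    \<open>y\<close>; \<open>\<eta> \<le> 1\<close> lets the Ekeland term be treated like the growth
    of the minorant.\<close>
  define \<eta> where "\<eta> = min 1 (\<delta> / (P + 1))"
  have \<eta>: "0 < \<eta>" "\<eta> \<le> 1" using \<delta> P by (simp_all add: \<eta>_def)
  have "\<eta> * P \<le> \<delta> / (P + 1) * P" using P by (intro mult_right_mono) (simp_all add: \<eta>_def)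
  also have "\<dots> \<le> \<delta>" using \<delta> P by (simp add: field_simps)
  finally have \<eta>P: "\<eta> * P \<le> \<delta>" .
  have "\<delta> / (P + 1) \<le> \<delta>" using \<delta> P by (simp add: field_simps)
  then have "\<eta> \<le> \<delta>" by (simp add: \<eta>_def)
  then have "\<eta> * R \<le> \<delta> * 1" using \<rho> R R_nonneg \<delta> by (intro mult_mono) auto
  then have \<eta>R: "\<eta> * R \<le> \<delta>" by simp
  obtain y u\<^sub>1 where yu: "(y, u\<^sub>1) \<in> S" and start: "J n (y, u\<^sub>1) + \<eta> * d (0, \<lambda>_. 0) (y, u\<^sub>1) \<le> integral\<^sup>L M a\<^sub>0"
    and min: "\<And>s. s \<in> S \<Longrightarrow> J n (y, u\<^sub>1) \<le> J n s + \<eta> * d (y, u\<^sub>1) s"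
    by (rule ekeland_point[where n=n, OF _ \<eta>(1)]) (use n(1) in simp, blast)
  have y: "y \<in> C" and u1 [measurable]: "u\<^sub>1 \<in> borel_measurable M" and u1_int: "integrable M (\<lambda>t. p t * norm (u\<^sub>1 t))"
    and u1_fin: "AE t in M. \<bar>F t (u\<^sub>1 t)\<bar> \<noteq> \<infinity>" and Fu1_int: "integrable M (\<lambda>t. Fr t (u\<^sub>1 t))"
    using yu by (auto simp: S_def)
  have y_le: "norm y \<le> \<rho> / 8" using C_bound[OF y] R by simp
  \<comment> \<open>The start is within \<open>\<delta>\<close> of the infimum, so Ekeland's
    inequality limits the distance travelled.\<close>
  have \<eta>u: "\<eta> * (\<integral>t. p t * norm (u\<^sub>1 t) \<partial>M) \<le> \<delta>"
  proof -
    have "\<eta> * (\<integral>t. p t * norm (u\<^sub>1 t) \<partial>M) \<le> \<eta> * d (0, \<lambda>_. 0) (y, u\<^sub>1)"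
      using \<eta> by (intro mult_left_mono) (auto simp: d_def)
    then show ?thesis using start J_ge[OF yu] by simp
  qed
  define Q where "Q = q n y u\<^sub>1"
  have Q_meas [measurable]: "Q \<in> borel_measurable M" and Q_int: "integrable M Q" unfolding Q_def
    by (rule q_measurable[OF u1], rule q_integrable[OF u1])
  have Q_norm: "norm (Q t) \<le> real n * p t" if "t \<in> space M" for t
    unfolding Q_def by (rule q_norm[OF that])
  have Q_ge: "real n * (p t * soft_norm \<theta> (u\<^sub>1 t - y)) \<le> Q t (u\<^sub>1 t - y)" if "t \<in> space M" for t
    unfolding Q_def by (rule q_ge[OF that])
  have pen_AE: "AE t in M. \<forall>z. ereal (penalized n (y, u\<^sub>1) t - real n * (p t * soft_norm \<theta> (z - y)) - \<eta> * (p t * norm (z - u\<^sub>1 t))) \<le> F t z"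
    by (rule variation_u[OF yu min])
  have ineq: "AE t in M. \<forall>z. ereal (Fr t (u\<^sub>1 t) - Q t (z - u\<^sub>1 t) - \<eta> * p t * norm (z - u\<^sub>1 t)) \<le> F t z"
    using pen_AE u1_fin AE_space
  proof eventually_elim
    case (elim t)
    show ?case unfolding Q_def
      by (intro allI approximate_subgradient_inequality[where u=u\<^sub>1] elim(1)[rule_format] elim(2,3))
  qed
  have s_nonneg: "0 \<le> \<eta> * p t" if "t \<in> space M" for t using \<eta> p_pos[OF that] by simp
  have s_meas: "(\<lambda>t. \<eta> * p t) \<in> borel_measurable M" by measurable
  obtain v\<^sub>1 where v1 [measurable]: "v\<^sub>1 \<in> borel_measurable M" and v1_sub: "AE t in M. v\<^sub>1 t \<in> subdifferential (F t) (u\<^sub>1 t)"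
    and v1_Q: "AE t in M. norm (v\<^sub>1 t + Q t) \<le> \<eta> * p t"
    by (rule subgradient_selection[OF u1 Q_meas s_meas s_nonneg u1_fin ineq]) blast+
  obtain u\<^sub>0 v\<^sub>0 where u0 [measurable]: "u\<^sub>0 \<in> borel_measurable M" and v0 [measurable]: "v\<^sub>0 \<in> borel_measurable M"
    and u0_le: "AE t in M. norm (u\<^sub>0 t) \<le> \<rho>" and v0_sub: "AE t in M. v\<^sub>0 t \<in> subdifferential (F t) (u\<^sub>0 t)"
    and v0_le: "AE t in M. norm (v\<^sub>0 t) \<le> p t + (m t + p t) / \<rho>"
    unfolding m_def by (rule near_zero_subgradient_selection[OF \<rho>(1)])
  \<comment> \<open>As \<open>norm y \<le> \<rho> / 8\<close>, the remaining points satisfy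
    \<open>norm (u\<^sub>1 t) \<le> \<rho>\<close>.\<close>
  define far where "far t \<longleftrightarrow> \<rho> / 2 < norm (u\<^sub>1 t - y)" for t
  have [measurable]: "Measurable.pred M far" unfolding far_def by measurable
  have far_bad: "AE t in M. far t \<longrightarrow> real n * p t * \<rho> \<le> 8 * m t"
    using pen_AE u1_fin AE_space
  proof eventually_elim
    case (elim t)
    then have t: "t \<in> space M" by simp
    show ?case
    proof
      assume "far t"
      define x where "x = norm (u\<^sub>1 t - y)"
      have x: "\<rho> / 2 < x" using \<open>far t\<close> by (simp add: far_def x_def)
      have u1_x: "norm (u\<^sub>1 t) \<le> 5 / 4 * x" using norm_triangle_sub[of "u\<^sub>1 t" y] y_le x by (simp add: x_def)
      \<comment> \<open>Test at the origin, where \<open>F\<close> is finite. With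
        \<open>x > \<rho> / 2\<close> the two soft norms differ by at least \<open>x / 2\<close>.
        The two copies of \<open>p t * norm (u\<^sub>1 t)\<close>, one from the minorant and one
        from the Ekeland term, are each at most \<open>5 / 4 * (p t * x)\<close> and sum up to
        \<open>10 * (p t * x / 4)\<close>. Half of the penalty absorbs them since
        \<open>n \<ge> 10\<close>.\<close>
      have "ereal (penalized n (y, u\<^sub>1) t - real n * (p t * soft_norm \<theta> (0 - y)) - \<eta> * (p t * norm (0 - u\<^sub>1 t))) \<le> F t 0"
        using elim(1) by blast
      then have "Fr t (u\<^sub>1 t) + real n * p t * (soft_norm \<theta> (u\<^sub>1 t - y) - soft_norm \<theta> y) \<le> a\<^sub>0 t + \<eta> * (p t * norm (u\<^sub>1 t))"
        by (simp add: penalized_def F_zero[OF t] algebra_simps)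
      moreover have "g\<^sub>0 t - p t * norm (u\<^sub>1 t) \<le> Fr t (u\<^sub>1 t)"
        using F_lower[OF t, of "u\<^sub>1 t"] elim(2) by (cases "F t (u\<^sub>1 t)") auto
      moreover have "\<eta> * (p t * norm (u\<^sub>1 t)) \<le> 1 * (p t * norm (u\<^sub>1 t))"
        using \<eta> p_pos[OF t] by (intro mult_right_mono) auto
      moreover have "real n * p t * (x / 2) \<le> real n * p t * (soft_norm \<theta> (u\<^sub>1 t - y) - soft_norm \<theta> y)"
      proof (intro mult_left_mono)
        show "x / 2 \<le> soft_norm \<theta> (u\<^sub>1 t - y) - soft_norm \<theta> y"
          using soft_norm_ge[of "u\<^sub>1 t - y" \<theta>] soft_norm_le[of \<theta> y] theta y_le x unfolding x_def[symmetric] theta_eq by simp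
        show "0 \<le> real n * p t" using p_pos[OF t] by simp
      qed
      moreover have "p t * norm (u\<^sub>1 t) \<le> p t * (5 / 4 * x)" using u1_x p_pos[OF t] by (intro mult_left_mono) auto
      moreover have "p t * (5 / 4 * x) = 5 * (p t * x / 4)" by simp
      ultimately have 1: "real n * p t * (x / 2) \<le> m t + 10 * (p t * x / 4)" unfolding m_def by linarith
      have "0 \<le> x" unfolding x_def by simp
      then have "0 \<le> p t * x / 4" using p_pos[OF t] by simp
      then have "10 * (p t * x / 4) \<le> real n * (p t * x / 4)" using n(1) by (intro mult_right_mono) auto
      with 1 have 2: "real n * p t * x \<le> 4 * m t" by simp
      have "real n * p t * (\<rho> / 2) \<le> real n * p t * x" using x p_pos[OF t] by (intro mult_left_mono) auto
      then show "real n * p t * \<rho> \<le> 8 * m t" using 2 by simp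
    qed
  qed
  define u where "u t = (if far t then u\<^sub>0 t else u\<^sub>1 t)" for t
  define v where "v t = (if far t then v\<^sub>0 t else v\<^sub>1 t)" for t
  have u_meas [measurable]: "u \<in> borel_measurable M" and v_meas [measurable]: "v \<in> borel_measurable M"
    unfolding u_def v_def by measurable
  have u_le: "AE t in M. norm (u t) \<le> \<rho>" using u0_le
  proof eventually_elim
    case (elim t)
    have "norm (u\<^sub>1 t) \<le> norm y + norm (u\<^sub>1 t - y)" by (rule norm_triangle_sub)
    then show ?case using elim y_le \<rho> by (auto simp: u_def far_def)
  qed
  have v_sub: "AE t in M. v t \<in> subdifferential (F t) (u t)"
    using v0_sub v1_sub by eventually_elim (simp add: u_def v_def)
  have bad_bounds: "AE t in M. far t \<longrightarrow> norm (v\<^sub>0 t) \<le> K * bad n t \<and> norm (Q t) \<le> K * bad n t"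
    using far_bad v0_le AE_space
  proof eventually_elim
    case (elim t)
    then have t: "t \<in> space M" by simp
    show ?case
    proof
      assume "far t"
      then have np: "real n * p t * \<rho> \<le> 8 * m t" using elim(1) by blast
      then have bad: "bad n t = m t" by (simp add: bad_def)
      have np': "real n * p t \<le> 8 / \<rho> * m t" using np \<rho> by (simp add: field_simps)
      have "1 * p t \<le> real n * p t" using n(1) p_pos[OF t] by (intro mult_right_mono) auto
      then have p_le: "p t \<le> 8 / \<rho> * m t" using np' by linarith
      have "norm (v\<^sub>0 t) \<le> p t + (m t + p t) / \<rho>" by (rule elim(2))
      also have "\<dots> \<le> 8 / \<rho> * m t + (m t + 8 / \<rho> * m t) / \<rho>"
        using p_le \<rho> by (intro add_mono divide_right_mono) auto
      also have "\<dots> = (8 / \<rho> + (1 + 8 / \<rho>) / \<rho>) * m t" by (simp add: field_simps)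
      also have "\<dots> \<le> K * m t" using \<rho> m_nonneg[OF t] unfolding K_def by (intro mult_right_mono) (auto simp: divide_right_mono)
      finally have "norm (v\<^sub>0 t) \<le> K * bad n t" by (simp add: bad)
      moreover have "norm (Q t) \<le> 8 / \<rho> * m t" using Q_norm[OF t] np' by simp
      moreover have "8 / \<rho> * m t \<le> K * m t"
        using \<rho> m_nonneg[OF t] unfolding K_def by (intro mult_right_mono) (auto simp: field_simps)
      ultimately show "norm (v\<^sub>0 t) \<le> K * bad n t \<and> norm (Q t) \<le> K * bad n t" by (simp add: bad)
    qed
  qed
  \<comment> \<open>Off the far set only the selection error \<open>\<eta> * p t\<close> counts; on
    it, \<open>v\<^sub>0\<close> and \<open>Q\<close> are each bounded by
    \<open>K * bad n t\<close>.\<close>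
  define err where "err t = \<eta> * p t + 2 * (K * bad n t)" for t
  have err_int: "integrable M err" unfolding err_def using p_int bad_int by simp
  have K_bad: "K * integral\<^sup>L M (bad n) \<le> \<delta>" using n(2) K by (simp add: field_simps)
  have "integral\<^sup>L M err = \<eta> * P + 2 * (K * integral\<^sup>L M (bad n))" unfolding err_def P_def using p_int bad_int by simp
  then have err_le: "integral\<^sup>L M err \<le> 3 * \<delta>" using \<eta>P K_bad by simp
  have vQ: "AE t in M. norm (v t + Q t) \<le> err t"
    using bad_bounds v1_Q AE_space
  proof eventually_elim
    case (elim t)
    have "0 \<le> \<eta> * p t" "0 \<le> K * bad n t" using \<eta> p_pos[OF elim(3)] bad_nonneg[OF elim(3)] K by auto
    then show ?case using elim norm_triangle_ineq[of "v\<^sub>0 t" "Q t"] by (auto simp: v_def err_def)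
  qed
  have vQ_int: "integrable M (\<lambda>t. v t + Q t)"
    by (rule Bochner_Integration.integrable_bound[OF err_int]) (use vQ in \<open>auto elim: eventually_mono\<close>)
  then have "integrable M (\<lambda>t. (v t + Q t) - Q t)" using Q_int by (rule Bochner_Integration.integrable_diff)
  then have v_int: "integrable M v" by simp
  \<comment> \<open>Varying \<open>y\<close> controls only the differences \<open>h - y\<close>. The
    value at \<open>y\<close> itself comes from testing the subgradient inequality at the origin:
    the penalty is at most \<open>Q t (u\<^sub>1 t - y)\<close>, and \<open>J\<close> at the Ekeland
    point is nearly the integral of \<open>a\<^sub>0\<close>.\<close>
  have Q_y: "(\<integral>t. Q t \<partial>M) y + xs y \<le> 2 * \<delta>"
  proof -
    have Qy_int: "integrable M (\<lambda>t. Q t y)" by (rule integrable_blinfun_apply[OF Q_int])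
    have "AE t in M. penalized n (y, u\<^sub>1) t + Q t y \<le> a\<^sub>0 t + \<eta> * (p t * norm (u\<^sub>1 t))"
      using ineq AE_space
    proof eventually_elim
      case (elim t)
      have "ereal (Fr t (u\<^sub>1 t) - Q t (0 - u\<^sub>1 t) - \<eta> * p t * norm (0 - u\<^sub>1 t)) \<le> F t 0" using elim(1) by blast
      then have "Fr t (u\<^sub>1 t) + Q t (u\<^sub>1 t) \<le> a\<^sub>0 t + \<eta> * (p t * norm (u\<^sub>1 t))"
        by (simp add: F_zero[OF elim(2)] blinfun.minus_right algebra_simps)
      then show ?case using Q_ge[OF elim(2)] by (simp add: penalized_def blinfun.diff_right)
    qed
    then have "(\<integral>t. penalized n (y, u\<^sub>1) t + Q t y \<partial>M) \<le> (\<integral>t. a\<^sub>0 t + \<eta> * (p t * norm (u\<^sub>1 t)) \<partial>M)"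
      using integrable_penalized[OF yu] Qy_int a0_int u1_int by (intro integral_mono_AE) auto
    then have "integral\<^sup>L M (penalized n (y, u\<^sub>1)) + (\<integral>t. Q t \<partial>M) y \<le> integral\<^sup>L M a\<^sub>0 + \<eta> * (\<integral>t. p t * norm (u\<^sub>1 t) \<partial>M)"
      using integrable_penalized[OF yu] Qy_int a0_int u1_int integral_blinfun_apply[OF Q_int] by simp
    then show ?thesis using J_ge[OF yu] \<eta>u by (simp add: J_def)
  qed
  have Q_C: "(\<integral>t. Q t \<partial>M) h + xs h \<le> 4 * \<delta>" if h: "h \<in> C" for h
  proof -
    have "(\<integral>t. Q t \<partial>M) (h - y) + xs (h - y) \<le> \<eta> * norm (h - y)"
      unfolding Q_def by (rule variation_y[OF yu min h])
    moreover have "\<eta> * norm (h - y) \<le> \<eta> * (2 * R)"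
      using norm_triangle_ineq4[of h y] C_bound[OF h] C_bound[OF y] \<eta> by (intro mult_left_mono) auto
    ultimately show ?thesis using Q_y \<eta>R by (simp add: blinfun.diff_right)
  qed
  have "\<bar>(\<integral>t. v t \<partial>M) h - xs h\<bar> \<le> \<tau>" if h: "h \<in> C" for h
  proof -
    \<comment> \<open>Symmetry of \<open>C\<close> turns the one-sided bound into a two-sided
      one.\<close>
    have "\<bar>(\<integral>t. Q t \<partial>M) h + xs h\<bar> \<le> 4 * \<delta>"
      using Q_C[OF h] Q_C[OF C_sym[OF h]] by (simp add: blinfun.minus_right abs_le_iff)
    moreover have "norm h \<le> 1" using C_bound[OF h] R \<rho> by simp
    moreover have "norm (\<integral>t. v t + Q t \<partial>M) \<le> 3 * \<delta>"
    proof -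
      have "norm (\<integral>t. v t + Q t \<partial>M) \<le> (\<integral>t. norm (v t + Q t) \<partial>M)" by (rule integral_norm_bound)
      also have "\<dots> \<le> integral\<^sup>L M err" using vQ_int err_int vQ by (intro integral_mono_AE) auto
      finally show ?thesis using err_le by simp
    qed
    then have "\<bar>(\<integral>t. v t + Q t \<partial>M) h\<bar> \<le> 3 * \<delta> * norm h"
      using norm_blinfun[of "\<integral>t. v t + Q t \<partial>M" h] mult_right_mono[of "norm (\<integral>t. v t + Q t \<partial>M)" "3 * \<delta>" "norm h"] by simp
    moreover have "(\<integral>t. v t + Q t \<partial>M) h = (\<integral>t. v t \<partial>M) h + (\<integral>t. Q t \<partial>M) h"
      using v_int Q_int by (simp add: blinfun.add_left)
    moreover have "3 * \<delta> * norm h \<le> 3 * \<delta>" using \<open>norm h \<le> 1\<close> \<delta> by (simp add: mult_left_le)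
    moreover have "8 * \<delta> = \<tau>" by (simp add: \<delta>_def)
    ultimately show ?thesis using \<delta> by linarith
  qed
  moreover have "(\<integral>t. v t (u t) \<partial>M) \<le> \<rho> * norm xs + \<tau>"
  proof -
    have vu_int: "integrable M (\<lambda>t. v t (u t))"
    proof (rule Bochner_Integration.integrable_bound)
      show "integrable M (\<lambda>t. norm (v t) * \<rho>)" using v_int by simp
      show "AE t in M. norm (v t (u t)) \<le> norm (norm (v t) * \<rho>)" using u_le
      proof eventually_elim
        case (elim t)
        then show ?case using norm_blinfun[of "v t" "u t"] mult_left_mono[OF elim, of "norm (v t)"] \<rho> by simp
      qed
    qed measurable
    \<comment> \<open>Near \<open>y\<close> the subgradient is almost \<open>- Q t\<close>, and
      \<open>Q t (u\<^sub>1 t - y) \<ge> 0\<close> allows \<open>u\<^sub>1 t\<close> to be replaced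
      by \<open>y\<close>. The integral of \<open>- Q t y\<close> is then at most
      \<open>xs y + 4 * \<delta>\<close>, by the estimate on \<open>C\<close> at
      \<open>- y\<close>.\<close>
    have "AE t in M. v t (u t) \<le> - Q t y + (\<eta> * (p t * norm (u\<^sub>1 t)) + 2 * (K * bad n t))"
      using bad_bounds v1_Q u0_le AE_space
    proof eventually_elim
      case (elim t)
      then have t: "t \<in> space M" by simp
      have nonneg: "0 \<le> \<eta> * (p t * norm (u\<^sub>1 t))" "0 \<le> K * bad n t"
        using \<eta> p_pos[OF t] bad_nonneg[OF t] K by auto
      show ?case
      proof (cases "far t")
        case True
        then have le: "norm (v\<^sub>0 t) \<le> K * bad n t" "norm (Q t) \<le> K * bad n t" using elim(1) by auto
        have "v\<^sub>0 t (u\<^sub>0 t) \<le> norm (v\<^sub>0 t) * norm (u\<^sub>0 t)" using norm_blinfun[of "v\<^sub>0 t" "u\<^sub>0 t"] by simp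
        also have "\<dots> \<le> K * bad n t * 1" using le elim(3) \<rho> nonneg by (intro mult_mono) auto
        finally have "v\<^sub>0 t (u\<^sub>0 t) \<le> K * bad n t" by simp
        moreover have "Q t y \<le> norm (Q t) * norm y" using norm_blinfun[of "Q t" y] by simp
        moreover have "norm (Q t) * norm y \<le> K * bad n t * 1" using le y_le \<rho> nonneg by (intro mult_mono) auto
        ultimately show ?thesis using True nonneg by (simp add: u_def v_def)
      next
        case False
        have "(v\<^sub>1 t + Q t) (u\<^sub>1 t) \<le> norm (v\<^sub>1 t + Q t) * norm (u\<^sub>1 t)" using norm_blinfun[of "v\<^sub>1 t + Q t" "u\<^sub>1 t"] by simp
        also have "\<dots> \<le> \<eta> * p t * norm (u\<^sub>1 t)" using elim(2) by (intro mult_right_mono) auto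
        finally have "v\<^sub>1 t (u\<^sub>1 t) + Q t (u\<^sub>1 t) \<le> \<eta> * (p t * norm (u\<^sub>1 t))" by (simp add: blinfun.add_left mult.assoc)
        moreover have "0 \<le> real n * (p t * soft_norm \<theta> (u\<^sub>1 t - y))"
          by (intro mult_nonneg_nonneg[OF _ soft_norm_weighted_nonneg[OF t]]) simp
        then have "Q t y \<le> Q t (u\<^sub>1 t)" using Q_ge[OF t] by (simp add: blinfun.diff_right)
        ultimately show ?thesis using False nonneg by (simp add: u_def v_def)
      qed
    qed
    then have "(\<integral>t. v t (u t) \<partial>M) \<le> (\<integral>t. - Q t y + (\<eta> * (p t * norm (u\<^sub>1 t)) + 2 * (K * bad n t)) \<partial>M)"
      using vu_int integrable_blinfun_apply[OF Q_int] u1_int bad_int by (intro integral_mono_AE) auto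
    also have "\<dots> = - (\<integral>t. Q t \<partial>M) y + (\<eta> * (\<integral>t. p t * norm (u\<^sub>1 t) \<partial>M) + 2 * (K * integral\<^sup>L M (bad n)))"
      using integrable_blinfun_apply[OF Q_int] u1_int bad_int integral_blinfun_apply[OF Q_int] by simp
    finally have "(\<integral>t. v t (u t) \<partial>M) \<le> - (\<integral>t. Q t \<partial>M) y + 3 * \<delta>" using \<eta>u K_bad by simp
    moreover have "- (\<integral>t. Q t \<partial>M) y - xs y \<le> 4 * \<delta>" using Q_C[OF C_sym[OF y]] by (simp add: blinfun.minus_right)
    moreover have "xs y \<le> norm xs * norm y" using norm_blinfun[of xs y] by simp
    moreover have "norm xs * norm y \<le> norm xs * \<rho>" using y_le \<rho> by (intro mult_left_mono) auto
    moreover have "8 * \<delta> = \<tau>" by (simp add: \<delta>_def)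
    ultimately show ?thesis using \<delta> by (simp add: mult.commute)
  qed
  ultimately show ?thesis using u_meas v_int u_le v_sub by blast
qed

end

section \<open>Weakly compact symmetric convex sets\<close>

text \<open>What the penalization asks of \<open>C\<close> apart from its size, which is adjusted
  afterwards by scaling. Weak compactness is sequential because Fatou's lemma works along
  sequences.\<close>

definition weak_disc :: "'a::real_normed_vector set \<Rightarrow> bool" where
  "weak_disc C \<longleftrightarrow> convex C \<and> (\<forall>y\<in>C. - y \<in> C) \<and> 0 \<in> C \<and> closed C \<and> bounded C \<and>
    (\<forall>s :: nat \<Rightarrow> 'a. (\<forall>n. s n \<in> C) \<longrightarrow>
       (\<exists>r y. strict_mono r \<and> y \<in> C \<and> (\<forall>l :: 'a \<Rightarrow>\<^sub>L real. (\<lambda>n. l (s (r n))) \<longlonglongrightarrow> l y)))"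

lemma weak_disc_scaleR:
  assumes "weak_disc C"
  shows "weak_disc ((\<lambda>y. c *\<^sub>R y) ` C)"
  unfolding weak_disc_def
proof (intro conjI allI impI)
  note C = assms[unfolded weak_disc_def]
  show "convex ((\<lambda>y. c *\<^sub>R y) ` C)" using C by (simp add: convex_scaling)
  show "\<forall>y\<in>(\<lambda>y. c *\<^sub>R y) ` C. - y \<in> (\<lambda>y. c *\<^sub>R y) ` C" using C by (auto simp flip: scaleR_minus_right)
  show "0 \<in> (\<lambda>y. c *\<^sub>R y) ` C" using C by (auto intro: image_eqI[of _ _ 0])
  show "closed ((\<lambda>y. c *\<^sub>R y) ` C)" using C by (simp add: closed_scaling)
  show "bounded ((\<lambda>y. c *\<^sub>R y) ` C)" using C by (simp add: bounded_scaling)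
  fix s :: "nat \<Rightarrow> 'a" assume "\<forall>n. s n \<in> (\<lambda>y. c *\<^sub>R y) ` C"
  then have "\<forall>n. \<exists>w. w \<in> C \<and> s n = c *\<^sub>R w" by blast
  then obtain w where w: "\<And>n. w n \<in> C" "\<And>n. s n = c *\<^sub>R w n" by metis
  then obtain r y where ry: "strict_mono r" "y \<in> C" "\<And>l :: 'a \<Rightarrow>\<^sub>L real. (\<lambda>n. l (w (r n))) \<longlonglongrightarrow> l y"
    using C by blast
  have "(\<lambda>n. l (s (r n))) \<longlonglongrightarrow> l (c *\<^sub>R y)" for l :: "'a \<Rightarrow>\<^sub>L real"
    unfolding w(2) blinfun.scaleR_right by (intro tendsto_intros ry(3))
  then show "\<exists>r y. strict_mono r \<and> y \<in> (\<lambda>y. c *\<^sub>R y) ` C \<and> (\<forall>l :: 'a \<Rightarrow>\<^sub>L real. (\<lambda>n. l (s (r n))) \<longlonglongrightarrow> l y)"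
    using ry(1,2) by blast
qed

text \<open>The convex hull of a finite symmetric set is norm compact, so subsequences even converge
  in norm.\<close>

lemma weak_disc_containing_finite:
  fixes Y :: "'a::real_normed_vector set"
  assumes "finite Y"
  shows "\<exists>C. weak_disc C \<and> Y \<subseteq> C"
proof -
  define V where "V = insert 0 (Y \<union> uminus ` Y)"
  have V: "finite V" "uminus ` V = V" "Y \<subseteq> V" "0 \<in> V" using assms by (auto simp: V_def image_Un image_image)
  define C where "C = convex hull V"
  have V_C: "V \<subseteq> C" unfolding C_def by (rule hull_subset)
  have compact: "compact C" unfolding C_def by (rule finite_imp_compact_convex_hull[OF V(1)])
  have "uminus ` C = C"
    unfolding C_def using convex_hull_linear_image[of uminus V] V(2) by (simp add: bounded_linear.linear bounded_linear_minus)
  then have sym: "\<forall>y\<in>C. - y \<in> C" by blast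
  have "\<exists>r y. strict_mono r \<and> y \<in> C \<and> (\<forall>l :: 'a \<Rightarrow>\<^sub>L real. (\<lambda>n. l (s (r n))) \<longlonglongrightarrow> l y)"
    if "\<forall>n. s n \<in> C" for s :: "nat \<Rightarrow> 'a"
  proof -
    obtain y r where "y \<in> C" "strict_mono r" "(s \<circ> r) \<longlonglongrightarrow> y"
      using compact \<open>\<forall>n. s n \<in> C\<close> unfolding compact_def by blast
    moreover from this have "(\<lambda>n. l (s (r n))) \<longlonglongrightarrow> l y" for l :: "'a \<Rightarrow>\<^sub>L real"
      by (intro tendsto_intros) (simp add: o_def)
    ultimately show ?thesis by blast
  qed
  then have "weak_disc C"
    unfolding weak_disc_def using sym V(4) V_C compact
    by (auto simp: C_def convex_convex_hull compact_imp_closed compact_imp_bounded)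
  then show ?thesis using V(3) V_C by blast
qed

text \<open>The dual is separable, so a diagonal subsequence converges at a dense sequence of
  functionals and hence, by boundedness, at all of them. The limit is an element of the bidual;
  reflexivity represents it by a vector, and weak lower semicontinuity of the norm keeps this vector
  in the ball.\<close>

lemma weak_disc_cball:
  assumes "reflexive_space TYPE('a::separable_asplund)"
  shows "weak_disc (cball 0 1 :: 'a set)"
proof -
  obtain e :: "nat \<Rightarrow> 'a \<Rightarrow>\<^sub>L real" where "\<And>l \<epsilon>. 0 < \<epsilon> \<Longrightarrow> \<exists>n. dist (e n) l < \<epsilon>"
    using dense_sequence_exists by blast
  then have e: "\<exists>n. norm (l - e n) < \<epsilon>" if "0 < \<epsilon>" for l \<epsilon> using that by (simp add: dist_norm norm_minus_commute)
  have "\<exists>r y. strict_mono r \<and> y \<in> cball 0 1 \<and> (\<forall>l :: 'a \<Rightarrow>\<^sub>L real. (\<lambda>n. l (s (r n))) \<longlonglongrightarrow> l y)"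
    if s: "\<forall>n. s n \<in> cball 0 1" for s :: "nat \<Rightarrow> 'a"
  proof -
    have s_le: "norm (s n) \<le> 1" for n using s by simp
    have l_s: "\<bar>l (s n)\<bar> \<le> norm l" for l :: "'a \<Rightarrow>\<^sub>L real" and n
      using norm_blinfun[of l "s n"] mult_left_mono[OF s_le[of n], of "norm l"] by simp
    interpret subseqs "\<lambda>i r. convergent (\<lambda>n. e i (s (r n)))"
    proof
      fix i and r :: "nat \<Rightarrow> nat" assume "strict_mono r"
      have "bounded (range (\<lambda>n. e i (s (r n))))" unfolding bounded_iff using l_s by auto
      then obtain l k where "strict_mono k" "((\<lambda>n. e i (s (r n))) \<circ> k) \<longlonglongrightarrow> l"
        using bounded_imp_convergent_subsequence by blast
      then show "\<exists>r'. strict_mono r' \<and> convergent (\<lambda>n. e i (s ((r \<circ> r') n)))" by (auto simp: convergent_def o_def)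
    qed
    have conv_e: "convergent (\<lambda>n. e i (s (diagseq n)))" for i
    proof -
      \<comment> \<open>The property of stage \<open>i\<close> is available along the diagonal
        sequence from index \<open>Suc i\<close> on; the offset is removed afterwards.\<close>
      have "convergent (\<lambda>n. e i (s ((diagseq \<circ> (+) (Suc i)) n)))"
        by (rule diagseq_holds) (auto simp: o_def intro: convergent_subseq_convergent[unfolded o_def])
      then have "convergent (\<lambda>n. e i (s (diagseq (n + Suc i))))" by (simp add: o_def add.commute)
      then obtain L where "(\<lambda>n. e i (s (diagseq (n + Suc i)))) \<longlonglongrightarrow> L" by (blast dest: convergentD)
      then have "(\<lambda>n. e i (s (diagseq n))) \<longlonglongrightarrow> L" by (rule LIMSEQ_offset)
      then show ?thesis by (rule convergentI)
    qed
    have conv: "convergent (\<lambda>n. l (s (diagseq n)))" for l :: "'a \<Rightarrow>\<^sub>L real"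
    proof (rule Cauchy_convergent, rule metric_CauchyI)
      fix \<epsilon> :: real assume "\<epsilon> > 0"
      then obtain i where i: "norm (l - e i) < \<epsilon> / 3" using e[of "\<epsilon> / 3" l] by auto
      have close: "\<bar>l (s n) - e i (s n)\<bar> < \<epsilon> / 3" for n
        using l_s[of "l - e i" n] i by (simp add: blinfun.diff_left)
      obtain N where N: "\<And>m n. m \<ge> N \<Longrightarrow> n \<ge> N \<Longrightarrow> dist (e i (s (diagseq m))) (e i (s (diagseq n))) < \<epsilon> / 3"
        using metric_CauchyD[OF convergent_Cauchy[OF conv_e[of i]], of "\<epsilon> / 3"] \<open>\<epsilon> > 0\<close> by auto
      show "\<exists>N. \<forall>m\<ge>N. \<forall>n\<ge>N. dist (l (s (diagseq m))) (l (s (diagseq n))) < \<epsilon>"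
      proof (intro exI[of _ N] allI impI)
        fix m n assume "N \<le> m" "N \<le> n"
        then have "\<bar>e i (s (diagseq m)) - e i (s (diagseq n))\<bar> < \<epsilon> / 3" using N by (simp add: dist_real_def)
        then show "dist (l (s (diagseq m))) (l (s (diagseq n))) < \<epsilon>"
          using close[of "diagseq m"] close[of "diagseq n"] unfolding dist_real_def by linarith
      qed
    qed
    define \<Phi> where "\<Phi> l = lim (\<lambda>n. l (s (diagseq n)))" for l :: "'a \<Rightarrow>\<^sub>L real"
    have \<Phi>: "(\<lambda>n. blinfun_apply l (s (diagseq n))) \<longlonglongrightarrow> \<Phi> l" for l
      using conv[of l] by (simp add: \<Phi>_def convergent_LIMSEQ_iff)
    have "bounded_linear \<Phi>"
    proof (rule bounded_linear_intro[of _ 1])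
      show "\<Phi> (l + l') = \<Phi> l + \<Phi> l'" for l l'
        using tendsto_add[OF \<Phi>[of l] \<Phi>[of l']] by (intro LIMSEQ_unique[OF \<Phi>]) (simp add: blinfun.add_left)
      show "\<Phi> (c *\<^sub>R l) = c *\<^sub>R \<Phi> l" for c l
        using tendsto_scaleR[OF tendsto_const \<Phi>[of l], of c] by (intro LIMSEQ_unique[OF \<Phi>]) (simp add: blinfun.scaleR_left)
      show "norm (\<Phi> l) \<le> norm l * 1" for l
        using tendsto_rabs[OF \<Phi>[of l]] l_s[of l] by (intro LIMSEQ_le_const2[where X="\<lambda>n. \<bar>l (s (diagseq n))\<bar>"]) auto
    qed
    then obtain y where y: "\<And>l. \<Phi> l = blinfun_apply l y"
      using assms unfolding reflexive_space_def by (metis bounded_linear_Blinfun_apply)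
    have lim: "(\<lambda>n. blinfun_apply l (s (diagseq n))) \<longlonglongrightarrow> blinfun_apply l y" for l :: "'a \<Rightarrow>\<^sub>L real" using \<Phi>[of l] by (simp add: y)
    have "ereal (norm y) \<le> liminf (\<lambda>n. ereal (norm (s (diagseq n))))"
    proof (rule convex_weakly_seq_lsc[where f="\<lambda>z. ereal (norm z)" and c=0 and k=0])
      show "convex_ereal (\<lambda>z :: 'a. ereal (norm z))"
        unfolding convex_ereal_def
      proof (intro allI impI)
        fix a b :: 'a and t :: real assume "0 < t \<and> t < 1"
        then show "ereal (norm (t *\<^sub>R a + (1 - t) *\<^sub>R b)) \<le> ereal t * ereal (norm a) + ereal (1 - t) * ereal (norm b)"
          using norm_triangle_ineq[of "t *\<^sub>R a" "(1 - t) *\<^sub>R b"] by simp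
      qed
      show "lsc (\<lambda>z :: 'a. ereal (norm z))"
        unfolding lsc_def
      proof
        fix a
        have "continuous_on UNIV (\<lambda>z :: 'a. ereal (norm z))" by (intro continuous_intros)
        then show "open {x. a < ereal (norm (x :: 'a))}" by (intro open_Collect_less continuous_intros)
      qed
    qed (use lim in auto)
    also have "\<dots> \<le> liminf (\<lambda>n. ereal 1)" by (intro Liminf_mono always_eventually) (use s_le in simp)
    finally have "norm y \<le> 1" by (simp add: Liminf_const)
    then show ?thesis using lim subseq_diagseq by (intro exI[of _ diagseq] exI[of _ y]) auto
  qed
  then show ?thesis unfolding weak_disc_def by auto
qed

section \<open>Approximation of subgradients\<close>

context convex_integrand
begin

text \<open>Otherwise each bound \<open>1 / Suc j\<close> admits a bad function. These functions
  tend to zero pointwise, so by lower semicontinuity the negative parts tend to zero, and the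
  minorant dominates them by \<open>a\<^sub>0 - g\<^sub>0 + p\<close>. One \<open>\<epsilon>\<close>
  thus serves all \<open>u\<close>.\<close>

lemma negative_part_small:
  assumes \<tau>: "0 < \<tau>"
  shows "\<exists>\<epsilon>>0. \<epsilon> \<le> 1 \<and> (\<forall>u. u \<in> borel_measurable M \<longrightarrow> (AE t in M. norm (u t) \<le> \<epsilon>) \<longrightarrow> (AE t in M. \<bar>F t (u t)\<bar> \<noteq> \<infinity>) \<longrightarrow>
     integrable M (\<lambda>t. max 0 (a\<^sub>0 t - real_of_ereal (F t (u t)))) \<and>
     (\<integral>t. max 0 (a\<^sub>0 t - real_of_ereal (F t (u t))) \<partial>M) \<le> \<tau>)"
proof (rule ccontr)
  define \<omega> where "\<omega> u t = max 0 (a\<^sub>0 t - real_of_ereal (F t (u t)))" for u :: "'t \<Rightarrow> 'a" and t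
  define w where "w t = a\<^sub>0 t - g\<^sub>0 t + p t" for t
  have w_int: "integrable M w" unfolding w_def using a0_int g0_int p_int by simp
  have \<omega>_le: "AE t in M. norm (\<omega> u t) \<le> w t" if "AE t in M. norm (u t) \<le> 1" "AE t in M. \<bar>F t (u t)\<bar> \<noteq> \<infinity>" for u
    using that AE_space
  proof eventually_elim
    case (elim t)
    have "g\<^sub>0 t - p t * norm (u t) \<le> real_of_ereal (F t (u t))"
      using F_lower[OF elim(3), of "u t"] elim(2) by (cases "F t (u t)") auto
    moreover have "p t * norm (u t) \<le> p t * 1" using elim(1) p_pos[OF elim(3)] by (intro mult_left_mono) auto
    ultimately have "a\<^sub>0 t - real_of_ereal (F t (u t)) \<le> w t" unfolding w_def by linarith
    moreover have "0 \<le> w t" using g0_le_a0[OF elim(3)] p_pos[OF elim(3)] by (simp add: w_def)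
    ultimately show ?case by (simp add: \<omega>_def)
  qed
  have \<omega>_meas [measurable]: "\<omega> u \<in> borel_measurable M" if [measurable]: "u \<in> borel_measurable M" for u
    unfolding \<omega>_def by measurable
  have \<omega>_int: "integrable M (\<omega> u)" if "u \<in> borel_measurable M" "AE t in M. norm (u t) \<le> 1" "AE t in M. \<bar>F t (u t)\<bar> \<noteq> \<infinity>" for u
  proof (rule Bochner_Integration.integrable_bound[OF w_int \<omega>_meas[OF that(1)]])
    show "AE t in M. norm (\<omega> u t) \<le> norm (w t)" using \<omega>_le[OF that(2,3)] by eventually_elim auto
  qed
  assume "\<not> ?thesis"
  then have neg: "\<And>\<epsilon>. 0 < \<epsilon> \<Longrightarrow> \<epsilon> \<le> 1 \<Longrightarrow> \<exists>u. u \<in> borel_measurable M \<and> (AE t in M. norm (u t) \<le> \<epsilon>) \<and> (AE t in M. \<bar>F t (u t)\<bar> \<noteq> \<infinity>) \<and>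
     \<not> (integrable M (\<omega> u) \<and> integral\<^sup>L M (\<omega> u) \<le> \<tau>)" unfolding \<omega>_def by blast
  have "\<forall>j. \<exists>u. u \<in> borel_measurable M \<and> (AE t in M. norm (u t) \<le> 1 / real (Suc j)) \<and> (AE t in M. \<bar>F t (u t)\<bar> \<noteq> \<infinity>) \<and>
     \<not> (integrable M (\<omega> u) \<and> integral\<^sup>L M (\<omega> u) \<le> \<tau>)"
    by (intro allI neg) auto
  from choice[OF this] obtain u where u_all: "\<forall>j. u j \<in> borel_measurable M \<and> (AE t in M. norm (u j t) \<le> 1 / real (Suc j)) \<and>
     (AE t in M. \<bar>F t (u j t)\<bar> \<noteq> \<infinity>) \<and> \<not> (integrable M (\<omega> (u j)) \<and> integral\<^sup>L M (\<omega> (u j)) \<le> \<tau>)" ..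
  then have u [measurable]: "\<And>j. u j \<in> borel_measurable M" and u_le: "\<And>j. AE t in M. norm (u j t) \<le> 1 / real (Suc j)"
    and fin: "\<And>j. AE t in M. \<bar>F t (u j t)\<bar> \<noteq> \<infinity>"
    and big: "\<And>j. \<not> (integrable M (\<omega> (u j)) \<and> integral\<^sup>L M (\<omega> (u j)) \<le> \<tau>)" by blast+
  have u_le1: "AE t in M. norm (u j t) \<le> 1" for j
    using u_le[of j] by eventually_elim (rule order_trans, assumption, simp)
  have big': "\<tau> < integral\<^sup>L M (\<omega> (u j))" for j using big[of j] \<omega>_int[OF u u_le1 fin] by auto
  have "(\<lambda>j. integral\<^sup>L M (\<omega> (u j))) \<longlonglongrightarrow> integral\<^sup>L M (\<lambda>t. 0)"
  proof (rule integral_dominated_convergence[OF _ _ w_int])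
    show "AE t in M. norm (\<omega> (u j) t) \<le> w t" for j by (rule \<omega>_le[OF u_le1 fin])
    have "AE t in M. \<forall>j. norm (u j t) \<le> 1 / real (Suc j)" "AE t in M. \<forall>j. \<bar>F t (u j t)\<bar> \<noteq> \<infinity>"
      using u_le fin by (auto simp: AE_all_countable)
    then show "AE t in M. (\<lambda>j. \<omega> (u j) t) \<longlonglongrightarrow> 0" using AE_space
    proof eventually_elim
      case (elim t)
      have lim: "(\<lambda>j. u j t) \<longlonglongrightarrow> 0"
        by (rule Lim_null_comparison[OF _ LIMSEQ_Suc[OF lim_1_over_n]]) (use elim(1) in auto)
      show ?case
      proof (rule LIMSEQ_I)
        fix \<epsilon> :: real assume \<epsilon>: "0 < \<epsilon>"
        have "open {x. ereal (a\<^sub>0 t - \<epsilon>) < F t x}" using F_lsc[OF elim(3)] by (simp add: lsc_def)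
        then have "eventually (\<lambda>j. u j t \<in> {x. ereal (a\<^sub>0 t - \<epsilon>) < F t x}) sequentially"
          using \<epsilon> F_zero[OF elim(3)] by (intro topological_tendstoD[OF lim]) auto
        then obtain N where N: "\<And>j. j \<ge> N \<Longrightarrow> ereal (a\<^sub>0 t - \<epsilon>) < F t (u j t)" by (auto simp: eventually_sequentially)
        show "\<exists>N. \<forall>j\<ge>N. norm (\<omega> (u j) t - 0) < \<epsilon>"
        proof (intro exI[of _ N] allI impI)
          fix j assume "N \<le> j"
          then have "ereal (a\<^sub>0 t - \<epsilon>) < ereal (real_of_ereal (F t (u j t)))" using N elim(2) by (simp add: ereal_real)
          then show "norm (\<omega> (u j) t - 0) < \<epsilon>" using \<epsilon> by (simp add: \<omega>_def)
        qed
      qed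
    qed
  qed measurable
  then have "(\<lambda>j. integral\<^sup>L M (\<omega> (u j))) \<longlonglongrightarrow> 0" by simp
  then have "\<tau> \<le> 0" by (rule LIMSEQ_le_const) (use big' in \<open>auto intro: less_imp_le\<close>)
  then show False using \<tau> by simp
qed

theorem subgradient_approximation:
  fixes xs :: "'a \<Rightarrow>\<^sub>L real"
  assumes C1: "C1_on (- {0}) (norm :: 'a \<Rightarrow> real)" and C: "weak_disc C" and \<tau>: "0 < \<tau>"
    and subgrad: "\<And>y b. integrable M b \<Longrightarrow> AE t in M. F t y = ereal (b t) \<Longrightarrow>
       integral\<^sup>L M a\<^sub>0 + xs y \<le> integral\<^sup>L M b"
  shows "\<exists>u v. u \<in> borel_measurable M \<and> integrable M v \<and> (AE t in M. norm (u t) \<le> \<tau>) \<and>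
    (AE t in M. v t \<in> subdifferential (F t) (u t)) \<and>
    (\<forall>h\<in>C. \<bar>(\<integral>t. v t \<partial>M) h - xs h\<bar> \<le> \<tau>) \<and>
    \<bar>\<integral>t. v t (u t) \<partial>M\<bar> \<le> \<tau> \<and>
    integrable M (\<lambda>t. \<bar>real_of_ereal (F t (u t)) - a\<^sub>0 t\<bar>) \<and>
    (\<integral>t. \<bar>real_of_ereal (F t (u t)) - a\<^sub>0 t\<bar> \<partial>M) \<le> \<tau>"
proof -
  obtain \<epsilon> where \<epsilon>: "0 < \<epsilon>" "\<epsilon> \<le> 1" and neg: "\<And>u. u \<in> borel_measurable M \<Longrightarrow> AE t in M. norm (u t) \<le> \<epsilon> \<Longrightarrow> AE t in M. \<bar>F t (u t)\<bar> \<noteq> \<infinity> \<Longrightarrow>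
     integrable M (\<lambda>t. max 0 (a\<^sub>0 t - real_of_ereal (F t (u t)))) \<and>
     (\<integral>t. max 0 (a\<^sub>0 t - real_of_ereal (F t (u t))) \<partial>M) \<le> \<tau> / 4"
    using negative_part_small[of "\<tau> / 4"] \<tau> by auto
  \<comment> \<open>Besides the uniform bounds, \<open>\<rho> * norm xs \<le> \<tau> / 4\<close> is
    wanted for the pairing of \<open>v\<close> with \<open>u\<close>.\<close>
  define \<rho> where "\<rho> = min (min \<epsilon> \<tau>) (\<tau> / (4 * (norm xs + 1)))"
  have \<rho>: "0 < \<rho>" "\<rho> \<le> 1" "\<rho> \<le> \<epsilon>" "\<rho> \<le> \<tau>"
    using \<epsilon> \<tau> by (auto simp: \<rho>_def add_nonneg_pos)
  have "\<rho> * norm xs \<le> \<tau> / (4 * (norm xs + 1)) * norm xs" by (intro mult_right_mono) (auto simp: \<rho>_def)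
  also have "\<dots> \<le> \<tau> / 4"
  proof -
    have pos: "0 < norm xs + 1" by (simp add: add_nonneg_pos)
    then have "\<tau> / (4 * (norm xs + 1)) * norm xs = \<tau> / 4 * (norm xs / (norm xs + 1))" by simp
    also have "\<dots> \<le> \<tau> / 4 * 1" using pos \<tau> by (intro mult_left_mono) auto
    finally show ?thesis by simp
  qed
  finally have \<rho>xs: "\<rho> * norm xs \<le> \<tau> / 4" .
  obtain R\<^sub>0 where R0: "0 < R\<^sub>0" "\<And>y. y \<in> C \<Longrightarrow> norm y \<le> R\<^sub>0"
    using C unfolding weak_disc_def bounded_pos by blast
  \<comment> \<open>Shrinks \<open>C\<close> into the ball of radius \<open>\<rho> / 8\<close>. The
    decomposition is then asked for the tolerance \<open>c * (\<tau> / 4)\<close>, so that dividing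
    by \<open>c\<close> brings back \<open>\<tau> / 4\<close> on \<open>C\<close> itself.\<close>
  define c where "c = min 1 (\<rho> / (8 * R\<^sub>0))"
  have c: "0 < c" "c \<le> 1" using \<rho> R0 by (auto simp: c_def)
  have "c * R\<^sub>0 \<le> \<rho> / (8 * R\<^sub>0) * R\<^sub>0" using R0 by (intro mult_right_mono) (auto simp: c_def)
  then have cR: "c * R\<^sub>0 \<le> \<rho> / 8" using R0 by simp
  define C' where "C' = (\<lambda>y. c *\<^sub>R y) ` C"
  have C': "weak_disc C'" unfolding C'_def by (rule weak_disc_scaleR[OF C])
  have C'_le: "norm y \<le> \<rho> / 8" if "y \<in> C'" for y
  proof -
    obtain w where "w \<in> C" "y = c *\<^sub>R w" using \<open>y \<in> C'\<close> by (auto simp: C'_def)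
    then have "norm y \<le> c * R\<^sub>0" using R0(2)[of w] c by (simp add: mult_left_mono)
    then show ?thesis using cR by simp
  qed
  have "0 < \<rho> / 16" using \<rho> by simp
  then obtain D :: "'a \<Rightarrow> 'a \<Rightarrow>\<^sub>L real" where D: "D \<in> borel_measurable borel"
    "\<And>z. (soft_norm (\<rho> / 16) has_derivative D z) (at z)" "\<And>z. norm (D z) \<le> 1" "\<And>z. soft_norm (\<rho> / 16) z \<le> D z z"
    using soft_norm_gradient[OF C1] by metis
  interpret penalization M F p g\<^sub>0 a\<^sub>0 C' "\<rho> / 8" "\<rho> / 16" xs D
    using C' C'_le D \<open>0 < \<rho> / 16\<close> subgrad by unfold_locales (auto simp: weak_disc_def)
  obtain u v where u [measurable]: "u \<in> borel_measurable M" and v: "integrable M v" and u_le: "AE t in M. norm (u t) \<le> \<rho>"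
    and sub: "AE t in M. v t \<in> subdifferential (F t) (u t)"
    and approx: "\<And>h. h \<in> C' \<Longrightarrow> \<bar>(\<integral>t. v t \<partial>M) h - xs h\<bar> \<le> c * (\<tau> / 4)"
    and vu: "(\<integral>t. v t (u t) \<partial>M) \<le> \<rho> * norm xs + c * (\<tau> / 4)"
    using approximate_decomposition[of \<rho> "c * (\<tau> / 4)"] \<rho> c \<tau> by auto
  have [measurable]: "v \<in> borel_measurable M" using v by auto
  have fin: "AE t in M. \<bar>F t (u t)\<bar> \<noteq> \<infinity>" using sub by eventually_elim (auto simp: subdifferential_def split: if_splits)
  define \<omega> where "\<omega> t = max 0 (a\<^sub>0 t - real_of_ereal (F t (u t)))" for t
  have u_\<epsilon>: "AE t in M. norm (u t) \<le> \<epsilon>" using u_le by eventually_elim (use \<rho> in simp)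
  have \<omega>: "integrable M \<omega>" "integral\<^sup>L M \<omega> \<le> \<tau> / 4" unfolding \<omega>_def using neg[OF u u_\<epsilon> fin] by auto
  have vu_int: "integrable M (\<lambda>t. v t (u t))"
  proof (rule Bochner_Integration.integrable_bound)
    show "integrable M (\<lambda>t. norm (v t) * \<rho>)" using v by simp
    show "AE t in M. norm (v t (u t)) \<le> norm (norm (v t) * \<rho>)" using u_le
    proof eventually_elim
      case (elim t)
      then show ?case using norm_blinfun[of "v t" "u t"] mult_left_mono[OF elim, of "norm (v t)"] \<rho> by simp
    qed
  qed measurable
  have le: "AE t in M. real_of_ereal (F t (u t)) - a\<^sub>0 t \<le> v t (u t)"
    using sub fin AE_space
  proof eventually_elim
    case (elim t)
    then have "\<forall>y. ereal (v t (y - u t)) \<le> F t y - F t (u t)" by (simp add: subdifferential_def)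
    from spec[OF this, of 0] show ?case using elim(2) F_zero[OF elim(3)] by (cases "F t (u t)") (auto simp: blinfun.minus_right)
  qed
  define \<alpha> where "\<alpha> t = \<bar>real_of_ereal (F t (u t)) - a\<^sub>0 t\<bar>" for t
  \<comment> \<open>The absolute value is the difference plus twice its negative part
    \<open>\<omega> t\<close>, and the difference is at most \<open>v t (u t)\<close>. Integration
    gives \<open>\<tau> / 2 + 2 * (\<tau> / 4)\<close>.\<close>
  have \<alpha>_le: "AE t in M. \<alpha> t \<le> v t (u t) + 2 * \<omega> t" using le by eventually_elim (simp add: \<alpha>_def \<omega>_def abs_if max_def)
  have \<omega>_ge: "AE t in M. - \<omega> t \<le> v t (u t)" using le by eventually_elim (simp add: \<omega>_def)
  have \<alpha>_int: "integrable M \<alpha>"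
  proof (rule Bochner_Integration.integrable_bound)
    show "integrable M (\<lambda>t. v t (u t) + 2 * \<omega> t)" using vu_int \<omega> by simp
    show "\<alpha> \<in> borel_measurable M" unfolding \<alpha>_def by measurable
    show "AE t in M. norm (\<alpha> t) \<le> norm (v t (u t) + 2 * \<omega> t)" using \<alpha>_le by eventually_elim (simp add: \<alpha>_def)
  qed
  have c\<tau>: "c * (\<tau> / 4) \<le> \<tau> / 4" using c \<tau> by (simp add: mult_right_le_one_le mult_left_le_one_le)
  have vu_le: "(\<integral>t. v t (u t) \<partial>M) \<le> \<tau> / 2" using vu \<rho>xs c\<tau> by simp
  have "integral\<^sup>L M \<alpha> \<le> (\<integral>t. v t (u t) + 2 * \<omega> t \<partial>M)" using \<alpha>_int vu_int \<omega> \<alpha>_le by (intro integral_mono_AE) auto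
  also have "\<dots> = (\<integral>t. v t (u t) \<partial>M) + 2 * integral\<^sup>L M \<omega>" using vu_int \<omega> by simp
  finally have \<alpha>_small: "integral\<^sup>L M \<alpha> \<le> \<tau>" using vu_le \<omega>(2) by simp
  have "(\<integral>t. - \<omega> t \<partial>M) \<le> (\<integral>t. v t (u t) \<partial>M)" using vu_int \<omega> \<omega>_ge by (intro integral_mono_AE) auto
  then have "\<bar>\<integral>t. v t (u t) \<partial>M\<bar> \<le> \<tau>" using vu_le \<omega> \<tau> by (simp add: abs_le_iff)
  moreover have "\<bar>(\<integral>t. v t \<partial>M) h - xs h\<bar> \<le> \<tau>" if h: "h \<in> C" for h
  proof -
    have "\<bar>(\<integral>t. v t \<partial>M) (c *\<^sub>R h) - xs (c *\<^sub>R h)\<bar> \<le> c * (\<tau> / 4)" using h by (intro approx) (auto simp: C'_def)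
    then have "c * \<bar>(\<integral>t. v t \<partial>M) h - xs h\<bar> \<le> c * (\<tau> / 4)"
      using c by (simp add: blinfun.scaleR_right abs_mult flip: right_diff_distrib)
    then show ?thesis using c \<tau> by simp
  qed
  moreover have "AE t in M. norm (u t) \<le> \<tau>" using u_le by eventually_elim (use \<rho> in simp)
  ultimately show ?thesis using u v sub \<alpha>_int \<alpha>_small unfolding \<alpha>_def by blast
qed

end

section \<open>Integral functionals\<close>

lemma e2ennreal_0 [simp]: "e2ennreal 0 = 0"
  by (metis e2ennreal_ereal ennreal_0 zero_ereal_def)

lemma ereal_integral_eq_real:
  assumes k: "integrable M k" and eq: "AE t in M. h t = ereal (k t)"
  shows "ereal_integral M h = ereal (integral\<^sup>L M k)"
proof -
  have pos: "(\<integral>\<^sup>+ t. e2ennreal (max (h t) 0) \<partial>M) = (\<integral>\<^sup>+ t. ennreal (k t) \<partial>M)"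
    by (rule nn_integral_cong_AE) (use eq in eventually_elim, simp add: e2ennreal_ereal max_def ennreal_neg flip: zero_ereal_def)
  have neg: "(\<integral>\<^sup>+ t. e2ennreal (- min (h t) 0) \<partial>M) = (\<integral>\<^sup>+ t. ennreal (- k t) \<partial>M)"
    by (rule nn_integral_cong_AE) (use eq in eventually_elim, simp add: e2ennreal_ereal min_def ennreal_neg)
  have fin: "(\<integral>\<^sup>+ t. ennreal (k t) \<partial>M) \<noteq> \<infinity>" "(\<integral>\<^sup>+ t. ennreal (- k t) \<partial>M) \<noteq> \<infinity>"
    using k by (auto simp: real_integrable_def)
  have "enn2ereal A = ereal (enn2real A)" if "A \<noteq> \<infinity>" for A
    using that by (cases A) (auto simp: enn2ereal_ennreal)
  then show ?thesis
    unfolding ereal_integral_def pos neg using fin by (simp add: real_lebesgue_integral_def[OF k])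
qed

lemma ereal_integral_finite:
  assumes h [measurable]: "h \<in> borel_measurable M"
    and pos_fin: "(\<integral>\<^sup>+ t. e2ennreal (max (h t) 0) \<partial>M) \<noteq> \<infinity>" and neg_fin: "(\<integral>\<^sup>+ t. e2ennreal (- min (h t) 0) \<partial>M) \<noteq> \<infinity>"
  shows "AE t in M. \<bar>h t\<bar> \<noteq> \<infinity>" "integrable M (\<lambda>t. real_of_ereal (h t))"
    "ereal_integral M h = ereal (\<integral>t. real_of_ereal (h t) \<partial>M)"
proof -
  have "AE t in M. e2ennreal (max (h t) 0) \<noteq> \<infinity>" "AE t in M. e2ennreal (- min (h t) 0) \<noteq> \<infinity>"
    by (rule nn_integral_PInf_AE[OF _ pos_fin], measurable, rule nn_integral_PInf_AE[OF _ neg_fin], measurable)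
  then show fin: "AE t in M. \<bar>h t\<bar> \<noteq> \<infinity>"
  proof eventually_elim
    case (elim t) then show ?case by (cases "h t") auto
  qed
  have "(\<integral>\<^sup>+ t. ennreal (norm (real_of_ereal (h t))) \<partial>M) = (\<integral>\<^sup>+ t. e2ennreal (max (h t) 0) + e2ennreal (- min (h t) 0) \<partial>M)"
  proof (rule nn_integral_cong_AE, use fin in eventually_elim)
    fix t assume "\<bar>h t\<bar> \<noteq> \<infinity>"
    then obtain r where "h t = ereal r" by (cases "h t") auto
    then show "ennreal (norm (real_of_ereal (h t))) = e2ennreal (max (h t) 0) + e2ennreal (- min (h t) 0)"
      by (cases "0 \<le> r") (auto simp: e2ennreal_ereal max_def min_def)
  qed
  also have "\<dots> = (\<integral>\<^sup>+ t. e2ennreal (max (h t) 0) \<partial>M) + (\<integral>\<^sup>+ t. e2ennreal (- min (h t) 0) \<partial>M)"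
    by (rule nn_integral_add) measurable
  finally have "(\<integral>\<^sup>+ t. ennreal (norm (real_of_ereal (h t))) \<partial>M) < \<infinity>"
    using pos_fin neg_fin by (simp add: top.not_eq_extremum[symmetric])
  then show int: "integrable M (\<lambda>t. real_of_ereal (h t))" by (intro integrableI_bounded) measurable
  have "AE t in M. h t = ereal (real_of_ereal (h t))" using fin by eventually_elim (simp add: ereal_real)
  then show "ereal_integral M h = ereal (\<integral>t. real_of_ereal (h t) \<partial>M)" by (rule ereal_integral_eq_real[OF int])
qed

text \<open>Since \<open>\<infinity> + (- \<infinity>) = \<infinity>\<close>, a finite value forces
  both parts to be finite.\<close>

lemma ereal_integral_real:
  assumes h: "h \<in> borel_measurable M" and fin: "\<bar>ereal_integral M h\<bar> \<noteq> \<infinity>"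
  shows "AE t in M. \<bar>h t\<bar> \<noteq> \<infinity>" "integrable M (\<lambda>t. real_of_ereal (h t))"
    "ereal_integral M h = ereal (\<integral>t. real_of_ereal (h t) \<partial>M)"
proof -
  have pos: "(\<integral>\<^sup>+ t. e2ennreal (max (h t) 0) \<partial>M) \<noteq> \<infinity>" using fin by (auto simp: ereal_integral_def)
  have neg: "(\<integral>\<^sup>+ t. e2ennreal (- min (h t) 0) \<partial>M) \<noteq> \<infinity>"
  proof
    assume "(\<integral>\<^sup>+ t. e2ennreal (- min (h t) 0) \<partial>M) = \<infinity>"
    then show False using fin pos unfolding ereal_integral_def
      by (cases "\<integral>\<^sup>+ t. e2ennreal (max (h t) 0) \<partial>M") (auto simp: enn2ereal_ennreal)
  qed
  show "AE t in M. \<bar>h t\<bar> \<noteq> \<infinity>" "integrable M (\<lambda>t. real_of_ereal (h t))"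
    "ereal_integral M h = ereal (\<integral>t. real_of_ereal (h t) \<partial>M)"
    using ereal_integral_finite[OF h pos neg] by blast+
qed

lemma ereal_integral_bounded_below:
  assumes h: "h \<in> borel_measurable M" and c: "integrable M c" "AE t in M. ereal (c t) \<le> h t"
    and ninf: "ereal_integral M h \<noteq> \<infinity>"
  shows "\<bar>ereal_integral M h\<bar> \<noteq> \<infinity>"
proof -
  have pos: "(\<integral>\<^sup>+ t. e2ennreal (max (h t) 0) \<partial>M) \<noteq> \<infinity>" using ninf by (auto simp: ereal_integral_def)
  have "(\<integral>\<^sup>+ t. e2ennreal (- min (h t) 0) \<partial>M) \<le> (\<integral>\<^sup>+ t. ennreal (- c t) \<partial>M)"
  proof (rule nn_integral_mono_AE, use c(2) in eventually_elim)
    fix t assume "ereal (c t) \<le> h t"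
    then show "e2ennreal (- min (h t) 0) \<le> ennreal (- c t)"
      by (cases "h t") (auto simp: e2ennreal_ereal min_def intro: ennreal_leI)
  qed
  moreover have "(\<integral>\<^sup>+ t. ennreal (- c t) \<partial>M) \<noteq> \<infinity>" using c(1) by (auto simp: real_integrable_def)
  ultimately have neg: "(\<integral>\<^sup>+ t. e2ennreal (- min (h t) 0) \<partial>M) \<noteq> \<infinity>" by (auto simp: top_unique)
  show ?thesis using ereal_integral_finite(3)[OF h pos neg] by simp
qed

lemma ereal_integral_nonneg:
  assumes "\<And>t. t \<in> space M \<Longrightarrow> 0 \<le> h t"
  shows "0 \<le> ereal_integral M h"
proof -
  have "(\<integral>\<^sup>+ t. e2ennreal (- min (h t) 0) \<partial>M) = (\<integral>\<^sup>+ t. 0 \<partial>M)"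
    by (rule nn_integral_cong) (use assms in \<open>simp add: min_absorb2\<close>)
  then show ?thesis by (simp add: ereal_integral_def zero_ennreal.rep_eq enn2ereal_nonneg)
qed

lemma normal_integrand_compose:
  assumes "normal_integrand M f" "u \<in> borel_measurable M"
  shows "(\<lambda>t. f t (u t)) \<in> borel_measurable M"
proof -
  have "(\<lambda>t. (t, u t)) \<in> measurable M (M \<Otimes>\<^sub>M borel)" using assms by measurable
  from measurable_compose[OF this, of "case_prod f" borel] assms(1) show ?thesis
    by (simp add: normal_integrand_def)
qed

lemma Linf_AE_bounded:
  assumes "u \<in> Linf M"
  obtains K where "0 \<le> K" "AE t in M. norm (u t) \<le> K"
proof -
  have fin: "Linf_norm M u < \<infinity>" using assms by (simp add: Linf_def)
  define K where "K = enn2real (Linf_norm M u)"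
  have K: "ennreal K = Linf_norm M u" using fin by (simp add: K_def less_top)
  have "AE t in M. ennreal (norm (u t)) \<le> ennreal K"
    unfolding K Linf_norm_def by (rule esssup_AE)
  then have "AE t in M. norm (u t) \<le> K" by eventually_elim (simp add: K_def)
  then show ?thesis using that[of K] by (simp add: K_def)
qed

text \<open>Integrates the subgradient inequality at \<open>u \<nu> t\<close>, splitting
  \<open>y - u \<nu> t\<close> as \<open>(y - x) - (u \<nu> t - x)\<close>; the remainders vanish in
  the limit. An arbitrary filter covers nets and sequences at once.\<close>

lemma subgradient_of_approximating:
  fixes x :: "'a::separable_asplund" and F :: "'i filter"
  assumes f: "normal_integrand M f" and fin: "\<bar>integral_functional M f x\<bar> \<noteq> \<infinity>"
    and appr: "approximating M f x I F u v" and F: "F \<noteq> bot" and I: "eventually (\<lambda>\<nu>. \<nu> \<in> I) F"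
    and weak: "\<And>y. ((\<lambda>\<nu>. blinfun_apply (LINT t|M. v \<nu> t) y) \<longlongrightarrow> blinfun_apply xs y) F"
  shows "xs \<in> subdifferential (integral_functional M f) x"
proof -
  have f_meas [measurable]: "(\<lambda>t. f t (w t)) \<in> borel_measurable M" if "w \<in> borel_measurable M" for w
    by (rule normal_integrand_compose[OF f that])
  define a where "a t = real_of_ereal (f t x)" for t
  have fin': "\<bar>ereal_integral M (\<lambda>t. f t x)\<bar> \<noteq> \<infinity>" using fin by (simp add: integral_functional_def)
  have fx: "AE t in M. \<bar>f t x\<bar> \<noteq> \<infinity>" and a_int: "integrable M a"
    and Ex: "integral_functional M f x = ereal (integral\<^sup>L M a)"
    using ereal_integral_real[OF _ fin'] by (auto simp: a_def[abs_def] integral_functional_def)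
  define e where "e \<nu> = ereal_integral M (\<lambda>t. \<bar>f t (u \<nu> t) - f t x\<bar>)" for \<nu>
  have e_lim: "(e \<longlongrightarrow> 0) F" and vu_lim: "((\<lambda>\<nu>. LINT t|M. v \<nu> t (u \<nu> t - x)) \<longlongrightarrow> 0) F"
    using appr by (auto simp: approximating_def e_def[abs_def])
  have "((\<lambda>\<nu>. real_of_ereal (e \<nu>)) \<longlongrightarrow> 0) F" using e_lim by (intro lim_real_of_ereal) (simp add: zero_ereal_def)
  have e_fin: "eventually (\<lambda>\<nu>. e \<nu> < 1) F" using e_lim by (intro order_tendstoD(2)) auto
  have "ereal (xs (y - x)) \<le> integral_functional M f y - integral_functional M f x" for y
  proof (cases "integral_functional M f y = \<infinity>")
    case True then show ?thesis by (simp add: Ex)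
  next
    case False
    \<comment> \<open>Finiteness of the integral at \<open>y\<close> is itself derived along the
      filter, from an integrable minorant of \<open>f t y\<close> that is available once
      \<open>e \<nu>\<close> is finite; hence it is part of the eventual statement.\<close>
    have step: "eventually (\<lambda>\<nu>. \<bar>integral_functional M f y\<bar> \<noteq> \<infinity> \<and>
      (LINT t|M. v \<nu> t) (y - x) \<le> real_of_ereal (integral_functional M f y) - integral\<^sup>L M a + real_of_ereal (e \<nu>) + (LINT t|M. v \<nu> t (u \<nu> t - x))) F"
      using e_fin I
    proof eventually_elim
      case (elim \<nu>)
      have u_Linf: "u \<nu> \<in> Linf M" and v_int: "integrable M (v \<nu>)" and sub: "AE t in M. v \<nu> t \<in> subdifferential (f t) (u \<nu> t)"
        using appr elim(2) by (auto simp: approximating_def)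
      have [measurable]: "u \<nu> \<in> borel_measurable M" "v \<nu> \<in> borel_measurable M" using u_Linf v_int by (auto simp: Linf_def)
      have fu: "AE t in M. \<bar>f t (u \<nu> t)\<bar> \<noteq> \<infinity>" using sub by eventually_elim (auto simp: subdifferential_def split: if_splits)
      have "0 \<le> e \<nu>" unfolding e_def by (rule ereal_integral_nonneg) simp
      then have e_real: "\<bar>e \<nu>\<bar> \<noteq> \<infinity>" using elim(1) by (cases "e \<nu>") auto
      have diff_meas: "(\<lambda>t. \<bar>f t (u \<nu> t) - f t x\<bar>) \<in> borel_measurable M" by measurable
      note diff = ereal_integral_real[OF diff_meas e_real[unfolded e_def]]
      define b where "b t = real_of_ereal (f t (u \<nu> t))" for t
      have [measurable]: "b \<in> borel_measurable M" "a \<in> borel_measurable M" unfolding a_def b_def by measurable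
      have ab: "AE t in M. real_of_ereal \<bar>f t (u \<nu> t) - f t x\<bar> = \<bar>b t - a t\<bar>" using fx fu
      proof eventually_elim
        case (elim t) then show ?case by (cases "f t x"; cases "f t (u \<nu> t)") (auto simp: a_def b_def)
      qed
      have ab_int: "integrable M (\<lambda>t. \<bar>b t - a t\<bar>)"
        by (rule integrable_cong_AE_imp[OF diff(2)]) (use ab in auto)
      then have "integrable M (\<lambda>t. norm (b t - a t))" by simp
      then have "integrable M (\<lambda>t. b t - a t)" by (rule integrable_norm_iff[THEN iffD1, rotated]) measurable
      from Bochner_Integration.integrable_add[OF this a_int] have "integrable M (\<lambda>t. (b t - a t) + a t)" .
      then have b_int: "integrable M b" by simp
      have "(\<integral>t. real_of_ereal \<bar>f t (u \<nu> t) - f t x\<bar> \<partial>M) = (\<integral>t. \<bar>b t - a t\<bar> \<partial>M)"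
        by (rule integral_cong_AE) (use ab in auto)
      then have e_eq: "real_of_ereal (e \<nu>) = (\<integral>t. \<bar>b t - a t\<bar> \<partial>M)" using diff(3) by (simp add: e_def)
      obtain K where K: "0 \<le> K" "AE t in M. norm (u \<nu> t) \<le> K" using Linf_AE_bounded[OF u_Linf] by metis
      have vu_int: "integrable M (\<lambda>t. v \<nu> t (u \<nu> t - x))"
      proof (rule Bochner_Integration.integrable_bound)
        show "integrable M (\<lambda>t. norm (v \<nu> t) * (K + norm x))" using v_int by simp
        show "AE t in M. norm (v \<nu> t (u \<nu> t - x)) \<le> norm (norm (v \<nu> t) * (K + norm x))" using K(2)
        proof eventually_elim
          case (elim t)
          have "norm (v \<nu> t (u \<nu> t - x)) \<le> norm (v \<nu> t) * norm (u \<nu> t - x)" by (rule norm_blinfun)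
          also have "\<dots> \<le> norm (v \<nu> t) * (K + norm x)"
            using elim norm_triangle_ineq4[of "u \<nu> t" x] by (intro mult_left_mono) auto
          finally show ?case using K(1) by simp
        qed
      qed measurable
      have vy_int: "integrable M (\<lambda>t. v \<nu> t (y - x))" by (rule integrable_blinfun_apply[OF v_int])
      define c where "c t = b t + (v \<nu> t (y - x) - v \<nu> t (u \<nu> t - x))" for t
      have c_int: "integrable M c" unfolding c_def using b_int vy_int vu_int by simp
      have c_le: "AE t in M. ereal (c t) \<le> f t y" using sub fu
      proof eventually_elim
        case (elim t)
        then have "ereal (v \<nu> t (y - u \<nu> t)) \<le> f t y - f t (u \<nu> t)" by (auto simp: subdifferential_def split: if_splits)
        moreover have "v \<nu> t (y - u \<nu> t) = v \<nu> t (y - x) - v \<nu> t (u \<nu> t - x)" by (simp add: blinfun.diff_right)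
        moreover obtain r where "f t (u \<nu> t) = ereal r" using elim(2) by (cases "f t (u \<nu> t)") auto
        ultimately show ?case by (cases "f t y") (auto simp: c_def b_def)
      qed
      have fin_y: "\<bar>ereal_integral M (\<lambda>t. f t y)\<bar> \<noteq> \<infinity>"
        using False by (intro ereal_integral_bounded_below[OF _ c_int c_le]) (auto simp: integral_functional_def)
      note y_int = ereal_integral_real[OF _ fin_y]
      have "AE t in M. c t \<le> real_of_ereal (f t y)" using c_le y_int(1)[OF f_meas, OF borel_measurable_const]
      proof eventually_elim
        case (elim t) then show ?case by (cases "f t y") auto
      qed
      then have "integral\<^sup>L M c \<le> (\<integral>t. real_of_ereal (f t y) \<partial>M)"
        using c_int y_int(2) by (intro integral_mono_AE) auto
      moreover have "(\<integral>t. real_of_ereal (f t y) \<partial>M) = real_of_ereal (integral_functional M f y)"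
        using y_int(3) by (simp add: integral_functional_def)
      moreover have "integral\<^sup>L M c = integral\<^sup>L M b + ((LINT t|M. v \<nu> t) (y - x) - (LINT t|M. v \<nu> t (u \<nu> t - x)))"
        unfolding c_def using b_int vy_int vu_int integral_blinfun_apply[OF v_int] by simp
      moreover have "integral\<^sup>L M a - integral\<^sup>L M b \<le> (\<integral>t. \<bar>b t - a t\<bar> \<partial>M)"
      proof -
        have "(\<integral>t. a t - b t \<partial>M) \<le> (\<integral>t. \<bar>b t - a t\<bar> \<partial>M)"
          using a_int b_int ab_int by (intro integral_mono) auto
        then show ?thesis using a_int b_int by simp
      qed
      ultimately show ?case using fin_y e_eq by (simp add: integral_functional_def)
    qed
    obtain E where E: "integral_functional M f y = ereal E"
      using eventually_happens'[OF F step] by (cases "integral_functional M f y") auto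
    have "xs (y - x) \<le> E - integral\<^sup>L M a + 0 + 0"
    proof (rule tendsto_le[OF F _ weak])
      show "((\<lambda>\<nu>. E - integral\<^sup>L M a + real_of_ereal (e \<nu>) + (LINT t|M. v \<nu> t (u \<nu> t - x))) \<longlongrightarrow> E - integral\<^sup>L M a + 0 + 0) F"
        by (intro tendsto_intros vu_lim \<open>((\<lambda>\<nu>. real_of_ereal (e \<nu>)) \<longlongrightarrow> 0) F\<close>)
      show "eventually (\<lambda>\<nu>. (LINT t|M. v \<nu> t) (y - x) \<le> E - integral\<^sup>L M a + real_of_ereal (e \<nu>) + (LINT t|M. v \<nu> t (u \<nu> t - x))) F"
        using step by eventually_elim (simp add: E)
    qed
    then show ?thesis by (simp add: Ex E)
  qed
  then show ?thesis using fin by (simp add: subdifferential_def)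
qed

text \<open>The mean value inequality with the supremum of the gradient norms as Lipschitz constant.
  That supremum may be infinite on a null set, where \<open>enn2real\<close> makes \<open>k\<close>
  zero, so the bound is claimed almost everywhere.\<close>

lemma lipschitz_minorant:
  fixes f g :: "'t \<Rightarrow> 'a::separable_asplund \<Rightarrow> ereal"
  assumes g: "normal_integrand M g"
    and le: "\<And>t y. t \<in> space M \<Longrightarrow> g t y \<le> f t y"
    and g_fin: "\<And>t y. t \<in> space M \<Longrightarrow> \<bar>g t y\<bar> \<noteq> \<infinity>"
    and C1: "\<And>t. t \<in> space M \<Longrightarrow> C1_on UNIV (\<lambda>y. real_of_ereal (g t y))"
    and meas: "(\<lambda>t. SUP y. ennreal (norm (gradient (\<lambda>z. real_of_ereal (g t z)) y))) \<in> borel_measurable M"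
    and int: "(\<integral>\<^sup>+ t. (SUP y. ennreal (norm (gradient (\<lambda>z. real_of_ereal (g t z)) y))) \<partial>M) < \<infinity>"
    and Eg: "\<bar>integral_functional M g x\<bar> \<noteq> \<infinity>"
  shows "\<exists>c k. integrable M c \<and> integrable M k \<and> (\<forall>t\<in>space M. 0 \<le> k t) \<and>
    (AE t in M. \<forall>y. ereal (c t - k t * norm (y - x)) \<le> f t y)"
proof -
  define s where "s t = (SUP y. ennreal (norm (gradient (\<lambda>z. real_of_ereal (g t z)) y)))" for t
  have [measurable]: "s \<in> borel_measurable M" using meas by (simp add: s_def[abs_def])
  have s_int: "(\<integral>\<^sup>+ t. s t \<partial>M) < \<infinity>" using int by (simp add: s_def)
  then have s_fin: "AE t in M. s t \<noteq> \<infinity>" by (intro nn_integral_PInf_AE) auto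
  define k where "k t = enn2real (s t)" for t
  have "(\<integral>\<^sup>+ t. ennreal (norm (k t)) \<partial>M) \<le> (\<integral>\<^sup>+ t. s t \<partial>M)"
    by (rule nn_integral_mono) (simp add: k_def ennreal_enn2real_if)
  then have k_int: "integrable M k"
    using s_int by (intro integrableI_bounded) (auto simp: k_def[abs_def] intro: le_less_trans)
  define c where "c t = real_of_ereal (g t x)" for t
  have c_int: "integrable M c"
    unfolding c_def using Eg normal_integrand_compose[OF g borel_measurable_const]
    by (intro ereal_integral_real) (auto simp: integral_functional_def)
  have "AE t in M. \<forall>y. ereal (c t - k t * norm (y - x)) \<le> f t y"
    using s_fin AE_space
  proof eventually_elim
    case (elim t)
    define h where "h y = real_of_ereal (g t y)" for y
    have deriv: "(h has_derivative frechet_derivative h (at y)) (at y)" for y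
      using C1[OF elim(2)] by (simp add: C1_on_def h_def[abs_def] frechet_derivative_works[symmetric])
    have bound: "onorm (frechet_derivative h (at y)) \<le> k t" for y
    proof -
      have "ennreal (norm (gradient h y)) \<le> s t" unfolding s_def h_def[abs_def] by (rule SUP_upper) simp
      also have "s t = ennreal (k t)" using elim(1) by (simp add: k_def less_top)
      finally have "norm (gradient h y) \<le> k t" by (simp add: k_def)
      then show ?thesis
        using has_derivative_bounded_linear[OF deriv[of y]]
        by (simp add: gradient_def norm_blinfun.rep_eq bounded_linear_Blinfun_apply)
    qed
    show ?case
    proof
      fix y
      have "norm (h y - h x) \<le> k t * norm (y - x)"
        by (rule differentiable_bound[where S=UNIV and f'="\<lambda>y. frechet_derivative h (at y)"]) (use deriv bound in auto)
      then have "c t - k t * norm (y - x) \<le> h y" by (simp add: c_def h_def abs_le_iff)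
      then have "ereal (c t - k t * norm (y - x)) \<le> g t y" using g_fin[OF elim(2), of y] by (simp add: h_def ereal_real flip: ereal_less_eq(3))
      also have "\<dots> \<le> f t y" by (rule le[OF elim(2)])
      finally show "ereal (c t - k t * norm (y - x)) \<le> f t y" .
    qed
  qed
  then show ?thesis using c_int k_int by (intro exI[of _ c] exI[of _ k]) (auto simp: k_def)
qed

text \<open>All requirements with one common tolerance and a set \<open>C\<close> of test vectors;
  nets and sequences arise by letting \<open>\<tau>\<close> and \<open>C\<close> vary.\<close>

definition subgradient_pair ::
    "'t measure \<Rightarrow> ('t \<Rightarrow> 'a::separable_asplund \<Rightarrow> ereal) \<Rightarrow> 'a \<Rightarrow> ('a \<Rightarrow>\<^sub>L real) \<Rightarrow> 'a set \<Rightarrow> real \<Rightarrow>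
     ('t \<Rightarrow> 'a) \<Rightarrow> ('t \<Rightarrow> 'a \<Rightarrow>\<^sub>L real) \<Rightarrow> bool" where
  "subgradient_pair M f x xs C \<tau> u v \<longleftrightarrow>
     u \<in> borel_measurable M \<and> integrable M v \<and> (AE t in M. norm (x - u t) \<le> \<tau>) \<and>
     (AE t in M. v t \<in> subdifferential (f t) (u t)) \<and>
     (\<forall>h\<in>C. \<bar>(LINT t|M. v t) h - xs h\<bar> \<le> \<tau>) \<and>
     \<bar>LINT t|M. v t (u t - x)\<bar> \<le> \<tau> \<and>
     ereal_integral M (\<lambda>t. \<bar>f t (u t) - f t x\<bar>) \<le> ereal \<tau>"

lemma integral_functional_subgradient_approximation:
  fixes f :: "'t \<Rightarrow> 'a::separable_asplund \<Rightarrow> ereal" and xs :: "'a \<Rightarrow>\<^sub>L real"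
  assumes compl: "complete_measure M" and sf: "sigma_finite_measure M"
    and C1: "C1_on (- {0}) (norm :: 'a \<Rightarrow> real)"
    and f: "normal_integrand M f" and conv: "\<And>t. t \<in> space M \<Longrightarrow> convex_ereal (f t)"
    and Ef: "\<bar>integral_functional M f x\<bar> \<noteq> \<infinity>"
    and c: "integrable M c" and k: "integrable M k" "\<And>t. t \<in> space M \<Longrightarrow> 0 \<le> k t"
    and lower: "AE t in M. \<forall>y. ereal (c t - k t * norm (y - x)) \<le> f t y"
    and xs: "xs \<in> subdifferential (integral_functional M f) x"
    and C: "weak_disc C" and \<tau>: "0 < \<tau>"
  shows "\<exists>u v. subgradient_pair M f x xs C \<tau> u v"
proof -
  have f_x [measurable]: "(\<lambda>t. f t y) \<in> borel_measurable M" for y by (rule normal_integrand_compose[OF f]) simp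
  have fin': "\<bar>ereal_integral M (\<lambda>t. f t x)\<bar> \<noteq> \<infinity>" using Ef by (simp add: integral_functional_def)
  note fx = ereal_integral_real[OF f_x fin']
  have "AE t in M. \<bar>f t x\<bar> \<noteq> \<infinity> \<and> (\<forall>y. ereal (c t - k t * norm (y - x)) \<le> f t y)"
    using fx(1) lower by eventually_elim simp
  then obtain N where N: "{t \<in> space M. \<not> (\<bar>f t x\<bar> \<noteq> \<infinity> \<and> (\<forall>y. ereal (c t - k t * norm (y - x)) \<le> f t y))} \<subseteq> N"
    and N0: "N \<in> null_sets M" unfolding eventually_ae_filter by blast
  have N_sets [measurable]: "N \<in> sets M" using N0 by auto
  have N_AE: "AE t in M. t \<notin> N" by (rule AE_not_in[OF N0])
  have good: "\<bar>f t x\<bar> \<noteq> \<infinity>" "\<And>y. ereal (c t - k t * norm (y - x)) \<le> f t y" if "t \<in> space M" "t \<notin> N" for t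
    using N \<open>t \<in> space M\<close> \<open>t \<notin> N\<close> by auto
  \<comment> \<open>Exists by sigma-finiteness. Added to the Lipschitz constant, it makes the weight
    strictly positive and keeps it integrable.\<close>
  obtain w :: "'t \<Rightarrow> real" where w: "w \<in> borel_measurable M" "\<And>t. w t > 0" "integrable M w"
    using sigma_finite_measure.obtain_positive_integrable_function[OF sf] by metis
  \<comment> \<open>Translation moves the base point to the origin. The null set \<open>N\<close>
    contains the points where finiteness at \<open>x\<close> or the minorant fails; zero values on
    it make the conditions hold at every \<open>t\<close> and change nothing almost
    everywhere.\<close>
  define F where "F t z = (if t \<in> N then 0 else f t (x + z))" for t z
  define p where "p t = k t + w t" for t
  define g\<^sub>0 where "g\<^sub>0 t = (if t \<in> N then 0 else c t)" for t
  define a\<^sub>0 where "a\<^sub>0 t = (if t \<in> N then 0 else real_of_ereal (f t x))" for t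
  have meas [measurable]: "c \<in> borel_measurable M" "(\<lambda>t. real_of_ereal (f t x)) \<in> borel_measurable M" using c fx(2) by auto
  have a0_AE: "AE t in M. a\<^sub>0 t = real_of_ereal (f t x)" using N_AE by eventually_elim (simp add: a\<^sub>0_def)
  have [measurable]: "a\<^sub>0 \<in> borel_measurable M" "g\<^sub>0 \<in> borel_measurable M" unfolding a\<^sub>0_def g\<^sub>0_def by measurable
  have int_a0: "integral\<^sup>L M a\<^sub>0 = (\<integral>t. real_of_ereal (f t x) \<partial>M)" by (rule integral_cong_AE) (use a0_AE in auto)
  interpret convex_integrand M F p g\<^sub>0 a\<^sub>0
  proof (rule convex_integrand.intro)
    show "complete_measure M" "sigma_finite_measure M" by fact+
    show "normal_integrand M F" unfolding normal_integrand_def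
    proof (intro conjI ballI)
      have shift: "(\<lambda>z. (fst z, x + snd z)) \<in> measurable (M \<Otimes>\<^sub>M borel) (M \<Otimes>\<^sub>M borel)" by measurable
      have "case_prod f \<in> borel_measurable (M \<Otimes>\<^sub>M borel)" using f by (simp add: normal_integrand_def)
      from measurable_compose[OF shift this]
      have [measurable]: "(\<lambda>z. f (fst z) (x + snd z)) \<in> borel_measurable (M \<Otimes>\<^sub>M borel)" by simp
      show "case_prod F \<in> borel_measurable (M \<Otimes>\<^sub>M borel)"
        unfolding F_def case_prod_beta' by measurable
      fix t assume t: "t \<in> space M"
      show "lsc (F t)"
      proof (cases "t \<in> N")
        case True then show ?thesis by (simp add: F_def lsc_def)
      next
        case False
        have "open ((\<lambda>z. x + z) -` {y. b < f t y})" for b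
          using f t by (intro open_vimage continuous_intros) (auto simp: normal_integrand_def lsc_def)
        then show ?thesis using False by (simp add: F_def lsc_def vimage_def)
      qed
    qed
    show "convex_ereal (F t)" if t: "t \<in> space M" for t
    proof (cases "t \<in> N")
      case True then show ?thesis by (simp add: F_def convex_ereal_def)
    next
      case False
      have "x + (s *\<^sub>R a + (1 - s) *\<^sub>R b) = s *\<^sub>R (x + a) + (1 - s) *\<^sub>R (x + b)" for s and a b :: 'a
        by (simp add: algebra_simps)
      then show ?thesis using conv[OF t] False by (simp add: F_def convex_ereal_def)
    qed
    show "0 < p t" if "t \<in> space M" for t using k(2)[OF that] w(2)[of t] by (simp add: p_def)
    show "integrable M p" unfolding p_def using k w by simp
    show "integrable M g\<^sub>0" by (rule integrable_cong_AE_imp[OF c]) (use N_AE in \<open>auto simp: g\<^sub>0_def elim: eventually_mono\<close>)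
    show "integrable M a\<^sub>0" by (rule integrable_cong_AE_imp[OF fx(2)]) (use a0_AE in auto)
    show "ereal (g\<^sub>0 t - p t * norm z) \<le> F t z" if t: "t \<in> space M" for t z
    proof (cases "t \<in> N")
      case True then show ?thesis using k(2)[OF t] w(2)[of t] by (simp add: F_def g\<^sub>0_def p_def)
    next
      case False
      have "ereal (g\<^sub>0 t - p t * norm z) \<le> ereal (c t - k t * norm ((x + z) - x))"
        using False w(2)[of t] by (simp add: g\<^sub>0_def p_def algebra_simps)
      also have "\<dots> \<le> f t (x + z)" by (rule good(2)[OF t False])
      finally show ?thesis using False by (simp add: F_def)
    qed
    show "F t 0 = ereal (a\<^sub>0 t)" if t: "t \<in> space M" for t
      using good(1)[OF t] by (auto simp: F_def a\<^sub>0_def ereal_real)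
  qed
  have subgrad: "integral\<^sup>L M a\<^sub>0 + xs y \<le> integral\<^sup>L M b" if b: "integrable M b" "AE t in M. F t y = ereal (b t)" for y b
  proof -
    have "AE t in M. f t (x + y) = ereal (b t)" using b(2) N_AE by eventually_elim (simp add: F_def)
    then have "integral_functional M f (x + y) = ereal (integral\<^sup>L M b)"
      unfolding integral_functional_def by (rule ereal_integral_eq_real[OF b(1)])
    moreover have "integral_functional M f x = ereal (integral\<^sup>L M a\<^sub>0)" using fx(3) by (simp add: integral_functional_def int_a0)
    moreover have "ereal (xs ((x + y) - x)) \<le> integral_functional M f (x + y) - integral_functional M f x"
      using xs Ef unfolding subdifferential_def by (metis (mono_tags, lifting) mem_Collect_eq)
    ultimately show ?thesis by simp
  qed
  obtain u v where u [measurable]: "u \<in> borel_measurable M" and v: "integrable M v" and u_le: "AE t in M. norm (u t) \<le> \<tau>"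
    and sub: "AE t in M. v t \<in> subdifferential (F t) (u t)"
    and vh: "\<forall>h\<in>C. \<bar>(LINT t|M. v t) h - xs h\<bar> \<le> \<tau>"
    and vu: "\<bar>LINT t|M. v t (u t)\<bar> \<le> \<tau>"
    and \<alpha>: "integrable M (\<lambda>t. \<bar>real_of_ereal (F t (u t)) - a\<^sub>0 t\<bar>)" "(LINT t|M. \<bar>real_of_ereal (F t (u t)) - a\<^sub>0 t\<bar>) \<le> \<tau>"
    using subgradient_approximation[OF C1 C \<tau> subgrad] by blast
  have sub': "AE t in M. v t \<in> subdifferential (f t) (x + u t)" using sub N_AE
  proof eventually_elim
    case (elim t)
    then have fin: "\<bar>f t (x + u t)\<bar> \<noteq> \<infinity>" and *: "\<And>y. ereal (v t (y - u t)) \<le> f t (x + y) - f t (x + u t)"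
      by (auto simp: subdifferential_def F_def split: if_splits)
    have "ereal (v t (y - (x + u t))) \<le> f t y - f t (x + u t)" for y
      using *[of "y - x"] by (simp add: algebra_simps)
    then show ?case using fin by (simp add: subdifferential_def)
  qed
  have "AE t in M. \<bar>f t (x + u t) - f t x\<bar> = ereal \<bar>real_of_ereal (F t (u t)) - a\<^sub>0 t\<bar>"
    using sub' N_AE AE_space
  proof eventually_elim
    case (elim t)
    have "\<bar>f t (x + u t)\<bar> \<noteq> \<infinity>" using elim(1) by (auto simp: subdifferential_def split: if_splits)
    then show ?case using good(1)[OF elim(3,2)] elim(2)
      by (cases "f t x"; cases "f t (x + u t)") (auto simp: F_def a\<^sub>0_def)
  qed
  then have "ereal_integral M (\<lambda>t. \<bar>f t (x + u t) - f t x\<bar>) \<le> ereal \<tau>"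
    using \<alpha> by (subst ereal_integral_eq_real[OF \<alpha>(1)]) auto
  then show ?thesis
    using v u_le sub' vh vu unfolding subgradient_pair_def by (intro exI[of _ "\<lambda>t. x + u t"] exI[of _ v]) (auto intro!: borel_measurable_add)
qed

lemma approximatingI:
  fixes x :: "'a::separable_asplund" and \<tau> :: "'i \<Rightarrow> real"
  assumes \<tau>: "(\<tau> \<longlongrightarrow> 0) F" and I: "eventually (\<lambda>\<nu>. \<nu> \<in> I) F"
    and pair: "\<And>\<nu>. \<nu> \<in> I \<Longrightarrow> subgradient_pair M f x xs (C \<nu>) (\<tau> \<nu>) (u \<nu>) (v \<nu>)"
  shows "approximating M f x I F u v"
proof -
  have u: "u \<nu> \<in> borel_measurable M" and v: "integrable M (v \<nu>)"
    and u_le: "AE t in M. norm (x - u \<nu> t) \<le> \<tau> \<nu>" and sub: "AE t in M. v \<nu> t \<in> subdifferential (f t) (u \<nu> t)"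
    and vu: "\<bar>LINT t|M. v \<nu> t (u \<nu> t - x)\<bar> \<le> \<tau> \<nu>"
    and fu: "ereal_integral M (\<lambda>t. \<bar>f t (u \<nu> t) - f t x\<bar>) \<le> ereal (\<tau> \<nu>)" if "\<nu> \<in> I" for \<nu>
    using pair[OF that] unfolding subgradient_pair_def by blast+
  show ?thesis unfolding approximating_def
  proof (intro conjI ballI)
    fix \<nu> assume \<nu>: "\<nu> \<in> I"
    note [measurable] = u[OF \<nu>]
    have "Linf_norm M (u \<nu>) \<le> ennreal (norm x + \<tau> \<nu>)"
      unfolding Linf_norm_def
    proof (rule esssup_I)
      show "AE t in M. ennreal (norm (u \<nu> t)) \<le> ennreal (norm x + \<tau> \<nu>)" using u_le[OF \<nu>]
      proof eventually_elim
        case (elim t)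
        have "norm (u \<nu> t) \<le> norm x + norm (x - u \<nu> t)" using norm_triangle_sub[of "u \<nu> t" x] by (simp add: norm_minus_commute)
        then show ?case using elim by (intro ennreal_leI) simp
      qed
    qed measurable
    then show "u \<nu> \<in> Linf M" using u[OF \<nu>] by (auto simp: Linf_def intro: le_less_trans)
    show "integrable M (v \<nu>)" "AE t in M. v \<nu> t \<in> subdifferential (f t) (u \<nu> t)" by (rule v[OF \<nu>] sub[OF \<nu>])+
  next
    show "((\<lambda>\<nu>. Linf_norm M (\<lambda>t. x - u \<nu> t)) \<longlongrightarrow> 0) F"
    proof (rule tendsto_sandwich[OF _ _ tendsto_const])
      show "((\<lambda>\<nu>. ennreal (\<tau> \<nu>)) \<longlongrightarrow> 0) F" using tendsto_ennrealI[OF \<tau>] by simp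
      show "eventually (\<lambda>\<nu>. Linf_norm M (\<lambda>t. x - u \<nu> t) \<le> ennreal (\<tau> \<nu>)) F" using I
      proof eventually_elim
        case (elim \<nu>)
        note [measurable] = u[OF elim]
        show ?case unfolding Linf_norm_def
        proof (rule esssup_I)
          show "AE t in M. ennreal (norm (x - u \<nu> t)) \<le> ennreal (\<tau> \<nu>)"
            using u_le[OF elim] by eventually_elim (rule ennreal_leI)
        qed measurable
      qed
    qed simp
    show "((\<lambda>\<nu>. LINT t|M. v \<nu> t (u \<nu> t - x)) \<longlongrightarrow> 0) F"
      by (rule Lim_null_comparison[OF _ \<tau>]) (use I vu in \<open>auto elim: eventually_mono\<close>)
    show "((\<lambda>\<nu>. ereal_integral M (\<lambda>t. \<bar>f t (u \<nu> t) - f t x\<bar>)) \<longlongrightarrow> 0) F"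
    proof (rule tendsto_sandwich[OF _ _ tendsto_const])
      show "((\<lambda>\<nu>. ereal (\<tau> \<nu>)) \<longlongrightarrow> 0) F" using tendsto_ereal[OF \<tau>] by (simp add: zero_ereal_def)
      show "eventually (\<lambda>\<nu>. ereal_integral M (\<lambda>t. \<bar>f t (u \<nu> t) - f t x\<bar>) \<le> ereal (\<tau> \<nu>)) F"
        using I fu by (auto elim: eventually_mono)
    qed (simp add: ereal_integral_nonneg)
  qed
qed

section \<open>Nets and the final equivalences\<close>

lemma tails_ne_bot: "directed_set I r \<Longrightarrow> tails I r \<noteq> bot"
proof
  assume I: "directed_set I r" and "tails I r = bot"
  then have "eventually (\<lambda>_. False) (tails I r)" by simp
  then obtain i where "i \<in> I" "\<forall>j\<in>I. (i, j) \<in> r \<longrightarrow> False" unfolding eventually_tails[OF I] by blast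
  then show False using I unfolding directed_set_def preorder_on_def refl_on_def by blast
qed

lemma eventually_tails_in: "directed_set I r \<Longrightarrow> eventually (\<lambda>\<nu>. \<nu> \<in> I) (tails I r)"
  unfolding eventually_tails by (auto simp: directed_set_def)

lemma directed_finite_sets_nat:
  "directed_set {(Y, n). finite Y} {((Y, n), (Y', n')). finite Y \<and> finite Y' \<and> Y \<subseteq> Y' \<and> (n::nat) \<le> n'}"
  (is "directed_set ?I ?r")
  unfolding directed_set_def
proof (intro conjI ballI)
  show "?I \<noteq> {}" by auto
  show "preorder_on ?I ?r" unfolding preorder_on_def refl_on_def trans_def by auto
  fix i j assume "i \<in> ?I" "j \<in> ?I"
  then show "\<exists>k\<in>?I. (i, k) \<in> ?r \<and> (j, k) \<in> ?r"
    by (intro bexI[of _ "(fst i \<union> fst j, max (snd i) (snd j))"]) auto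
qed

lemma subgradient_of_net:
  assumes "normal_integrand M f" "\<bar>integral_functional M f x\<bar> \<noteq> \<infinity>"
    and "directed_set I r" "approximating M f x I (tails I r) u v"
    and "\<forall>y. ((\<lambda>\<nu>. blinfun_apply (LINT t|M. v \<nu> t) y) \<longlongrightarrow> blinfun_apply xs y) (tails I r)"
  shows "xs \<in> subdifferential (integral_functional M f) x"
  using subgradient_of_approximating[OF assms(1,2,4) tails_ne_bot[OF assms(3)] eventually_tails_in[OF assms(3)]] assms(5)
  by blast

text \<open>Existence of a net is claimed for one concrete index type, sufficiency for an arbitrary
  one; the second conjunct records the latter. Finiteness of the integral of \<open>g\<close> at
  \<open>x\<close> provides the integrable term \<open>c\<close> of the minorant.\<close>

theorem corollary3p8:
  fixes M :: "'t measure"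
    and f g :: "'t \<Rightarrow> 'a::separable_asplund \<Rightarrow> ereal"
    and x :: 'a
    and xs :: "'a \<Rightarrow>\<^sub>L real"
  assumes "complete_measure M"
    and "sigma_finite_measure M"
    and "C1_on (- {0}) (norm :: 'a \<Rightarrow> real)"
    and "normal_integrand M f"
    and "normal_integrand M g"
    and "\<And>t y. t \<in> space M \<Longrightarrow> g t y \<le> f t y"
    and "\<And>t y. t \<in> space M \<Longrightarrow> \<bar>g t y\<bar> \<noteq> \<infinity>"
    and "\<And>t. t \<in> space M \<Longrightarrow> C1_on UNIV (\<lambda>y. real_of_ereal (g t y))"
    and "(\<lambda>t. SUP y. ennreal (norm (gradient (\<lambda>z. real_of_ereal (g t z)) y))) \<in> borel_measurable M"
    and "(\<integral>\<^sup>+ t. (SUP y. ennreal (norm (gradient (\<lambda>z. real_of_ereal (g t z)) y))) \<partial>M) < \<infinity>"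
    and "\<And>t. t \<in> space M \<Longrightarrow> convex_ereal (f t)"
    and "\<bar>integral_functional M f x\<bar> \<noteq> \<infinity>"
    and "\<bar>integral_functional M g x\<bar> \<noteq> \<infinity>"
  shows "(xs \<in> subdifferential (integral_functional M f) x \<longleftrightarrow>
            (\<exists>(I :: ('a set \<times> nat) set) r u v.
               directed_set I r \<and>
               approximating M f x I (tails I r) u v \<and>
               (\<forall>y. ((\<lambda>\<nu>. blinfun_apply (LINT t|M. v \<nu> t) y) \<longlongrightarrow> blinfun_apply xs y) (tails I r))))
       \<and> (\<forall>(I :: 'i set) r u v.
               directed_set I r \<and>
               approximating M f x I (tails I r) u v \<and>
               (\<forall>y. ((\<lambda>\<nu>. blinfun_apply (LINT t|M. v \<nu> t) y) \<longlongrightarrow> blinfun_apply xs y) (tails I r))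
               \<longrightarrow> xs \<in> subdifferential (integral_functional M f) x)
       \<and> (reflexive_space TYPE('a) \<longrightarrow>
            (xs \<in> subdifferential (integral_functional M f) x \<longleftrightarrow>
               (\<exists>u v.
                  approximating M f x (UNIV :: nat set) sequentially u v \<and>
                  (\<lambda>n. LINT t|M. v n t) \<longlonglongrightarrow> xs)))"
proof -
  let ?E = "integral_functional M f"
  note f = assms(4) and Ef = assms(12)
  obtain c k where ck: "integrable M c" "integrable M k" "\<And>t. t \<in> space M \<Longrightarrow> 0 \<le> k t"
    "AE t in M. \<forall>y. ereal (c t - k t * norm (y - x)) \<le> f t y"
    using lipschitz_minorant[OF assms(5-10,13)] by blast
  have approx: "\<exists>u v. subgradient_pair M f x xs C \<tau> u v"
    if "xs \<in> subdifferential ?E x" "weak_disc C" "0 < \<tau>" for C \<tau>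
    by (rule integral_functional_subgradient_approximation[OF assms(1-3) f assms(11) Ef ck that])
  have ex_net: "\<exists>(I :: ('a set \<times> nat) set) r u v. directed_set I r \<and> approximating M f x I (tails I r) u v \<and>
      (\<forall>y. ((\<lambda>\<nu>. blinfun_apply (LINT t|M. v \<nu> t) y) \<longlongrightarrow> blinfun_apply xs y) (tails I r))"
    if xs: "xs \<in> subdifferential ?E x"
  proof -
    define I :: "('a set \<times> nat) set" where "I = {(Y, n). finite Y}"
    define r :: "('a set \<times> nat) rel" where "r = {((Y, n), (Y', n')). finite Y \<and> finite Y' \<and> Y \<subseteq> Y' \<and> n \<le> n'}"
    define \<tau> :: "'a set \<times> nat \<Rightarrow> real" where "\<tau> \<nu> = 1 / real (Suc (snd \<nu>))" for \<nu>
    have dir: "directed_set I r" unfolding I_def r_def by (rule directed_finite_sets_nat)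
    have "\<exists>u v. \<nu> \<in> I \<longrightarrow> subgradient_pair M f x xs (fst \<nu>) (\<tau> \<nu>) u v" for \<nu>
    proof (cases "\<nu> \<in> I")
      case True
      then have "finite (fst \<nu>)" by (auto simp: I_def)
      \<comment> \<open>The finite set itself need not be a disc; the estimate is obtained on a
        larger disc and restricted to it.\<close>
      then obtain C where C: "weak_disc C" "fst \<nu> \<subseteq> C" using weak_disc_containing_finite by blast
      have "0 < \<tau> \<nu>" by (simp add: \<tau>_def)
      from approx[OF xs C(1) this] show ?thesis using C(2) unfolding subgradient_pair_def by blast
    qed blast
    then obtain u v where pair: "\<And>\<nu>. \<nu> \<in> I \<Longrightarrow> subgradient_pair M f x xs (fst \<nu>) (\<tau> \<nu>) (u \<nu>) (v \<nu>)" by metis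
    have ev: "eventually (\<lambda>\<nu>. \<nu> \<in> I \<and> y \<in> fst \<nu> \<and> \<tau> \<nu> < e) (tails I r)" if e: "0 < e" for e y
    proof -
      obtain n where n: "1 / real (Suc n) < e" using nat_approx_posE[OF e] by blast
      show ?thesis unfolding eventually_tails[OF dir]
      proof (intro bexI ballI impI)
        show "({y}, n) \<in> I" by (simp add: I_def)
        fix j assume j: "j \<in> I" "(({y}, n), j) \<in> r"
        then have "n \<le> snd j" "y \<in> fst j" by (auto simp: r_def)
        moreover from this have "\<tau> j \<le> 1 / real (Suc n)" unfolding \<tau>_def by (intro divide_left_mono) auto
        ultimately show "j \<in> I \<and> y \<in> fst j \<and> \<tau> j < e" using j n by simp
      qed
    qed
    have \<tau>_lim: "(\<tau> \<longlongrightarrow> 0) (tails I r)"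
    proof (rule tendstoI)
      fix e :: real assume "0 < e"
      from ev[OF this, of 0] show "eventually (\<lambda>\<nu>. dist (\<tau> \<nu>) 0 < e) (tails I r)"
        by eventually_elim (simp add: \<tau>_def)
    qed
    have "approximating M f x I (tails I r) u v"
      by (rule approximatingI[OF \<tau>_lim eventually_tails_in[OF dir] pair])
    moreover have "((\<lambda>\<nu>. blinfun_apply (LINT t|M. v \<nu> t) y) \<longlongrightarrow> blinfun_apply xs y) (tails I r)" for y
    proof (rule tendstoI)
      fix e :: real assume "0 < e"
      from ev[OF this, of y] show "eventually (\<lambda>\<nu>. dist (blinfun_apply (LINT t|M. v \<nu> t) y) (xs y) < e) (tails I r)"
      proof eventually_elim
        case (elim \<nu>)
        then have "\<bar>(LINT t|M. v \<nu> t) y - xs y\<bar> \<le> \<tau> \<nu>" using pair unfolding subgradient_pair_def by blast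
        then show ?case using elim by (simp add: dist_real_def)
      qed
    qed
    ultimately show ?thesis using dir by blast
  qed
  have seq_iff: "xs \<in> subdifferential ?E x \<longleftrightarrow>
      (\<exists>u v. approximating M f x (UNIV :: nat set) sequentially u v \<and> (\<lambda>n. LINT t|M. v n t) \<longlonglongrightarrow> xs)"
    if refl: "reflexive_space TYPE('a)"
  proof
    assume xs: "xs \<in> subdifferential ?E x"
    define \<tau> where "\<tau> n = 1 / real (Suc n)" for n
    have \<tau>_lim: "\<tau> \<longlonglongrightarrow> 0" unfolding \<tau>_def by (rule LIMSEQ_Suc[OF lim_1_over_n])
    have "\<exists>u v. subgradient_pair M f x xs (cball 0 1) (\<tau> n) u v" for n
      by (rule approx[OF xs weak_disc_cball[OF refl]]) (simp add: \<tau>_def)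
    then obtain u v where pair: "\<And>n. subgradient_pair M f x xs (cball 0 1) (\<tau> n) (u n) (v n)" by metis
    have "approximating M f x (UNIV :: nat set) sequentially u v"
      by (rule approximatingI[OF \<tau>_lim _ pair]) simp
    \<comment> \<open>A uniform bound on the unit ball is a bound in the dual norm, whence norm
      convergence.\<close>
    moreover have "(\<lambda>n. LINT t|M. v n t) \<longlonglongrightarrow> xs"
    proof (rule LIM_zero_cancel, rule Lim_null_comparison[OF always_eventually[OF allI] \<tau>_lim])
      fix n
      show "norm ((LINT t|M. v n t) - xs) \<le> \<tau> n"
      proof (rule norm_blinfun_bound)
        show "0 \<le> \<tau> n" by (simp add: \<tau>_def)
        fix h :: 'a
        show "norm (((LINT t|M. v n t) - xs) h) \<le> \<tau> n * norm h"
        proof (cases "h = 0")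
          case False
          have "h /\<^sub>R norm h \<in> cball 0 1" using False by simp
          then have "\<bar>(LINT t|M. v n t) (h /\<^sub>R norm h) - xs (h /\<^sub>R norm h)\<bar> \<le> \<tau> n" using pair unfolding subgradient_pair_def by blast
          then show ?thesis using False
            by (simp add: blinfun.scaleR_right blinfun.diff_left abs_mult field_simps flip: right_diff_distrib)
        qed simp
      qed
    qed
    ultimately show "\<exists>u v. approximating M f x (UNIV :: nat set) sequentially u v \<and> (\<lambda>n. LINT t|M. v n t) \<longlonglongrightarrow> xs" by blast
  next
    assume "\<exists>u v. approximating M f x (UNIV :: nat set) sequentially u v \<and> (\<lambda>n. LINT t|M. v n t) \<longlonglongrightarrow> xs"
    then obtain u v where uv: "approximating M f x (UNIV :: nat set) sequentially u v" "(\<lambda>n. LINT t|M. v n t) \<longlonglongrightarrow> xs" by blast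
    have "(\<lambda>n. blinfun_apply (LINT t|M. v n t) y) \<longlonglongrightarrow> xs y" for y
      by (intro blinfun.tendsto uv(2) tendsto_const)
    then show "xs \<in> subdifferential ?E x"
      by (intro subgradient_of_approximating[OF f Ef uv(1)]) auto
  qed
  show ?thesis
  proof (intro conjI)
    show "xs \<in> subdifferential ?E x \<longleftrightarrow> (\<exists>(I :: ('a set \<times> nat) set) r u v. directed_set I r \<and> approximating M f x I (tails I r) u v \<and>
        (\<forall>y. ((\<lambda>\<nu>. blinfun_apply (LINT t|M. v \<nu> t) y) \<longlongrightarrow> blinfun_apply xs y) (tails I r)))"
      using ex_net subgradient_of_net[OF f Ef] by blast
    show "\<forall>(I :: 'i set) r u v. directed_set I r \<and> approximating M f x I (tails I r) u v \<and>
        (\<forall>y. ((\<lambda>\<nu>. blinfun_apply (LINT t|M. v \<nu> t) y) \<longlongrightarrow> blinfun_apply xs y) (tails I r))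
        \<longrightarrow> xs \<in> subdifferential ?E x"
      using subgradient_of_net[OF f Ef] by blast
  qed (use seq_iff in blast)
qed

end
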